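(* Let $L_1,L_2$ be two $D$-invariant subspaces of $C^\infty(a,b)$, with discrete simple spectra, having common residual subspace $L_{1,I}=L_{2,I}$ (or, which is the same, common residual interval $I$). If $$\sigma(D|_{L_1})=\sigma(D|_{L_2}),$$ then either $L_1\subset L_2$ or $L_2\subset L_1$.
   Context: $C^\infty(a,b)$ is the space of infinitely differentiable functions on the interval $(a,b)$ with its usual countably normed topology (uniform convergence of all derivatives on compact subsets of $(a,b)$), and $Df=f'$. A $D$-invariant subspace is a closed linear subspace $L$ of $C^\infty(a,b)$ with $DL\subset L$. Its spectrum $\sigma(D|_L)$ is the set of $\mu\in\mathbb{C}$ for which $D|_L-\mu I:L\to L$ is not invertible. It is known that $\sigma(D|_L)$ is either empty, or all of $\mathbb{C}$, or a discrete set of eigenvalues. The discrete spectrum is simple if each eigenvalue has multiplicity one, i.e. $e^{\mu t}\in L$ but $te^{\mu t}\notin L$ for each $\mu\in\sigma(D|_L)$. For a relatively closed subinterval $I$ of $(a,b)$ put $L_I=\{f\in C^\infty(a,b):f|_I\equiv0\}$ (if $I=\{c\}$ is one point, $L_I$ is the set of $f$ with $f^{(k)}(c)=0$ for all $k\ge 0$). If $\sigma(D|_L)\neq\mathbb{C}$, there is a unique minimal relatively closed subinterval $I$ of $(a,b)$ with $L_I\subset L$; it is called the residual interval of $L$, and $L_I$ the residual subspace of $L$. *)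

theory Defs
  imports "HOL-Analysis.Analysis" "HOL-Library.Function_Algebras"
begin

text \<open>
  A function on the open interval \<open>einterval a b\<close>, which may be unbounded, is represented by its
  extension by zero to the real line. This makes the representation unique, and
  sums and scalar multiples can be taken pointwise on the whole line.
\<close>

definition deriv_op :: "ereal \<Rightarrow> ereal \<Rightarrow> (real \<Rightarrow> complex) \<Rightarrow> real \<Rightarrow> complex" where
  "deriv_op a b f = (\<lambda>t. if t \<in> einterval a b then vector_derivative f (at t) else 0)"

definition smooth_functions :: "ereal \<Rightarrow> ereal \<Rightarrow> (real \<Rightarrow> complex) set" where
  "smooth_functions a b =
     {f. (\<forall>t. t \<notin> einterval a b \<longrightarrow> f t = 0) \<and>
         (\<forall>k. \<forall>t\<in>einterval a b. ((deriv_op a b ^^ k) f) differentiable (at t))}"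

text \<open>
  The sets below are the open balls of the seminorms \<open>f \<mapsto> sup\<^sub>K |f\<^sup>(\<^sup>k\<^sup>)|\<close>: on the compact set
  \<open>K\<close> the supremum is attained, so the pointwise strict bound is a strict bound on the supremum.
\<close>

definition smooth_topology :: "ereal \<Rightarrow> ereal \<Rightarrow> (real \<Rightarrow> complex) topology" where
  "smooth_topology a b = topology_generated_by
     {{g \<in> smooth_functions a b.
         \<forall>t\<in>K. norm ((deriv_op a b ^^ k) g t - (deriv_op a b ^^ k) f t) < e} | f K k e.
       f \<in> smooth_functions a b \<and> compact K \<and> K \<subseteq> einterval a b \<and> e > 0}"

interpretation cfun: vector_space "\<lambda>(c::complex) (f::real \<Rightarrow> complex) t. c * f t"
  by unfold_locales (auto simp: fun_eq_iff algebra_simps)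

definition D_invariant_subspace :: "ereal \<Rightarrow> ereal \<Rightarrow> (real \<Rightarrow> complex) set \<Rightarrow> bool" where
  "D_invariant_subspace a b L \<longleftrightarrow>
     cfun.subspace L \<and> closedin (smooth_topology a b) L \<and> deriv_op a b ` L \<subseteq> L"

text \<open>
  Invertibility on \<open>L\<close> is bijectivity. A closed subspace of the Fr\'echet space of smooth functions
  is Fr\'echet, so by the open mapping theorem the inverse is then continuous.
\<close>

definition D_spectrum :: "ereal \<Rightarrow> ereal \<Rightarrow> (real \<Rightarrow> complex) set \<Rightarrow> complex set" where
  "D_spectrum a b L = {\<mu>. \<not> bij_betw (\<lambda>f t. deriv_op a b f t - \<mu> * f t) L L}"

definition exp_monomial :: "ereal \<Rightarrow> ereal \<Rightarrow> nat \<Rightarrow> complex \<Rightarrow> real \<Rightarrow> complex" where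
  "exp_monomial a b n \<mu> =
     (\<lambda>t. if t \<in> einterval a b then of_real t ^ n * exp (\<mu> * of_real t) else 0)"

definition discrete_simple_spectrum :: "ereal \<Rightarrow> ereal \<Rightarrow> (real \<Rightarrow> complex) set \<Rightarrow> bool" where
  "discrete_simple_spectrum a b L \<longleftrightarrow>
     discrete (D_spectrum a b L) \<and>
     (\<forall>\<mu>\<in>D_spectrum a b L. exp_monomial a b 0 \<mu> \<in> L \<and> exp_monomial a b 1 \<mu> \<notin> L)"

definition relatively_closed_subinterval :: "ereal \<Rightarrow> ereal \<Rightarrow> real set \<Rightarrow> bool" where
  "relatively_closed_subinterval a b I \<longleftrightarrow>
     I \<noteq> {} \<and> is_interval I \<and> closedin (top_of_set (einterval a b)) I"

definition vanishing_subspace :: "ereal \<Rightarrow> ereal \<Rightarrow> real set \<Rightarrow> (real \<Rightarrow> complex) set" where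
  "vanishing_subspace a b I =
     (if \<exists>c. I = {c}
      then {f \<in> smooth_functions a b. \<forall>c\<in>I. \<forall>k. (deriv_op a b ^^ k) f c = 0}
      else {f \<in> smooth_functions a b. \<forall>t\<in>I. f t = 0})"

definition is_residual_interval :: "ereal \<Rightarrow> ereal \<Rightarrow> (real \<Rightarrow> complex) set \<Rightarrow> real set \<Rightarrow> bool" where
  "is_residual_interval a b L I \<longleftrightarrow>
     relatively_closed_subinterval a b I \<and> vanishing_subspace a b I \<subseteq> L \<and>
     (\<forall>J. relatively_closed_subinterval a b J \<and> vanishing_subspace a b J \<subseteq> L \<and> J \<subseteq> I \<longrightarrow> J = I)"

end

theory Submission
  imports Defs "HOL-Complex_Analysis.Complex_Analysis" "HOL-Real_Asymp.Real_Asymp"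
begin

text \<open>
  Suppose that \<open>f \<in> L\<^sub>1 - L\<^sub>2\<close> and \<open>g \<in> L\<^sub>2 - L\<^sub>1\<close>, and choose continuous functionals \<open>\<phi>\<close> and \<open>\<psi>\<close> that
  annihilate \<open>L\<^sub>2\<close> and \<open>L\<^sub>1\<close> respectively, with \<open>\<phi> f \<noteq> 0\<close> and \<open>\<psi> g \<noteq> 0\<close>. Their transforms vanish on
  the common simple spectrum, so the functions \<open>M k\<close> and \<open>N k\<close> that take \<open>l\<close> to \<open>\<phi> ((D - l)\<inverse> (D ^^ k) f)\<close>
  and to \<open>\<psi> ((D - l)\<inverse> (D ^^ k) g)\<close>, with the resolvents of \<open>D\<close> on \<open>L\<^sub>1\<close> and \<open>L\<^sub>2\<close>, are entire.
  Since \<open>\<phi>\<close> and \<open>\<psi>\<close> annihilate the common residual subspace, and the residual interval is sharp for the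
  annihilators, these functions have exponential type zero. At each point, depending on which of the
  transforms of \<open>\<phi>\<close> and \<open>\<psi>\<close> is larger in absolute value there, \<open>M k\<close> or \<open>N k\<close> is bounded by a polynomial
  of a degree \<open>p\<close> that does not depend on \<open>k\<close>. For two entire functions of exponential type zero this
  implies that one of them is a polynomial of degree at most \<open>p\<close>, because their logarithms
  would otherwise be essentially subharmonic functions with disjoint supports that grow too slowly.
  As \<open>M (k + 1) l = l * M k l + \<phi> ((D ^^ k) f)\<close>, the case \<open>k = p + 2\<close> gives \<open>\<phi> f = 0\<close> or \<open>\<psi> g = 0\<close>.
\<close>

section \<open>Phragmen-Lindelof estimates\<close>

text \<open>The obstacle is the exponential type of \<open>M k\<close>. It is a quotient of entire
  functions of exponential type, and its denominator has zeros, so it can only be estimated through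
  lower bounds. In each half-plane the denominator, freed of its exponential factor, is bounded by a
  polynomial; division by Blaschke factors and Harnack's inequality then bound the quotient by exp
  (\<epsilon> |z|^2 / |Re z|), provided that the denominator is not too small at one far point of
  the real axis. Sharpness of the residual interval supplies such points. The estimate degenerates
  at the imaginary axis, where a barrier in squares repairs it. Simplicity of the spectrum enters
  because a transform with a zero of order one at a spectral point divides, near that point, every
  transform that vanishes there. The degree \<open>p\<close> is the order of the two functionals,
  which differentiating f or g leaves alone. Type zero is the exact threshold: for two nonnegative
  subharmonic functions with disjoint supports the product of the mean squares grows at least like
  r^4, while o(r) for each makes it o(r^4).\<close>

lemma norm_blaschke_circle:
  fixes a w :: complex
  assumes "norm w = 1"
  shows "norm (1 - cnj a * w) = norm (w - a)"
proof -
  have "w * cnj w = 1" using assms by (simp add: complex_norm_square[symmetric])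
  then have "1 - cnj a * w = w * cnj (w - a)" by (simp add: algebra_simps)
  then show ?thesis using assms by (simp add: norm_mult del: complex_cnj_diff)
qed

lemma holomorphic_le_1_cball:
  fixes f :: "complex \<Rightarrow> complex"
  assumes "f holomorphic_on ball 0 R" "R > 1" "\<And>w. norm w = 1 \<Longrightarrow> norm (f w) \<le> 1" "norm z \<le> 1"
  shows "norm (f z) \<le> 1"
proof (rule maximum_modulus_frontier[of f "cball 0 1"])
  show "f holomorphic_on interior (cball 0 1)"
    by (rule holomorphic_on_subset[OF assms(1)]) (use \<open>R > 1\<close> in auto)
  have "cball 0 1 \<subseteq> ball (0::complex) R" using \<open>R > 1\<close> by auto
  then show "continuous_on (closure (cball 0 1)) f"
    using holomorphic_on_imp_continuous_on[OF assms(1)] by (auto intro: continuous_on_subset)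
qed (use assms in \<open>auto\<close>)

text \<open>Dividing \<open>B\<close> by the Blaschke factor of a zero \<open>a\<close> leaves the
  moduli of \<open>B\<close> and \<open>M * B\<close> on the unit circle unchanged, so both bounds
  survive inside by the maximum principle. The value at 0 grows by the factor 1 / |a| > 1 / s and
  cannot exceed 1, so \<open>n\<close> bounds the number of divisions.\<close>

lemma remove_zeros:
  fixes B M :: "complex \<Rightarrow> complex"
  assumes "R > 1" "0 < s" "s < 1"
    and M: "M holomorphic_on ball 0 R"
  assumes "B holomorphic_on ball 0 R"
    and "\<And>w. norm w \<le> 1 \<Longrightarrow> norm (B w) \<le> 1" "\<And>w. norm w \<le> 1 \<Longrightarrow> norm (M w * B w) \<le> 1"
    and "norm (B 0) \<ge> s ^ n"
  shows "\<exists>B'. B' holomorphic_on ball 0 R \<and> (\<forall>w. norm w \<le> 1 \<longrightarrow> norm (B' w) \<le> 1 \<and> norm (M w * B' w) \<le> 1)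
    \<and> norm (B 0) \<le> norm (B' 0) \<and> (\<forall>w. norm w < s \<longrightarrow> B' w \<noteq> 0)"
  using assms(5-)
proof (induction n arbitrary: B)
  case (0 B) show ?case
  proof (cases "\<exists>a. norm a < s \<and> B a = 0")
    case False then show ?thesis using 0 by blast
  next
    case True
    then obtain a where a: "norm a < s" "B a = 0" by blast
    \<comment> \<open>Here |B 0| = 1 is the maximal modulus and is attained inside, so
      \<open>B\<close> is a unimodular constant and cannot have the zero \<open>a\<close>.\<close>
    have "B constant_on (ball 0 1)"  if "norm (B 0) = 1"
      unfolding constant_on_def
      using maximum_modulus_principle[of B "ball 0 1" "ball 0 1" 0] 0 that \<open>R > 1\<close>
      by (force simp: constant_on_def intro: holomorphic_on_subset)
    moreover have "norm (B 0) = 1" using 0(2)[of 0] 0(4) by simp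
    ultimately obtain c where "\<And>w. norm w < 1 \<Longrightarrow> B w = c" by (auto simp: constant_on_def)
    then have "B 0 = B a" using a \<open>s < 1\<close> by simp
    then show ?thesis using a \<open>norm (B 0) = 1\<close> by simp
  qed
next
  case (Suc n B) show ?case
  proof (cases "\<exists>a. norm a < s \<and> B a = 0")
    case False then show ?thesis using Suc.prems by blast
  next
    case True
    then obtain a where a: "norm a < s" "B a = 0" by blast
    have "a \<noteq> 0" using a Suc.prems(4) \<open>0 < s\<close> by (metis norm_zero zero_less_power not_le)
    define g where "g = (\<lambda>z. if z = a then deriv B a else (B z - B a) / (z - a))"
    define B1 where "B1 = (\<lambda>z. g z * (1 - cnj a * z))"
    have g: "g holomorphic_on ball 0 R"
      unfolding g_def by (rule pole_lemma_open[OF Suc.prems(1)]) simp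
    have B1: "B1 holomorphic_on ball 0 R" unfolding B1_def by (intro holomorphic_intros g)
    have circ: "norm (B1 w) = norm (B w)" if "norm w = 1" for w
    proof -
      have "w \<noteq> a" using that a \<open>s < 1\<close> by auto
      then show ?thesis using norm_blaschke_circle[OF that, of a] a
        by (simp add: B1_def g_def norm_mult norm_divide)
    qed
    have b1: "norm (B1 w) \<le> 1" if "norm w \<le> 1" for w
      by (rule holomorphic_le_1_cball[OF B1 \<open>R > 1\<close> _ that]) (use circ Suc.prems in auto)
    have b2: "norm (M w * B1 w) \<le> 1" if "norm w \<le> 1" for w
    proof (rule holomorphic_le_1_cball[OF _ \<open>R > 1\<close> _ that, of "\<lambda>w. M w * B1 w"])
      show "(\<lambda>w. M w * B1 w) holomorphic_on ball 0 R" by (intro holomorphic_intros M B1)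
      show "norm (M w * B1 w) \<le> 1" if "norm w = 1" for w
        using circ[OF that] Suc.prems(3)[of w] that by (simp add: norm_mult)
    qed
    have B10: "norm (B1 0) = norm (B 0) / norm a"
      using a \<open>a \<noteq> 0\<close> by (simp add: B1_def g_def norm_divide)
    have "norm (B 0) \<ge> s * s ^ n" using Suc.prems(4) by simp
    moreover have "norm (B1 0) * norm a = norm (B 0)" using B10 \<open>a \<noteq> 0\<close> by simp
    moreover have "norm (B1 0) * norm a \<le> norm (B1 0) * s" using a by (intro mult_left_mono) auto
    ultimately have "s * s ^ n \<le> s * norm (B1 0)" by (simp add: mult.commute)
    then have n: "s ^ n \<le> norm (B1 0)" using \<open>0 < s\<close> by simp
    have le: "norm (B 0) \<le> norm (B1 0)"
    proof -
      have "norm (B1 0) * norm a \<le> norm (B1 0) * 1" using a \<open>s < 1\<close> by (intro mult_left_mono) auto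
      then show ?thesis using \<open>norm (B1 0) * norm a = norm (B 0)\<close> by simp
    qed
    obtain B' where B': "B' holomorphic_on ball 0 R"
      "\<forall>w. norm w \<le> 1 \<longrightarrow> norm (B' w) \<le> 1 \<and> norm (M w * B' w) \<le> 1"
      "norm (B1 0) \<le> norm (B' 0)" "\<forall>w. norm w < s \<longrightarrow> B' w \<noteq> 0"
      using Suc.IH[OF B1 b1 b2 n] by blast
    have "norm (B 0) \<le> norm (B' 0)" using le B'(3) by linarith
    with B' show ?thesis by blast
  qed
qed

text \<open>Schwarz's lemma for the Cayley transform \<open>k\<close>, which maps the left
  half-plane to the disc and \<open>H 0\<close> to 0, gives Harnack's inequality for the nonnegative
  harmonic function - Re h.\<close>

lemma Re_nonpos_harnack:
  fixes h :: "complex \<Rightarrow> complex"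
  assumes h: "h holomorphic_on ball 0 s" and s: "norm w < s"
    and neg: "\<And>z. norm z < s \<Longrightarrow> Re (h z) \<le> 0"
  shows "- Re (h w) \<le> - Re (h 0) * ((s + norm w) / (s - norm w))"
proof -
  define \<tau> where "\<tau> = norm w / s"
  have "s > 0" using s norm_ge_zero[of w] by linarith
  then have \<tau>: "0 \<le> \<tau>" "\<tau> < 1" using s by (auto simp: \<tau>_def)
  \<comment> \<open>Subtracting \<open>d\<close> makes the real part strictly negative, which keeps
    the denominator of \<open>k\<close> away from 0; \<open>d\<close> tends to 0 at the end.\<close>
  have *: "- Re (h w) \<le> (d - Re (h 0)) * ((1 + \<tau>) / (1 - \<tau>))" if "d > 0" for d
  proof -
    define H where "H = (\<lambda>z. h (of_real s * z) - of_real d)"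
    define k where "k = (\<lambda>z. (H z - H 0) / (H z + cnj (H 0)))"
    have neg': "Re (H z) < 0" if "norm z < 1" for z
    proof -
      have "norm (of_real s * z) < s" using that \<open>s > 0\<close> by (simp add: norm_mult)
      then show ?thesis using neg[of "of_real s * z"] \<open>d > 0\<close> by (simp add: H_def)
    qed
    have nz: "H z + cnj (H 0) \<noteq> 0" if "norm z < 1" for z
    proof
      assume "H z + cnj (H 0) = 0"
      then have "Re (H z) + Re (H 0) = 0" by (metis cnj.simps(1) plus_complex.simps(1) zero_complex.simps(1))
      then show False using neg'[OF that] neg'[of 0] by simp
    qed
    have H: "H holomorphic_on ball 0 1" unfolding H_def
      by (intro holomorphic_intros holomorphic_on_compose_gen[OF _ h, unfolded o_def])
        (use \<open>s > 0\<close> in \<open>auto simp: norm_mult\<close>)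
    have k: "k holomorphic_on ball 0 1" unfolding k_def
      by (intro holomorphic_intros H) (use nz in auto)
    have k1: "norm (k z) < 1" if "norm z < 1" for z
    proof -
      have "(norm (H z + cnj (H 0)))\<^sup>2 - (norm (H z - H 0))\<^sup>2 = 4 * (Re (H z) * Re (H 0))"
        unfolding cmod_power2 by (simp add: power2_eq_square algebra_simps)
      moreover have "0 < Re (H z) * Re (H 0)" using mult_neg_neg[OF neg'[OF that] neg'[of 0]] by simp
      ultimately have "(norm (H z - H 0))\<^sup>2 < (norm (H z + cnj (H 0)))\<^sup>2" by linarith
      then have "norm (H z - H 0) < norm (H z + cnj (H 0))"
        by (simp add: power_less_imp_less_base)
      then show ?thesis using nz[OF that] by (simp add: k_def norm_divide)
    qed
    define z where "z = w / of_real s"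
    have z: "norm z = \<tau>" using \<open>s > 0\<close> by (simp add: z_def \<tau>_def norm_divide)
    have Hz: "H z = h w - of_real d" using \<open>s > 0\<close> by (simp add: H_def z_def)
    have "norm (k z) \<le> norm z"
      by (rule Schwarz_Lemma(1)[OF k]) (use k1 \<tau> z in \<open>auto simp: k_def\<close>)
    then have "norm (H z - H 0) \<le> \<tau> * norm (H z + cnj (H 0))"
      using nz[of z] z \<tau> by (simp add: k_def norm_divide divide_simps)
    moreover have "norm (H z + cnj (H 0)) \<le> norm (H z - H 0) + (-2 * Re (H 0))"
    proof -
      have "H z + cnj (H 0) = (H z - H 0) + of_real (2 * Re (H 0))"
        by (simp add: complex_eq_iff)
      moreover have "norm (H z - H 0 + of_real (2 * Re (H 0))) \<le> norm (H z - H 0) + \<bar>2 * Re (H 0)\<bar>"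
        using norm_triangle_ineq[of "H z - H 0" "of_real (2 * Re (H 0))"] by (simp only: norm_of_real)
      moreover have "\<bar>2 * Re (H 0)\<bar> = - 2 * Re (H 0)" using neg'[of 0] by simp
      ultimately show ?thesis by (simp only:)
    qed
    ultimately have "norm (H z - H 0) \<le> \<tau> * (norm (H z - H 0) + (-2 * Re (H 0)))"
      using \<tau> by (meson mult_left_mono order_trans)
    then have "norm (H z - H 0) * (1 - \<tau>) \<le> -2 * \<tau> * Re (H 0)" by (simp add: algebra_simps)
    moreover have "- Re (H z) + Re (H 0) \<le> norm (H z - H 0)"
      using abs_Re_le_cmod[of "H z - H 0"] by simp
    then have "(- Re (H z) + Re (H 0)) * (1 - \<tau>) \<le> norm (H z - H 0) * (1 - \<tau>)"
      using \<tau> by (intro mult_right_mono) auto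
    ultimately have "- Re (H z) * (1 - \<tau>) \<le> - Re (H 0) * (1 + \<tau>)" by (simp add: algebra_simps)
    then have "- Re (H z) \<le> - Re (H 0) * ((1 + \<tau>) / (1 - \<tau>))" using \<tau> by (simp add: field_simps)
    then show ?thesis using Hz \<open>d > 0\<close> by (simp add: H_def)
  qed
  have "- Re (h w) \<le> (- Re (h 0)) * ((1 + \<tau>) / (1 - \<tau>))"
  proof (rule tendsto_lowerbound)
    show "((\<lambda>d. (d - Re (h 0)) * ((1 + \<tau>) / (1 - \<tau>))) \<longlongrightarrow> (- Re (h 0)) * ((1 + \<tau>) / (1 - \<tau>))) (at_right 0)"
      using \<tau> by (auto intro!: tendsto_eq_intros)
    show "\<forall>\<^sub>F d in at_right 0. - Re (h w) \<le> (d - Re (h 0)) * ((1 + \<tau>) / (1 - \<tau>))"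
      using * by (auto simp: eventually_at_right_field intro!: exI[of _ 1])
  qed auto
  moreover have "(1 + \<tau>) / (1 - \<tau>) = (s + norm w) / (s - norm w)"
    using \<open>s > 0\<close> s by (simp add: \<tau>_def field_simps)
  ultimately show ?thesis by simp
qed

text \<open>The zero-free \<open>B'\<close> has a holomorphic logarithm with nonpositive real part
  on the disc of radius \<open>s\<close>, and Harnack bounds |B'| from below by its value at 0. The
  bound on \<open>M * B'\<close> then turns into one on \<open>M\<close>. Passing from
  \<open>B\<close> to \<open>B'\<close> loses nothing, since the value at 0 can only grow.\<close>

lemma disc_bound_closed:
  fixes B M :: "complex \<Rightarrow> complex"
  assumes "R > 1" "s < 1" "norm w < s"
    and M: "M holomorphic_on ball 0 R"
  assumes "B holomorphic_on ball 0 R"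
    and "\<And>w. norm w \<le> 1 \<Longrightarrow> norm (B w) \<le> 1" "\<And>w. norm w \<le> 1 \<Longrightarrow> norm (M w * B w) \<le> 1"
    and "B 0 \<noteq> 0"
  shows "norm (M w) \<le> exp (- ln (norm (B 0)) * ((s + norm w) / (s - norm w)))"
proof -
  have "s > 0" using assms(3) norm_ge_zero[of w] by linarith
  obtain n where "s ^ n < norm (B 0)"
    using real_arch_pow_inv[of "norm (B 0)" s] assms by auto
  then obtain B' where B': "B' holomorphic_on ball 0 R"
    "\<And>w. norm w \<le> 1 \<Longrightarrow> norm (B' w) \<le> 1" "\<And>w. norm w \<le> 1 \<Longrightarrow> norm (M w * B' w) \<le> 1"
    "norm (B 0) \<le> norm (B' 0)" "\<And>w. norm w < s \<Longrightarrow> B' w \<noteq> 0"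
    using remove_zeros[OF \<open>R > 1\<close> \<open>s > 0\<close> \<open>s < 1\<close> M assms(5), of n] assms(6,7) by (metis less_imp_le)
  have "B' holomorphic_on ball 0 s"
    by (rule holomorphic_on_subset[OF B'(1)]) (use assms in auto)
  then obtain h where h: "h holomorphic_on ball 0 s" "\<And>z. z \<in> ball 0 s \<Longrightarrow> B' z = exp (h z)"
    using contractible_imp_holomorphic_log[of B' "ball 0 s"] B'(5)
    by (metis convex_ball convex_imp_contractible mem_ball_0)
  have neg: "Re (h z) \<le> 0" if "norm z < s" for z
    using B'(2)[of z] h(2)[of z] that \<open>s < 1\<close> by simp
  have H: "- Re (h w) \<le> - Re (h 0) * ((s + norm w) / (s - norm w))"
    by (rule Re_nonpos_harnack[OF h(1) assms(3) neg])
  have "norm (B' 0) = exp (Re (h 0))" using h(2)[of 0] \<open>s > 0\<close> by simp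
  then have "- Re (h 0) \<le> - ln (norm (B 0))" using B'(4) \<open>B 0 \<noteq> 0\<close>
    using ln_mono[of "norm (B 0)" "norm (B' 0)"] by simp
  then have "- Re (h 0) * ((s + norm w) / (s - norm w)) \<le> - ln (norm (B 0)) * ((s + norm w) / (s - norm w))"
    using assms(3) \<open>s > 0\<close> by (intro mult_right_mono) auto
  with H have "- Re (h w) \<le> - ln (norm (B 0)) * ((s + norm w) / (s - norm w))" by linarith
  moreover have "norm (M w) \<le> exp (- Re (h w))"
  proof -
    have "norm (M w) * exp (Re (h w)) \<le> 1" using B'(3)[of w] h(2)[of w] assms(2,3) by (simp add: norm_mult)
    then show ?thesis by (simp add: exp_minus field_simps)
  qed
  ultimately show ?thesis by (meson exp_le_cancel_iff order_trans)
qed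

lemma disc_bound:
  fixes B M :: "complex \<Rightarrow> complex"
  assumes w: "norm w < 1"
    and M: "M holomorphic_on ball 0 1" and B: "B holomorphic_on ball 0 1"
    and le: "\<And>w. norm w < 1 \<Longrightarrow> norm (B w) \<le> 1" "\<And>w. norm w < 1 \<Longrightarrow> norm (M w * B w) \<le> 1"
    and B0: "B 0 \<noteq> 0"
  shows "norm (M w) \<le> exp (- ln (norm (B 0)) * (4 / (1 - norm w)))"
proof -
  \<comment> \<open>\<open>s\<close> is both the dilation factor and the zero-free radius: after
    dilation the point is w / s, and it has to lie in the disc of radius \<open>s\<close>, that is
    |w| < s^2. The choice puts s^2 halfway between |w| and 1.\<close>
  define s where "s = sqrt ((1 + norm w) / 2)"
  have s2: "s * s = (1 + norm w) / 2" by (simp add: s_def)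
  have "0 < s" "s < 1" using w by (auto simp: s_def real_sqrt_lt_1_iff add_pos_nonneg)
  have ws: "norm w < s * s" using w s2 by simp
  have lt: "norm (of_real s * z) < 1" if "norm z \<le> 1" for z :: complex
  proof -
    have "s * norm z \<le> s * 1" using that \<open>0 < s\<close> by (intro mult_left_mono) auto
    moreover have "norm (of_real s * z) = s * norm z" using \<open>0 < s\<close> by (simp add: norm_mult)
    ultimately show ?thesis using \<open>s < 1\<close> by linarith
  qed
  have sub: "(\<lambda>z. of_real s * z) ` ball 0 (1 / s) \<subseteq> ball (0::complex) 1"
    using \<open>0 < s\<close> by (auto simp: norm_mult field_simps)
  have "norm (M (of_real s * (w / of_real s))) \<le> exp (- ln (norm (B (of_real s * 0))) * ((s + norm (w / of_real s)) / (s - norm (w / of_real s))))"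
  proof (rule disc_bound_closed[where R="1/s" and M = "\<lambda>z. M (of_real s * z)" and B = "\<lambda>z. B (of_real s * z)"])
    show "(\<lambda>z. M (of_real s * z)) holomorphic_on ball 0 (1 / s)" "(\<lambda>z. B (of_real s * z)) holomorphic_on ball 0 (1 / s)"
      using holomorphic_on_compose_gen[OF _ M sub] holomorphic_on_compose_gen[OF _ B sub]
      by (auto simp: o_def intro: holomorphic_intros)
    show "norm (w / of_real s) < s" using ws \<open>0 < s\<close> by (simp add: norm_divide field_simps)
  qed (use \<open>0 < s\<close> \<open>s < 1\<close> lt le B0 in auto)
  also have "(s + norm (w / of_real s)) / (s - norm (w / of_real s)) = (s * s + norm w) / (s * s - norm w)"
    using \<open>0 < s\<close> ws by (simp add: norm_divide field_simps)
  finally have *: "norm (M w) \<le> exp (- ln (norm (B 0)) * ((s * s + norm w) / (s * s - norm w)))"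
    using \<open>0 < s\<close> by simp
  have "(s * s + norm w) / (s * s - norm w) \<le> 2 / ((1 - norm w) / 2)"
  proof (rule frac_le)
    show "(0::real) \<le> 2" by simp
    show "s * s + norm w \<le> 2" "0 < (1 - norm w) / 2" "(1 - norm w) / 2 \<le> s * s - norm w"
      using w unfolding s2 by (auto simp: field_simps)
  qed
  then have "(s * s + norm w) / (s * s - norm w) \<le> 4 / (1 - norm w)" by simp
  moreover have "ln (norm (B 0)) \<le> 0" using le(1)[of 0] B0 by simp
  ultimately have "- ln (norm (B 0)) * ((s * s + norm w) / (s * s - norm w)) \<le> - ln (norm (B 0)) * (4 / (1 - norm w))"
    by (intro mult_left_mono) simp_all
  then show ?thesis using order_trans[OF *] by (simp only: exp_le_cancel_iff)
qed

text \<open>The Cayley map \<open>T\<close> sends 0 to -\<rho>, so \<open>disc_bound\<close> applies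
  with the loss \<epsilon> \<rho> at the centre and a factor of order |z|^2 / (\<rho> |Re z|). The
  radius \<rho> cancels, so the estimate is the same whichever far point the lower bound comes
  from.\<close>

lemma half_plane_bound:
  fixes B M :: "complex \<Rightarrow> complex"
  assumes M: "M holomorphic_on {z. Re z < 0}" and B: "B holomorphic_on {z. Re z < 0}"
    and le: "\<And>z. Re z < 0 \<Longrightarrow> norm (B z) \<le> 1" "\<And>z. Re z < 0 \<Longrightarrow> norm (M z * B z) \<le> 1"
    and \<rho>: "\<rho> > 0" "norm (B (- of_real \<rho>)) \<ge> exp (- \<epsilon> * \<rho>)" and z: "Re z < 0" "norm z \<ge> \<rho>"
  shows "norm (M z) \<le> exp (8 * \<epsilon> * (norm z)\<^sup>2 / \<bar>Re z\<bar>)"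
proof -
  define T :: "complex \<Rightarrow> complex" where "T = (\<lambda>w. - of_real \<rho> * (1 - w) / (1 + w))"
  have nz: "1 + w \<noteq> 0" if "norm w < 1" for w :: complex
    using that by (metis add_eq_0_iff norm_minus_cancel norm_one less_irrefl)
  have T: "T holomorphic_on ball 0 1"
    unfolding T_def by (intro holomorphic_intros) (use nz in auto)
  have ReT: "Re (T w) < 0" if "norm w < 1" for w
  proof -
    have "(1 - w) * cnj (1 + w) = of_real (1 - (norm w)\<^sup>2) + (cnj w - w)"
      using complex_norm_square[of w] by (simp add: algebra_simps)
    then have "Re ((1 - w) * cnj (1 + w)) = 1 - (norm w)\<^sup>2" by simp
    moreover have "(norm w)\<^sup>2 < 1" using that by (simp add: power_less_one_iff abs_square_less_1)
    ultimately have "Re ((1 - w) * cnj (1 + w)) > 0" by simp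
    then have "Re ((1 - w) / (1 + w)) > 0" using nz[OF that]
      by (subst complex_div_cnj) (simp add: Re_divide_of_real zero_less_divide_iff flip: of_real_power)
    moreover have "T w = of_real (-\<rho>) * ((1 - w) / (1 + w))" by (simp add: T_def)
    then have "Re (T w) = -\<rho> * Re ((1 - w) / (1 + w))"
      by (simp only: times_complex.simps Re_complex_of_real Im_complex_of_real)
    ultimately show ?thesis using \<open>\<rho> > 0\<close> by simp
  qed
  have sub: "T ` ball 0 1 \<subseteq> {z. Re z < 0}" using ReT by auto
  define w where "w = (of_real \<rho> + z) / (of_real \<rho> - z)"
  have "of_real \<rho> - z \<noteq> 0" using z \<rho> by (metis Re_complex_of_real eq_iff_diff_eq_0 not_less_iff_gr_or_eq)
  have Tw: "T w = z"
  proof -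
    have "1 + w = 2 * of_real \<rho> / (of_real \<rho> - z)" "1 - w = - 2 * z / (of_real \<rho> - z)"
      using \<open>of_real \<rho> - z \<noteq> 0\<close> by (auto simp: w_def field_simps)
    then show ?thesis using \<open>of_real \<rho> - z \<noteq> 0\<close> \<open>\<rho> > 0\<close> unfolding T_def by (simp only:) simp
  qed
  define x where "x = - Re z"
  have "x > 0" using z by (simp add: x_def)
  have sq: "(norm (of_real \<rho> - z))\<^sup>2 - (norm (of_real \<rho> + z))\<^sup>2 = 4 * \<rho> * x"
    unfolding cmod_power2 by (simp add: x_def power2_eq_square algebra_simps)
  define n where "n = (norm (of_real \<rho> - z))\<^sup>2"
  have "n > 0" using \<open>of_real \<rho> - z \<noteq> 0\<close> by (simp add: n_def)
  have w2: "1 - (norm w)\<^sup>2 = 4 * \<rho> * x / n"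
  proof -
    have "(norm (of_real \<rho> + z))\<^sup>2 = n - 4 * \<rho> * x" using sq by (simp add: n_def)
    then have "(norm w)\<^sup>2 = (n - 4 * \<rho> * x) / n" by (simp add: w_def norm_divide power_divide n_def)
    then show ?thesis using \<open>n > 0\<close> by (simp add: diff_divide_distrib)
  qed
  also have "\<dots> > 0" using \<open>x > 0\<close> \<open>n > 0\<close> \<open>\<rho> > 0\<close> by simp
  finally have w1: "norm w < 1" by (simp add: power_less_one_iff abs_square_less_1)
  have "norm ((M \<circ> T) w) \<le> exp (- ln (norm ((B \<circ> T) 0)) * (4 / (1 - norm w)))"
  proof (rule disc_bound[OF w1])
    show "(M \<circ> T) holomorphic_on ball 0 1" "(B \<circ> T) holomorphic_on ball 0 1"
      using holomorphic_on_compose_gen[OF T M sub] holomorphic_on_compose_gen[OF T B sub] by auto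
    have "norm (B (- of_real \<rho>)) > 0" using \<rho>(2) by (meson exp_gt_zero less_le_trans)
    then show "(B \<circ> T) 0 \<noteq> 0" by (auto simp: T_def)
  qed (use le ReT in auto)
  then have "norm (M z) \<le> exp (- ln (norm (B (- of_real \<rho>))) * (4 / (1 - norm w)))"
    using Tw by (simp add: T_def)
  moreover have "- ln (norm (B (- of_real \<rho>))) * (4 / (1 - norm w)) \<le> 8 * \<epsilon> * (norm z)\<^sup>2 / x"
  proof -
    have pos: "norm (B (- of_real \<rho>)) > 0" using \<rho>(2) by (meson exp_gt_zero less_le_trans)
    have l: "- ln (norm (B (- of_real \<rho>))) \<le> \<epsilon> * \<rho>"
      using ln_mono[OF \<rho>(2) exp_gt_zero] by simp
    have "- ln (norm (B (- of_real \<rho>))) \<ge> 0" using le(1)[of "- of_real \<rho>"] \<rho> pos by simp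
    then have e0: "\<epsilon> * \<rho> \<ge> 0" using l by linarith
    have "1 - (norm w)\<^sup>2 \<le> 2 * (1 - norm w)" 
      using mult_right_mono[of "1 + norm w" 2 "1 - norm w"] w1 by (simp add: power2_eq_square algebra_simps)
    then have "4 * \<rho> * x / n \<le> 2 * (1 - norm w)" using w2 by simp
    then have "4 / (1 - norm w) \<le> 2 * n / (\<rho> * x)"
      using w1 \<open>n > 0\<close> \<open>\<rho> > 0\<close> \<open>x > 0\<close> by (simp add: field_simps)
    moreover have "n \<le> 4 * (norm z)\<^sup>2"
    proof -
      have "norm (of_real \<rho> - z) \<le> 2 * norm z"
        using norm_triangle_ineq4[of "of_real \<rho>" z] z(2) \<rho>(1) unfolding norm_of_real by linarith
      then have "n \<le> (2 * norm z)\<^sup>2" unfolding n_def by (rule power_mono) simp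
      then show ?thesis unfolding power_mult_distrib by simp
    qed
    then have "2 * n / (\<rho> * x) \<le> 2 * (4 * (norm z)\<^sup>2) / (\<rho> * x)"
      using \<open>\<rho> > 0\<close> \<open>x > 0\<close> by (intro divide_right_mono) auto
    ultimately have "4 / (1 - norm w) \<le> 8 * (norm z)\<^sup>2 / (\<rho> * x)" by simp
    then have "- ln (norm (B (- of_real \<rho>))) * (4 / (1 - norm w)) \<le> (\<epsilon> * \<rho>) * (8 * (norm z)\<^sup>2 / (\<rho> * x))"
      using l e0 w1 by (intro mult_mono) auto
    also have "\<dots> = 8 * \<epsilon> * (norm z)\<^sup>2 / x" using \<open>\<rho> > 0\<close> \<open>x > 0\<close> by (simp add: field_simps)
    finally show ?thesis .
  qed
  ultimately have "norm (M z) \<le> exp (8 * \<epsilon> * (norm z)\<^sup>2 / x)" by (meson exp_le_cancel_iff order_trans)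
  then show ?thesis using \<open>x > 0\<close> by (simp add: x_def)
qed

section \<open>Phragmen-Lindelof principles in a quadrant and a half-plane\<close>

lemma le_exp_iff: "x * exp (- a) \<le> 1 \<longleftrightarrow> x \<le> exp a" for x a :: real
  by (simp add: exp_minus field_simps)

text \<open>The hypothesis places w in the sector |arg w| \<le> pi/4, so its root lies in |arg|
  \<le> pi/8, where |Im| \<le> Re / 2, and the cube of the root has an argument of at most 3 pi/8.
  Hence w^(3/2) has a real part comparable to |w|^(3/2), as a barrier requires.\<close>

lemma Re_csqrt_cubed_ge:
  assumes "\<bar>Im w\<bar> \<le> Re w"
  shows "Re (csqrt w ^ 3) \<ge> Re (csqrt w) ^ 3 / 4" "norm w \<le> 5 / 4 * (Re (csqrt w))\<^sup>2" "Re (csqrt w) \<ge> 0"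
proof -
  define p q where "p = Re (csqrt w)" and "q = \<bar>Im (csqrt w)\<bar>"
  show "Re (csqrt w) \<ge> 0" using csqrt_principal[of w] by auto
  then have p: "p \<ge> 0" and q: "q \<ge> 0" by (auto simp: p_def q_def)
  have w: "w = csqrt w * csqrt w" by (metis power2_csqrt power2_eq_square)
  have qq: "Im (csqrt w) * Im (csqrt w) = q * q" by (simp add: q_def)
  have re: "Re w = p * p - q * q" by (subst w) (simp add: p_def qq del: csqrt.simps)
  have "Im w = 2 * (p * Im (csqrt w))" by (subst w) (simp add: p_def del: csqrt.simps)
  then have "\<bar>Im w\<bar> = \<bar>2 * (p * Im (csqrt w))\<bar>" by (rule arg_cong)
  also have "\<dots> = 2 * (\<bar>p\<bar> * q)" unfolding q_def abs_mult by (simp only: abs_numeral)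
  finally have "\<bar>Im w\<bar> = 2 * (p * q)" using p by simp
  then have pq: "2 * (p * q) \<le> p * p - q * q" using assms re by simp
  have "2 * q \<le> p"
  proof (cases "p = 0")
    case True
    then have "q * q \<le> 0" using pq by simp
    then have "q = 0" by (metis mult_eq_0_iff order_antisym zero_le_square)
    then show ?thesis using True by simp
  next
    case False
    have "p * (2 * q) = 2 * (p * q)" by simp
    then have "p * (2 * q) \<le> p * p" using pq zero_le_square[of q] by linarith
    then show ?thesis using False p by simp
  qed
  then have "(2 * q) * (2 * q) \<le> p * p" using q by (intro mult_mono) auto
  then have q2: "4 * (q * q) \<le> p * p" by simp
  have "Re (csqrt w ^ 3) = p * (p * p) - 3 * p * (Im (csqrt w) * Im (csqrt w))"
    by (simp add: p_def power3_eq_cube algebra_simps del: csqrt.simps)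
  also have "\<dots> = p * (p * p) - 3 * p * (q * q)" by (simp only: qq)
  finally have r: "Re (csqrt w ^ 3) = p * (p * p) - 3 * (p * (q * q))" by simp
  have "p * (4 * (q * q)) \<le> p * (p * p)" using q2 p by (intro mult_left_mono) auto
  then show "Re (csqrt w ^ 3) \<ge> Re (csqrt w) ^ 3 / 4"
    unfolding r p_def[symmetric] by (simp add: power3_eq_cube)
  have "norm w = (norm (csqrt w))\<^sup>2" by (metis norm_power power2_csqrt)
  also have "\<dots> = p * p + q * q" unfolding cmod_power2 by (simp add: p_def power2_eq_square qq del: csqrt.simps)
  finally show "norm w \<le> 5 / 4 * (Re (csqrt w))\<^sup>2" using q2 unfolding p_def[symmetric] by (simp add: power2_eq_square)
qed

text \<open>The barrier is exp (- \<delta> w^(3/2)): the exponent 3/2 exceeds the growth order 1 of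
  \<open>F\<close> and stays below 2, the critical order of a quadrant. So the barrier wins on large
  arcs, and its exponent keeps a sign. Letting \<delta> tend to 0 removes it.\<close>

lemma Phragmen_Lindelof_quadrant:
  fixes F :: "complex \<Rightarrow> complex"
  assumes cont: "continuous_on {z. Re z \<ge> 0 \<and> Im z \<ge> 0} F" and holo: "F holomorphic_on {z. Re z > 0 \<and> Im z > 0}"
    and growth: "\<And>z. Re z \<ge> 0 \<Longrightarrow> Im z \<ge> 0 \<Longrightarrow> norm (F z) \<le> C * exp (\<sigma> * norm z)"
    and edge: "\<And>z. Re z \<ge> 0 \<Longrightarrow> Im z \<ge> 0 \<Longrightarrow> Re z = 0 \<or> Im z = 0 \<Longrightarrow> norm (F z) \<le> 1"
    and z: "Re z \<ge> 0" "Im z \<ge> 0"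
  shows "norm (F z) \<le> 1"
proof -
  \<comment> \<open>Rotation by - pi/4 makes the quadrant symmetric about the positive axis; the
    shift by 1 in \<open>w\<close> avoids the branch point of the root at the corner.\<close>
  define u :: complex where "u = Complex (1 / sqrt 2) (- 1 / sqrt 2)"
  define w where "w = (\<lambda>z. u * z + 1)"
  have u: "norm u = 1" by (simp add: u_def cmod_def power_divide)
  have Rw: "Re (w z) = (Re z + Im z) / sqrt 2 + 1" "Im (w z) = (Im z - Re z) / sqrt 2" for z
    by (auto simp: w_def u_def add_divide_distrib diff_divide_distrib)
  have cone: "\<bar>Im (w z)\<bar> \<le> Re (w z)" "Re (w z) > 0" if "Re z \<ge> 0" "Im z \<ge> 0" for z
  proof -
    have "\<bar>Im z - Re z\<bar> / sqrt 2 \<le> (Re z + Im z) / sqrt 2" using that by (intro divide_right_mono) auto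
    then show "\<bar>Im (w z)\<bar> \<le> Re (w z)" unfolding Rw by (simp add: abs_divide)
    show "Re (w z) > 0" unfolding Rw using that by (simp add: add_nonneg_pos)
  qed
  define s where "s = (\<lambda>z. csqrt (w z))"
  have s: "Re (s z ^ 3) \<ge> Re (s z) ^ 3 / 4" "norm (w z) \<le> 5 / 4 * (Re (s z))\<^sup>2" "Re (s z) \<ge> 0"
    if "Re z \<ge> 0" "Im z \<ge> 0" for z
    using Re_csqrt_cubed_ge[OF cone(1)[OF that]] unfolding s_def .
  have "norm (F z) \<le> exp (\<delta> * Re (s z ^ 3))" if "\<delta> > 0" for \<delta>
  proof -
    define G where "G = (\<lambda>z. F z * exp (- (of_real \<delta> * s z ^ 3)))"
    have nG: "norm (G z) = norm (F z) * exp (- (\<delta> * Re (s z ^ 3)))" for z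
      by (simp add: G_def norm_mult)
    have edgeG: "norm (G z) \<le> norm (F z)" if "Re z \<ge> 0" "Im z \<ge> 0" for z
    proof -
      have "Re (s z ^ 3) \<ge> 0" using s(1)[OF that] zero_le_power[OF s(3)[OF that], of 3] by linarith
      then have "exp (- (\<delta> * Re (s z ^ 3))) \<le> 1" using \<open>\<delta> > 0\<close> by simp
      then show ?thesis unfolding nG by (metis mult_left_le norm_ge_zero)
    qed
    have "\<forall>\<^sub>F R in at_top. \<delta> * (R / 2 * sqrt (R / 2)) / 4 \<ge> \<sigma> * R + ln (max C 1)"
      using \<open>\<delta> > 0\<close> by real_asymp
    then obtain R0 where R0: "\<And>R. R \<ge> R0 \<Longrightarrow> \<delta> * (R / 2 * sqrt (R / 2)) / 4 \<ge> \<sigma> * R + ln (max C 1)"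
      by (auto simp: eventually_at_top_linorder)
    \<comment> \<open>On the arc, 5/4 (Re s)^2 \<ge> |w| \<ge> R - 1; with R \<ge> 10 this gives the
      inequality (Re s)^2 \<ge> R / 2 that the choice of \<open>R0\<close> anticipates.\<close>
    define R where "R = max (max R0 10) (norm z)"
    define S where "S = {z. Re z \<ge> 0 \<and> Im z \<ge> 0 \<and> norm z \<le> R}"
    have clS: "closed S"
    proof -
      have "S = {z. 0 \<le> Re z} \<inter> {z. 0 \<le> Im z} \<inter> cball 0 R" by (auto simp: S_def)
      then show ?thesis by (auto intro!: closed_Int closed_halfspace_Re_ge closed_halfspace_Im_ge)
    qed
    have opT: "open {z. Re z > 0 \<and> Im z > 0 \<and> norm z < R}"
    proof -
      have "{z. Re z > 0 \<and> Im z > 0 \<and> norm z < R} = {z. 0 < Re z} \<inter> {z. 0 < Im z} \<inter> ball 0 R" by auto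
      then show ?thesis by (auto intro!: open_Int open_halfspace_Re_gt open_halfspace_Im_gt)
    qed
    have intS: "interior S = {z. Re z > 0 \<and> Im z > 0 \<and> norm z < R}"
    proof
      show "{z. Re z > 0 \<and> Im z > 0 \<and> norm z < R} \<subseteq> interior S"
        by (rule interior_maximal[OF _ opT]) (auto simp: S_def)
      have "interior S \<subseteq> interior {z. 0 \<le> Re z}" "interior S \<subseteq> interior {z. 0 \<le> Im z}" "interior S \<subseteq> interior (cball 0 R)"
        by (rule interior_mono; auto simp: S_def)+
      then show "interior S \<subseteq> {z. Re z > 0 \<and> Im z > 0 \<and> norm z < R}"
        using interior_halfspace_ge[of "1::complex" 0] interior_halfspace_ge[of \<i> 0]
        by (auto simp: inner_complex_def)
    qed
    have "continuous_on {z. Re z \<ge> 0 \<and> Im z \<ge> 0} s" unfolding s_def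
    proof (rule continuous_on_compose2[OF continuous_on_csqrt])
      show "continuous_on {z. Re z \<ge> 0 \<and> Im z \<ge> 0} w" unfolding w_def by (intro continuous_intros)
    qed (use cone(2) in \<open>force simp: complex_nonpos_Reals_iff\<close>)
    then have contG: "continuous_on {z. Re z \<ge> 0 \<and> Im z \<ge> 0} G"
      unfolding G_def by (intro continuous_intros cont)
    have holG: "G holomorphic_on {z. Re z > 0 \<and> Im z > 0}"
      unfolding G_def s_def w_def
    proof (intro holomorphic_intros holo)
      fix z assume "z \<in> {z. Re z > 0 \<and> Im z > 0}"
      then show "u * z + 1 \<notin> \<real>\<^sub>\<le>\<^sub>0" using cone(2)[of z] by (auto simp: complex_nonpos_Reals_iff w_def)
    qed
    have "norm (G z) \<le> 1"
    proof (rule maximum_modulus_frontier[of G S])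
      show "G holomorphic_on interior S"
        by (rule holomorphic_on_subset[OF holG]) (auto simp: intS)
      show "continuous_on (closure S) G" unfolding closure_closed[OF clS]
        by (rule continuous_on_subset[OF contG]) (auto simp: S_def)
      have "S \<subseteq> cball 0 R" by (auto simp: S_def)
      then show "bounded S" using bounded_cball bounded_subset by blast
      show "z \<in> S" using z by (simp add: S_def R_def)
      fix x assume "x \<in> frontier S"
      then have x: "x \<in> S" "x \<notin> interior S" using clS by (auto simp: frontier_def)
      then have x': "Re x \<ge> 0" "Im x \<ge> 0" by (auto simp: S_def)
      from x consider "Re x = 0 \<or> Im x = 0" | "norm x = R" unfolding intS by (force simp: S_def)
      then show "norm (G x) \<le> 1"
      proof cases
        case 1 then show ?thesis using edgeG[OF x'] edge[OF x'] by linarith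
      next
        case 2
        have "R \<ge> 10" by (simp add: R_def)
        have "norm (w x) \<ge> R - 1" using norm_triangle_ineq4[of "w x" 1] 2 u by (simp add: w_def norm_mult)
        then have "5 / 4 * (Re (s x))\<^sup>2 \<ge> R - 1" using s(2)[OF x'] by linarith
        then have a2: "(Re (s x))\<^sup>2 \<ge> R / 2" using \<open>R \<ge> 10\<close> by linarith
        then have a1: "Re (s x) \<ge> sqrt (R / 2)" using s(3)[OF x'] real_le_lsqrt by (metis abs_of_nonneg real_sqrt_abs real_sqrt_le_iff)
        have "R / 2 * sqrt (R / 2) \<le> (Re (s x))\<^sup>2 * Re (s x)"
          using a1 a2 \<open>R \<ge> 10\<close> by (intro mult_mono) auto
        then have "R / 2 * sqrt (R / 2) \<le> Re (s x) ^ 3" by (simp add: power2_eq_square power3_eq_cube)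
        then have "R / 2 * sqrt (R / 2) / 4 \<le> Re (s x ^ 3)" using s(1)[OF x'] by linarith
        then have "\<delta> * (R / 2 * sqrt (R / 2) / 4) \<le> \<delta> * Re (s x ^ 3)" using \<open>\<delta> > 0\<close> by (intro mult_left_mono) auto
        moreover have "\<delta> * (R / 2 * sqrt (R / 2)) / 4 \<ge> \<sigma> * R + ln (max C 1)" by (rule R0) (simp add: R_def)
        ultimately have k: "\<sigma> * R + ln (max C 1) \<le> \<delta> * Re (s x ^ 3)" by simp
        have "norm (F x) \<le> max C 1 * exp (\<sigma> * R)"
          using growth[OF x'] 2 by (metis exp_ge_zero max.cobounded1 mult_right_mono order_trans)
        also have "\<dots> = exp (\<sigma> * R + ln (max C 1))" by (simp add: exp_add mult.commute)
        also have "\<dots> \<le> exp (\<delta> * Re (s x ^ 3))" using k by simp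
        finally show ?thesis unfolding nG le_exp_iff .
      qed
    qed
    then show ?thesis unfolding nG le_exp_iff .
  qed
  then have "\<forall>\<^sub>F \<delta> in at_right 0. norm (F z) \<le> exp (\<delta> * Re (s z ^ 3))"
    by (auto simp: eventually_at_right_field intro!: exI[of _ 1])
  moreover have "((\<lambda>\<delta>. exp (\<delta> * Re (s z ^ 3))) \<longlongrightarrow> exp (0 * Re (s z ^ 3))) (at_right 0)"
    by (intro tendsto_intros)
  ultimately show ?thesis using tendsto_lowerbound[of _ _ "at_right (0::real)" "norm (F z)"] by fastforce
qed

text \<open>Order 1 is critical in a half-plane, as exp (- z) shows. The bound on the negative real
  axis cuts the half-plane into two quadrants, in which growth of order 1 is harmless.\<close>

lemma Phragmen_Lindelof_half_plane:
  fixes F :: "complex \<Rightarrow> complex"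
  assumes holo: "F holomorphic_on {z. Re z < 1}"
    and growth: "\<And>z. Re z \<le> 0 \<Longrightarrow> norm (F z) \<le> C * exp (\<sigma> * norm z)"
    and edge: "\<And>z. Re z \<le> 0 \<Longrightarrow> Re z = 0 \<or> Im z = 0 \<Longrightarrow> norm (F z) \<le> 1"
    and z: "Re z \<le> 0"
  shows "norm (F z) \<le> 1"
proof -
  have cont: "continuous_on {z. Re z < 1} F" by (rule holomorphic_on_imp_continuous_on[OF holo])
  show ?thesis
  proof (cases "Im z \<ge> 0")
    case True
    have "norm (F (\<i> * (- \<i> * z))) \<le> 1"
    proof (rule Phragmen_Lindelof_quadrant[of "\<lambda>z. F (\<i> * z)" C \<sigma>])
      show "continuous_on {z. Re z \<ge> 0 \<and> Im z \<ge> 0} (\<lambda>z. F (\<i> * z))"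
        by (rule continuous_on_compose2[OF cont]) (auto intro!: continuous_intros)
      show "(\<lambda>z. F (\<i> * z)) holomorphic_on {z. Re z > 0 \<and> Im z > 0}"
        by (rule holomorphic_on_compose_gen[OF _ holo, unfolded o_def]) (auto intro!: holomorphic_intros)
      show "norm (F (\<i> * z)) \<le> C * exp (\<sigma> * norm z)" if "Re z \<ge> 0" "Im z \<ge> 0" for z
        using growth[of "\<i> * z"] that by (simp add: norm_mult)
    qed (use edge True z in auto)
    then show ?thesis by simp
  next
    case False
    have "norm (F (- (- z))) \<le> 1"
    proof (rule Phragmen_Lindelof_quadrant[of "\<lambda>z. F (- z)" C \<sigma>])
      show "continuous_on {z. Re z \<ge> 0 \<and> Im z \<ge> 0} (\<lambda>z. F (- z))"
        by (rule continuous_on_compose2[OF cont]) (auto intro!: continuous_intros)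
      show "(\<lambda>z. F (- z)) holomorphic_on {z. Re z > 0 \<and> Im z > 0}"
        by (rule holomorphic_on_compose_gen[OF _ holo, unfolded o_def]) (auto intro!: holomorphic_intros)
      show "norm (F (- z)) \<le> C * exp (\<sigma> * norm z)" if "Re z \<ge> 0" "Im z \<ge> 0" for z
        using growth[of "- z"] that by simp
    qed (use edge False z in auto)
    then show ?thesis by simp
  qed
qed

section \<open>Bounds that degenerate at the imaginary axis\<close>

text \<open>Consider the square with opposite corners i y/2 and 3 i y/2. Its sides meet the axis
  only at these corners, where the given bound blows up like the reciprocal distance. The functions
  \<open>w1\<close> and \<open>w2\<close> vanish at the two corners, so a multiple of the harmonic
  function Re (1 / w1 + 1 / w2) blows up at the same rate and dominates ln |M| on the sides; the
  maximum principle carries this inside.\<close>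

lemma bound_across_imaginary_axis:
  fixes M :: "complex \<Rightarrow> complex"
  assumes M: "M holomorphic_on UNIV" and \<epsilon>: "\<epsilon> > 0"
    and le: "\<And>z. norm z \<ge> r \<Longrightarrow> Re z \<noteq> 0 \<Longrightarrow> norm (M z) \<le> exp (\<epsilon> * (norm z)\<^sup>2 / \<bar>Re z\<bar>)"
    and y: "y > 0" "y \<ge> 2 * r" and z: "Im z = y" "\<bar>Re z\<bar> < y / 2"
  shows "norm (M z) \<le> exp (20 * \<epsilon> * y)"
proof -
  \<comment> \<open>On a side, Re (1 / w) is 1 / (2 |Re p|), and |p|^2 \<le> 5/2 y^2 on the square;
    \<open>c\<close> makes c / (2 |Re p|) match the resulting bound \<epsilon> (5/2) y^2 / |Re p|.
    At height y both reciprocals contribute at most 2 / y, whence the final 20 \<epsilon> y.\<close>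
  define c where "c = 5 * \<epsilon> * y\<^sup>2"
  have c: "c > 0" using \<epsilon> y by (simp add: c_def)
  define w1 w2 where "w1 = (\<lambda>p. Complex (Im p - y / 2) (- Re p))" and "w2 = (\<lambda>p. Complex (3 * y / 2 - Im p) (Re p))"
  have w1: "w1 = (\<lambda>p. - \<i> * p - of_real (y / 2))" by (auto simp: w1_def complex_eq_iff fun_eq_iff)
  have w2: "w2 = (\<lambda>p. of_real (3 * y / 2) + \<i> * p)" by (auto simp: w2_def complex_eq_iff fun_eq_iff)
  have compact: "compact (cball (0::complex) (2 * y))" by simp
  have "continuous_on (cball 0 (2 * y)) M"
    using M by (meson continuous_on_subset holomorphic_on_imp_continuous_on subset_UNIV)
  then have "bounded (M ` cball 0 (2 * y))"
    using compact by (intro compact_imp_bounded compact_continuous_image)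
  then obtain B where "B > 0" and B': "\<And>x. x \<in> M ` cball 0 (2 * y) \<Longrightarrow> norm x \<le> B"
    unfolding bounded_pos by blast
  have B: "norm (M p) \<le> B" if "norm p \<le> 2 * y" for p
    by (rule B') (use that in auto)
  \<comment> \<open>The corners lie on the axis, where no bound is given, and are cut off at
    distance \<delta>. On the cuts the barrier is at least c / (2 \<delta>), and \<delta> is so
    small that this covers the logarithm of the crude bound \<open>B\<close>.\<close>
  define \<delta> where "\<delta> = min (y / 4) (c / (2 * (\<bar>ln B\<bar> + 1)))"
  have "\<delta> > 0" using c y by (auto simp: \<delta>_def add_nonneg_pos)
  moreover have "\<delta> \<le> y / 4" unfolding \<delta>_def by (rule min.cobounded1)
  ultimately have \<delta>: "\<delta> > 0" "\<delta> \<le> y / 4" by auto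
  have \<delta>B: "ln B \<le> c / (2 * \<delta>)"
  proof -
    have "\<delta> \<le> c / (2 * (\<bar>ln B\<bar> + 1))" by (simp add: \<delta>_def)
    then have "\<delta> * (2 * (\<bar>ln B\<bar> + 1)) \<le> c" by (simp add: pos_le_divide_eq add_nonneg_pos)
    then have "\<bar>ln B\<bar> + 1 \<le> c / (2 * \<delta>)" using \<delta> by (simp add: field_simps)
    then show ?thesis by linarith
  qed
  define S where "S = {p. \<bar>Re p\<bar> \<le> Im p - y / 2 \<and> \<bar>Re p\<bar> \<le> 3 * y / 2 - Im p \<and> y / 2 + \<delta> \<le> Im p \<and> Im p \<le> 3 * y / 2 - \<delta>}"
  define T where "T = {p. \<bar>Re p\<bar> < Im p - y / 2 \<and> \<bar>Re p\<bar> < 3 * y / 2 - Im p \<and> y / 2 + \<delta> < Im p \<and> Im p < 3 * y / 2 - \<delta>}"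
  have cl: "closed S" unfolding S_def by (intro closed_Collect_conj closed_Collect_le continuous_intros)
  have opT: "open T" unfolding T_def by (intro open_Collect_conj open_Collect_less continuous_intros)
  have "T \<subseteq> S" by (auto simp: T_def S_def)
  then have TS: "T \<subseteq> interior S" using opT interior_maximal by blast
  define G where "G = (\<lambda>p. M p * exp (- (of_real c * (1 / w1 p + 1 / w2 p))))"
  have Rew: "Re (w1 p) \<ge> \<delta>" "Re (w2 p) \<ge> \<delta>" if "p \<in> S" for p
    using that by (auto simp: S_def w1_def w2_def)
  have nz: "w1 p \<noteq> 0" "w2 p \<noteq> 0" if "p \<in> S" for p using Rew[OF that] \<delta> by auto
  have Re_inv: "Re (1 / w) = Re w / (norm w)\<^sup>2" for w
    by (simp add: Re_divide cmod_power2)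
  have holS: "G holomorphic_on interior S"
    unfolding G_def w1 w2
    by (intro holomorphic_intros holomorphic_on_subset[OF M])
       (use nz interior_subset in \<open>auto simp: w1 w2\<close>)
  have contS: "continuous_on S G"
    unfolding G_def w1 w2
    by (intro continuous_intros continuous_on_subset[OF holomorphic_on_imp_continuous_on[OF M]])
       (use nz in \<open>auto simp: w1 w2\<close>)
  have nG: "norm (G p) = norm (M p) * exp (- (c * (Re (1 / w1 p) + Re (1 / w2 p))))" for p
    by (simp add: G_def norm_mult)
  have small: "(norm p)\<^sup>2 \<le> 5 / 2 * y\<^sup>2" "y / 2 \<le> norm p" if "p \<in> S" for p
  proof -
    have "\<bar>Re p\<bar> \<le> y / 2" "\<bar>Im p\<bar> \<le> 3 * y / 2" using that \<delta> y by (auto simp: S_def)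
    then have "(Re p)\<^sup>2 \<le> (y / 2)\<^sup>2" "(Im p)\<^sup>2 \<le> (3 * y / 2)\<^sup>2" by (auto intro: abs_le_square_iff[THEN iffD1] simp: y)
    then show "(norm p)\<^sup>2 \<le> 5 / 2 * y\<^sup>2" unfolding cmod_power2 by (simp add: power2_eq_square)
    show "y / 2 \<le> norm p" using abs_Im_le_cmod[of p] that \<delta> by (auto simp: S_def)
  qed
  have Re_pos: "Re (1 / w1 p) \<ge> 0" "Re (1 / w2 p) \<ge> 0" if "p \<in> S" for p
    unfolding Re_inv using Rew[OF that] \<delta> by auto
  have "norm (G z) \<le> 1"
  proof (rule maximum_modulus_frontier[OF holS])
    show "continuous_on (closure S) G" using contS cl by simp
    have "S \<subseteq> cball 0 (2 * y)"
    proof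
      fix p assume "p \<in> S"
      then have "\<bar>Re p\<bar> \<le> y / 2" "\<bar>Im p\<bar> \<le> 3 * y / 2" using \<delta> y by (auto simp: S_def)
      then show "p \<in> cball 0 (2 * y)" using cmod_le[of p] by simp
    qed
    then have S2: "\<And>p. p \<in> S \<Longrightarrow> norm p \<le> 2 * y" by auto
    show "bounded S" using \<open>S \<subseteq> cball 0 (2 * y)\<close> bounded_cball bounded_subset by blast
    show "z \<in> S" using z \<delta> y by (auto simp: S_def)
    fix p assume "p \<in> frontier S"
    then have p: "p \<in> S" "p \<notin> T" using cl TS by (auto simp: frontier_def)
    have side: "c * Re (1 / w) \<ge> ln (norm (M p))"
      if w: "\<bar>Im w\<bar> = \<bar>Re p\<bar>" "Re w = \<bar>Re p\<bar>" "Re w > 0" "M p \<noteq> 0" for w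
    proof -
      have "(norm w)\<^sup>2 = 2 * (Re p)\<^sup>2" unfolding cmod_power2 using w by (metis mult_2 power2_abs)
      then have "Re (1 / w) = 1 / (2 * \<bar>Re p\<bar>)" unfolding Re_inv using w
        by (simp add: power2_eq_square divide_simps)
      then have eq: "c * Re (1 / w) = \<epsilon> * (5 / 2 * y\<^sup>2) / \<bar>Re p\<bar>" by (simp add: c_def)
      have "norm (M p) \<le> exp (\<epsilon> * (norm p)\<^sup>2 / \<bar>Re p\<bar>)"
        by (rule le) (use small[OF p(1)] y w in auto)
      then have "ln (norm (M p)) \<le> \<epsilon> * (norm p)\<^sup>2 / \<bar>Re p\<bar>" using w(4) by (metis ln_exp ln_mono zero_less_norm_iff)
      also have "\<dots> \<le> \<epsilon> * (5 / 2 * y\<^sup>2) / \<bar>Re p\<bar>"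
        using small[OF p(1)] \<epsilon> by (intro divide_right_mono mult_left_mono) auto
      finally show ?thesis using eq by simp
    qed
    have cut: "c * Re (1 / w) \<ge> ln (norm (M p))" if w: "Re w = \<delta>" "\<bar>Im w\<bar> \<le> Re w" "M p \<noteq> 0" for w
    proof -
      have "(Im w)\<^sup>2 \<le> \<delta>\<^sup>2" using w \<delta> by (auto intro: abs_le_square_iff[THEN iffD1])
      then have "(norm w)\<^sup>2 \<le> 2 * \<delta>\<^sup>2" unfolding cmod_power2 using w by simp
      moreover have "(norm w)\<^sup>2 > 0" using w \<delta> by auto
      ultimately have "\<delta> / (2 * \<delta>\<^sup>2) \<le> Re (1 / w)" unfolding Re_inv w(1)
        using \<delta> by (intro divide_left_mono mult_pos_pos) auto
      then have "1 / (2 * \<delta>) \<le> Re (1 / w)" using \<delta> by (simp add: power2_eq_square)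
      then have "c * (1 / (2 * \<delta>)) \<le> c * Re (1 / w)" using c by (intro mult_left_mono) auto
      moreover have "ln (norm (M p)) \<le> ln B" using B[OF S2[OF p(1)]] w(3) \<open>B > 0\<close> by simp
      ultimately show ?thesis using \<delta>B by simp
    qed
    show "norm (G p) \<le> 1"
    proof (cases "M p = 0")
      case True then show ?thesis by (simp add: G_def)
    next
      case False
      from p consider "\<bar>Re p\<bar> = Im p - y / 2" | "\<bar>Re p\<bar> = 3 * y / 2 - Im p" | "Im p = y / 2 + \<delta>" | "Im p = 3 * y / 2 - \<delta>"
        unfolding S_def T_def by fastforce
      then have "ln (norm (M p)) \<le> c * Re (1 / w1 p) \<or> ln (norm (M p)) \<le> c * Re (1 / w2 p)"
      proof cases
        case 1 then show ?thesis using side[of "w1 p"] Rew(1)[OF p(1)] \<delta> False by (auto simp: w1_def)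
      next
        case 2 then show ?thesis using side[of "w2 p"] Rew(2)[OF p(1)] \<delta> False by (auto simp: w2_def)
      next
        case 3 then show ?thesis using cut[of "w1 p"] p(1) False by (auto simp: w1_def S_def)
      next
        case 4 then show ?thesis using cut[of "w2 p"] p(1) False by (auto simp: w2_def S_def)
      qed
      moreover have "c * Re (1 / w1 p) \<ge> 0" "c * Re (1 / w2 p) \<ge> 0" using Re_pos[OF p(1)] c by auto
      ultimately have "ln (norm (M p)) \<le> c * (Re (1 / w1 p) + Re (1 / w2 p))" by (auto simp: distrib_left)
      then have "norm (M p) \<le> exp (c * (Re (1 / w1 p) + Re (1 / w2 p)))" using False
        by (metis exp_le_cancel_iff exp_ln zero_less_norm_iff)
      then show ?thesis unfolding nG le_exp_iff .
    qed
  qed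
  then have "norm (M z) \<le> exp (c * (Re (1 / w1 z) + Re (1 / w2 z)))"
    unfolding nG le_exp_iff .
  also have "c * (Re (1 / w1 z) + Re (1 / w2 z)) \<le> c * (2 / y + 2 / y)"
  proof -
    have *: "Re (1 / w) \<le> 2 / y" if "Re w = y / 2" for w
    proof -
      have "Re (1 / w) \<le> norm (1 / w)" by (rule complex_Re_le_cmod)
      also have "\<dots> = 1 / norm w" by (simp add: norm_divide)
      also have "\<dots> \<le> 1 / (y / 2)" using complex_Re_le_cmod[of w] that y by (intro divide_left_mono mult_pos_pos) auto
      finally show ?thesis by simp
    qed
    have "Re (w1 z) = y / 2" "Re (w2 z) = y / 2" using z by (auto simp: w1_def w2_def)
    then show ?thesis using * c by (intro mult_left_mono add_mono) auto
  qed
  also have "c * (2 / y + 2 / y) = 20 * \<epsilon> * y" using y by (simp add: c_def power2_eq_square field_simps)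
  finally show ?thesis by simp
qed

text \<open>Where |Re z| \<ge> |z| / 4, the hypothesis already gives the exponent 4 \<epsilon> |z|.
  Elsewhere |Im z| \<ge> 3/4 |z|, and \<open>bound_across_imaginary_axis\<close> applies, after a
  reflection in the lower half-plane. On the remaining disc \<open>M\<close> is bounded by
  compactness.\<close>

lemma exp_bound_of_cone_bound:
  fixes M :: "complex \<Rightarrow> complex"
  assumes M: "M holomorphic_on UNIV" and \<epsilon>: "\<epsilon> > 0"
    and le: "\<And>z. norm z \<ge> r \<Longrightarrow> Re z \<noteq> 0 \<Longrightarrow> norm (M z) \<le> exp (\<epsilon> * (norm z)\<^sup>2 / \<bar>Re z\<bar>)"
  shows "\<exists>C. \<forall>z. norm (M z) \<le> C * exp (20 * \<epsilon> * norm z)"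
proof -
  define R where "R = max 1 (4 * r)"
  have big: "norm (M z) \<le> exp (20 * \<epsilon> * norm z)" if z: "norm z \<ge> R" for z
  proof (cases "\<bar>Re z\<bar> \<ge> norm z / 4")
    case True
    have nz: "norm z > 0" "norm z \<ge> r" using z unfolding R_def by linarith+
    then have "norm (M z) \<le> exp (\<epsilon> * (norm z)\<^sup>2 / \<bar>Re z\<bar>)" using True by (intro le) auto
    also have "\<epsilon> * (norm z)\<^sup>2 / \<bar>Re z\<bar> \<le> \<epsilon> * (norm z)\<^sup>2 / (norm z / 4)"
    proof -
      have "\<bar>Re z\<bar> > 0" using True nz by linarith
      then have "0 < \<bar>Re z\<bar> * (norm z / 4)" using nz by (intro mult_pos_pos) auto
      then show ?thesis using True \<epsilon> by (intro divide_left_mono mult_nonneg_nonneg) auto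
    qed
    also have "\<dots> = 4 * \<epsilon> * norm z" using nz by (simp add: power2_eq_square)
    also have "\<dots> \<le> 20 * \<epsilon> * norm z" using \<epsilon> nz by simp
    finally show ?thesis by simp
  next
    case False
    define y where "y = \<bar>Im z\<bar>"
    have yz: "y \<le> norm z" "y \<ge> 3 / 4 * norm z" using abs_Im_le_cmod[of z] cmod_le[of z] False by (auto simp: y_def)
    have y: "y > 0" "y \<ge> 2 * r" "\<bar>Re z\<bar> < y / 2" using yz z False unfolding R_def by linarith+
    have "norm (M z) \<le> exp (20 * \<epsilon> * y)"
    proof (cases "Im z \<ge> 0")
      case True then show ?thesis
        by (intro bound_across_imaginary_axis[OF M \<epsilon> le y(1,2) _ y(3)]) (auto simp: y_def)
    next
      case False
      have "norm (M (- (- z))) \<le> exp (20 * \<epsilon> * y)"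
      proof (rule bound_across_imaginary_axis[of "\<lambda>z. M (- z)" \<epsilon> r, OF _ \<epsilon> _ y(1,2)])
        show "(\<lambda>z. M (- z)) holomorphic_on UNIV"
          by (rule holomorphic_on_compose_gen[OF _ M, unfolded o_def]) (auto intro!: holomorphic_intros)
        show "norm (M (- z)) \<le> exp (\<epsilon> * (norm z)\<^sup>2 / \<bar>Re z\<bar>)" if "norm z \<ge> r" "Re z \<noteq> 0" for z
          using le[of "- z"] that by simp
      qed (use False y in \<open>auto simp: y_def\<close>)
      then show ?thesis by simp
    qed
    also have "\<dots> \<le> exp (20 * \<epsilon> * norm z)" using yz \<epsilon> by simp
    finally show ?thesis .
  qed
  have "continuous_on (cball 0 R) M"
    using M by (meson continuous_on_subset holomorphic_on_imp_continuous_on subset_UNIV)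
  then have "bounded (M ` cball 0 R)" by (intro compact_imp_bounded compact_continuous_image) auto
  then obtain B where "B > 0" and B': "\<And>x. x \<in> M ` cball 0 R \<Longrightarrow> norm x \<le> B"
    unfolding bounded_pos by blast
  have B: "norm (M p) \<le> B" if "norm p \<le> R" for p
    by (rule B') (use that in auto)
  have "norm (M z) \<le> max 1 B * exp (20 * \<epsilon> * norm z)" for z
  proof -
    have e: "exp (20 * \<epsilon> * norm z) \<ge> 1" using \<epsilon> by simp
    have "norm (M z) \<le> max 1 B * 1 \<or> norm (M z) \<le> 1 * exp (20 * \<epsilon> * norm z)"
      using B[of z] big[of z] by (cases "norm z \<le> R") auto
    moreover have "max 1 B * 1 \<le> max 1 B * exp (20 * \<epsilon> * norm z)" "1 * exp (20 * \<epsilon> * norm z) \<le> max 1 B * exp (20 * \<epsilon> * norm z)"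
      using e by (intro mult_mono; simp)+
    ultimately show ?thesis by linarith
  qed
  then show ?thesis by blast
qed

text \<open>The last condition prevents \<open>B\<close> from decaying so fast along the negative axis that it could
  compensate for exponential growth of \<open>M\<close>.\<close>

definition dominated_left :: "(complex \<Rightarrow> complex) \<Rightarrow> real \<Rightarrow> bool" where
  "dominated_left M \<epsilon> \<longleftrightarrow> (\<exists>B C n. B holomorphic_on UNIV \<and>
     (\<forall>z. Re z \<le> 0 \<longrightarrow> norm (B z) \<le> C * (1 + norm z) ^ n \<and> norm (M z * B z) \<le> C * (1 + norm z) ^ n) \<and>
     (\<forall>r. \<exists>\<rho>\<ge>r. norm (B (- of_real \<rho>)) \<ge> exp (- \<epsilon> * \<rho>)))"

lemma one_add_norm_le:
  fixes z :: complex
  assumes "Re z \<le> 0" shows "1 + norm z \<le> 2 * norm (1 - z)"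
proof -
  have "1 \<le> norm (1 - z)" using complex_Re_le_cmod[of "1 - z"] assms by simp
  moreover have "norm z \<le> norm (1 - z)"
  proof (rule power2_le_imp_le[OF _ norm_ge_zero])
    show "(norm z)\<^sup>2 \<le> (norm (1 - z))\<^sup>2"
      unfolding cmod_power2 using assms by (simp add: power2_eq_square algebra_simps)
  qed
  ultimately show ?thesis by simp
qed

text \<open>On the left half-plane 1 - z has no zero and is comparable to 1 + |z|, so dividing
  \<open>B\<close> by a multiple of (1 - z)^n normalises both polynomial bounds to 1. The price at
  -\<rho> is polynomial and is paid with a second \<epsilon>, which turns the 8 of
  \<open>half_plane_bound\<close> into 16.\<close>

lemma dominated_left_bound:
  assumes M: "M holomorphic_on UNIV" and dom: "dominated_left M \<epsilon>" and \<epsilon>: "\<epsilon> > 0"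
  shows "\<exists>r. \<forall>z. Re z < 0 \<longrightarrow> norm z \<ge> r \<longrightarrow> norm (M z) \<le> exp (16 * \<epsilon> * (norm z)\<^sup>2 / \<bar>Re z\<bar>)"
proof -
  obtain B C n where B: "B holomorphic_on UNIV"
    "\<And>z. Re z \<le> 0 \<Longrightarrow> norm (B z) \<le> C * (1 + norm z) ^ n" "\<And>z. Re z \<le> 0 \<Longrightarrow> norm (M z * B z) \<le> C * (1 + norm z) ^ n"
    "\<And>r. \<exists>\<rho>\<ge>r. norm (B (- of_real \<rho>)) \<ge> exp (- \<epsilon> * \<rho>)"
    using dom unfolding dominated_left_def by blast
  define K where "K = max C 1 * 2 ^ n"
  have K: "K > 0" by (simp add: K_def)
  define B' where "B' = (\<lambda>z. B z / (of_real K * (1 - z) ^ n))"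
  have *: "X / (K * norm (1 - z) ^ n) \<le> 1" if "X \<le> C * (1 + norm z) ^ n" "Re z \<le> 0" for X z
  proof -
    have "(1 + norm z) ^ n \<le> (2 * norm (1 - z)) ^ n"
      using one_add_norm_le[OF that(2)] by (intro power_mono) auto
    then have "max C 1 * (1 + norm z) ^ n \<le> max C 1 * (2 * norm (1 - z)) ^ n"
      by (intro mult_left_mono) auto
    moreover have "C * (1 + norm z) ^ n \<le> max C 1 * (1 + norm z) ^ n" by (intro mult_right_mono) auto
    ultimately have "X \<le> K * norm (1 - z) ^ n" using that by (simp add: K_def power_mult_distrib mult.assoc)
    moreover have "K * norm (1 - z) ^ n > 0"
      using one_add_norm_le[OF that(2)] norm_ge_zero[of z] K by (intro mult_pos_pos zero_less_power) linarith+
    ultimately show ?thesis by (simp add: pos_divide_le_eq)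
  qed
  have "\<forall>\<^sub>F \<rho> in at_top. K * (1 + \<rho>) ^ n \<le> exp (\<epsilon> * \<rho>)" using \<epsilon> K by real_asymp
  then obtain r0 where r0: "\<And>\<rho>. \<rho> \<ge> r0 \<Longrightarrow> K * (1 + \<rho>) ^ n \<le> exp (\<epsilon> * \<rho>)" by (auto simp: eventually_at_top_linorder)
  obtain \<rho> where \<rho>: "\<rho> \<ge> max r0 1" "norm (B (- of_real \<rho>)) \<ge> exp (- \<epsilon> * \<rho>)" using B(4) by blast
  have "norm (1 + complex_of_real \<rho>) = 1 + \<rho>" using \<rho> norm_of_real[of "1 + \<rho>", where 'a=complex] by simp
  then have "norm (B' (- of_real \<rho>)) = norm (B (- of_real \<rho>)) / (K * (1 + \<rho>) ^ n)"
    using K by (simp add: B'_def norm_divide norm_mult norm_power)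
  moreover have "exp (- \<epsilon> * \<rho>) / exp (\<epsilon> * \<rho>) \<le> norm (B (- of_real \<rho>)) / (K * (1 + \<rho>) ^ n)"
    using \<rho> r0[of \<rho>] K by (intro frac_le) auto
  moreover have "exp (- \<epsilon> * \<rho>) / exp (\<epsilon> * \<rho>) = exp (- (2 * \<epsilon>) * \<rho>)"
    by (simp flip: exp_diff)
  ultimately have B'\<rho>: "norm (B' (- of_real \<rho>)) \<ge> exp (- (2 * \<epsilon>) * \<rho>)" by simp
  have "norm (M z) \<le> exp (8 * (2 * \<epsilon>) * (norm z)\<^sup>2 / \<bar>Re z\<bar>)" if z: "Re z < 0" "norm z \<ge> \<rho>" for z
  proof (rule half_plane_bound[where B = B' and \<rho> = \<rho>])
    show "M holomorphic_on {z. Re z < 0}" by (rule holomorphic_on_subset[OF M]) auto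
    show "B' holomorphic_on {z. Re z < 0}" unfolding B'_def
      by (intro holomorphic_intros holomorphic_on_subset[OF B(1)]) (use K in auto)
    show "norm (B' z) \<le> 1" if "Re z < 0" for z
      using *[OF B(2)[of z]] that K by (simp add: B'_def norm_divide norm_mult norm_power)
    show "norm (M z * B' z) \<le> 1" if "Re z < 0" for z
      using *[OF B(3)[of z]] that K by (simp add: B'_def norm_divide norm_mult norm_power)
  qed (use \<rho> B'\<rho> z in auto)
  then show ?thesis by (intro exI[of _ \<rho>]) auto
qed

theorem zero_exponential_type:
  assumes M: "M holomorphic_on UNIV"
    and "\<And>\<epsilon>. \<epsilon> > 0 \<Longrightarrow> dominated_left M \<epsilon>" "\<And>\<epsilon>. \<epsilon> > 0 \<Longrightarrow> dominated_left (\<lambda>z. M (- z)) \<epsilon>" and \<epsilon>: "\<epsilon> > 0"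
  shows "\<exists>C. \<forall>z. norm (M z) \<le> C * exp (\<epsilon> * norm z)"
proof -
  \<comment> \<open>320 = 20 * 16 combines the losses in \<open>exp_bound_of_cone_bound\<close> and
    \<open>dominated_left_bound\<close>.\<close>
  define e where "e = \<epsilon> / 320"
  have e: "e > 0" using \<epsilon> by (simp add: e_def)
  obtain r1 where r1: "\<And>z. Re z < 0 \<Longrightarrow> norm z \<ge> r1 \<Longrightarrow> norm (M z) \<le> exp (16 * e * (norm z)\<^sup>2 / \<bar>Re z\<bar>)"
    using dominated_left_bound[OF M assms(2)[OF e] e] by blast
  have "(\<lambda>z. M (- z)) holomorphic_on UNIV"
    by (rule holomorphic_on_compose_gen[OF _ M, unfolded o_def]) (auto intro!: holomorphic_intros)
  from dominated_left_bound[OF this assms(3)[OF e] e]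
  obtain r2 where r2: "\<And>z. Re z < 0 \<Longrightarrow> norm z \<ge> r2 \<Longrightarrow> norm (M (- z)) \<le> exp (16 * e * (norm z)\<^sup>2 / \<bar>Re z\<bar>)" by blast
  have "\<exists>C. \<forall>z. norm (M z) \<le> C * exp (20 * (16 * e) * norm z)"
  proof (rule exp_bound_of_cone_bound[OF M])
    show "norm (M z) \<le> exp (16 * e * (norm z)\<^sup>2 / \<bar>Re z\<bar>)" if "norm z \<ge> max r1 r2" "Re z \<noteq> 0" for z
      using r1[of z] r2[of "- z"] that by (cases "Re z < 0") auto
  qed (use e in auto)
  then show ?thesis by (simp add: e_def)
qed

section \<open>Pairs of entire functions with polynomially bounded minimum\<close>

lemma has_vector_derivative_glue:
  fixes f g :: "real \<Rightarrow> 'a :: real_normed_vector"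
  assumes "\<And>x. x \<le> c \<Longrightarrow> (f has_vector_derivative f' x) (at x)"
    and "\<And>x. x \<ge> c \<Longrightarrow> (g has_vector_derivative g' x) (at x)"
    and "f c = g c" "f' c = g' c"
  shows "((\<lambda>x. if x \<le> c then f x else g x) has_vector_derivative (if x \<le> c then f' x else g' x)) (at x)"
proof -
  have "((\<lambda>x. if x \<in> {..c} then f x else g x) has_vector_derivative (if x \<in> {..c} then f' x else g' x)) (at x within UNIV)"
    by (rule has_vector_derivative_If_within_closures[where T = "{c<..}"])
       (use assms in \<open>auto intro: has_vector_derivative_at_within\<close>)
  then show ?thesis by simp
qed

lemma periodic_shift_int:
  fixes u :: "real \<Rightarrow> 'a" and k :: int
  assumes "\<And>\<theta>. u (\<theta> + 2 * pi) = u \<theta>"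
  shows "u (\<theta> + 2 * pi * of_int k) = u \<theta>"
proof -
  have nat: "u (\<theta> + 2 * pi * of_nat n) = u \<theta>" for n \<theta>
  proof (induction n)
    case (Suc n)
    have "u (\<theta> + 2 * pi * of_nat (Suc n)) = u ((\<theta> + 2 * pi * of_nat n) + 2 * pi)" by (simp add: algebra_simps)
    then show ?case using assms Suc by simp
  qed simp
  show ?thesis
  proof (cases "k \<ge> 0")
    case True then show ?thesis using nat[of \<theta> "nat k"] by simp
  next
    case False then show ?thesis using nat[of "\<theta> + 2 * pi * of_int k" "nat (- k)"] by simp
  qed
qed

lemma integral_period:
  fixes f :: "real \<Rightarrow> real"
  assumes per: "\<And>\<theta>. f (\<theta> + 2 * pi) = f \<theta>" and cont: "continuous_on UNIV f" and z: "0 \<le> z" "z \<le> 2 * pi"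
  shows "integral {z..z + 2 * pi} f = integral {0..2 * pi} f"
proof -
  have int: "f integrable_on {a..b}" for a b
    by (intro integrable_continuous_real continuous_on_subset[OF cont]) auto
  have "integral {0..z} (\<lambda>x. f (x + 2 * pi)) = integral {0 + 2 * pi..z + 2 * pi} f"
    using integral_shift_cbox_plus[of 0 z f "2 * pi"] by (simp add: o_def add.commute)
  then have "integral {2 * pi..z + 2 * pi} f = integral {0..z} f" by (simp add: per)
  moreover have "integral {z..2 * pi} f + integral {2 * pi..z + 2 * pi} f = integral {z..z + 2 * pi} f"
    by (rule Henstock_Kurzweil_Integration.integral_combine) (use z int in auto)
  moreover have "integral {0..z} f + integral {z..2 * pi} f = integral {0..2 * pi} f"
    by (rule Henstock_Kurzweil_Integration.integral_combine) (use z int in auto)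
  ultimately show ?thesis by simp
qed

text \<open>Picone's identity: for k = \<beta> cot a, the Riccati equation k' = - \<beta>^2 - k^2
  makes the integrand (g' - k g)^2 plus the derivative of k g^2, and the latter integrates to 0
  because g vanishes at both ends. The slack pi - \<beta> (y - x) is shared equally between the
  ends, which keeps a inside (0, pi) and k finite.\<close>

lemma Wirtinger_interval:
  fixes g g' :: "real \<Rightarrow> real"
  assumes g: "\<And>\<theta>. (g has_real_derivative g' \<theta>) (at \<theta>)" and cont: "continuous_on UNIV g'"
    and "x \<le> y" "g x = 0" "g y = 0" and \<beta>: "\<beta> \<ge> 0" "\<beta> * (y - x) < pi"
  shows "integral {x..y} (\<lambda>\<theta>. (g' \<theta>)\<^sup>2 - \<beta>\<^sup>2 * (g \<theta>)\<^sup>2) \<ge> 0"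
proof -
  define \<delta> where "\<delta> = (pi - \<beta> * (y - x)) / 2"
  have "\<delta> > 0" using \<beta> by (simp add: \<delta>_def)
  define a where "a = (\<lambda>\<theta>. \<beta> * (\<theta> - x) + \<delta>)"
  define k where "k = (\<lambda>\<theta>. \<beta> * cos (a \<theta>) / sin (a \<theta>))"
  have sin: "sin (a \<theta>) > 0" if "\<theta> \<in> {x..y}" for \<theta>
  proof (rule sin_gt_zero)
    have "\<beta> * (\<theta> - x) \<ge> 0" "\<beta> * (\<theta> - x) \<le> \<beta> * (y - x)" using that \<beta> by (auto intro: mult_left_mono)
    then show "0 < a \<theta>" "a \<theta> < pi" using \<open>\<delta> > 0\<close> \<beta>(2) unfolding a_def \<delta>_def by (auto simp: field_simps)
  qed
  define F' where "F' = (\<lambda>\<theta>. (- \<beta>\<^sup>2 - (k \<theta>)\<^sup>2) * (g \<theta>)\<^sup>2 + k \<theta> * (2 * g \<theta> * g' \<theta>))"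
  have a': "(a has_real_derivative \<beta>) (at \<theta>)" for \<theta>
    unfolding a_def by (auto intro!: derivative_eq_intros)
  have k': "(k has_real_derivative - \<beta>\<^sup>2 - (k \<theta>)\<^sup>2) (at \<theta>)" if "\<theta> \<in> {x..y}" for \<theta>
  proof -
    have "sin (a \<theta>) \<noteq> 0" using sin[OF that] by simp
    have "(k has_real_derivative (- (\<beta> * \<beta> * sin (a \<theta>)) * sin (a \<theta>) - \<beta> * cos (a \<theta>) * (cos (a \<theta>) * \<beta>)) / (sin (a \<theta>) * sin (a \<theta>))) (at \<theta>)"
      unfolding k_def using \<open>sin (a \<theta>) \<noteq> 0\<close> by (auto intro!: derivative_eq_intros a')
    moreover have "(- (\<beta> * \<beta> * sin (a \<theta>)) * sin (a \<theta>) - \<beta> * cos (a \<theta>) * (cos (a \<theta>) * \<beta>)) / (sin (a \<theta>) * sin (a \<theta>)) = - \<beta>\<^sup>2 - (k \<theta>)\<^sup>2"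
      using \<open>sin (a \<theta>) \<noteq> 0\<close> by (simp add: k_def power2_eq_square field_simps)
    ultimately show ?thesis by simp
  qed
  have "((\<lambda>\<theta>. k \<theta> * (g \<theta>)\<^sup>2) has_vector_derivative F' \<theta>) (at \<theta> within {x..y})" if "\<theta> \<in> {x..y}" for \<theta>
    unfolding F'_def has_real_derivative_iff_has_vector_derivative[symmetric]
    by (rule has_field_derivative_at_within) (auto intro!: derivative_eq_intros k'[OF that] g simp: algebra_simps)
  then have "(F' has_integral k y * (g y)\<^sup>2 - k x * (g x)\<^sup>2) {x..y}"
    using \<open>x \<le> y\<close> by (intro fundamental_theorem_of_calculus) auto
  then have F': "(F' has_integral 0) {x..y}" using assms by simp
  have contg: "continuous_on {x..y} g"
    by (rule continuous_at_imp_continuous_on) (auto intro: DERIV_isCont g)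
  have contk: "continuous_on {x..y} k"
    by (rule continuous_at_imp_continuous_on) (auto intro: DERIV_isCont k')
  have eq: "(g' \<theta>)\<^sup>2 - \<beta>\<^sup>2 * (g \<theta>)\<^sup>2 = (g' \<theta> - k \<theta> * g \<theta>)\<^sup>2 + F' \<theta>" for \<theta>
    by (simp add: F'_def power2_eq_square algebra_simps)
  have "(\<lambda>\<theta>. (g' \<theta> - k \<theta> * g \<theta>)\<^sup>2) integrable_on {x..y}"
    by (intro integrable_continuous_real continuous_intros contg contk continuous_on_subset[OF cont]) auto
  then have "integral {x..y} (\<lambda>\<theta>. (g' \<theta> - k \<theta> * g \<theta>)\<^sup>2 + F' \<theta>) = integral {x..y} (\<lambda>\<theta>. (g' \<theta> - k \<theta> * g \<theta>)\<^sup>2) + 0"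
    using Henstock_Kurzweil_Integration.integral_add[OF _ has_integral_integrable[OF F']] integral_unique[OF F']
    by simp
  moreover have "integral {x..y} (\<lambda>\<theta>. (g' \<theta> - k \<theta> * g \<theta>)\<^sup>2) \<ge> 0"
    by (rule Henstock_Kurzweil_Integration.integral_nonneg) (fact, simp)
  ultimately show ?thesis unfolding eq by simp
qed

text \<open>The zeros of \<open>g\<close> may accumulate, so the interval estimates are not summed
  over the gaps. Instead a supremum is taken over the zeros up to which the integral of
  \<open>h\<close> is nonnegative; a further zero is always less than \<open>el\<close> away, so the
  supremum is the end of the period.\<close>

lemma Wirtinger_periodic:
  fixes g g' :: "real \<Rightarrow> real"
  assumes g: "\<And>\<theta>. (g has_real_derivative g' \<theta>) (at \<theta>)" and cont: "continuous_on UNIV g'"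
    and per: "\<And>\<theta>. g (\<theta> + 2 * pi) = g \<theta>" "\<And>\<theta>. g' (\<theta> + 2 * pi) = g' \<theta>"
    and z: "0 \<le> z" "z \<le> 2 * pi" "g z = 0"
    and \<beta>: "\<beta> \<ge> 0" "\<beta> * el < pi" "el > 0"
    and zeros: "\<And>x. \<exists>\<theta>. x < \<theta> \<and> \<theta> < x + el \<and> g \<theta> = 0"
  shows "\<beta>\<^sup>2 * integral {0..2 * pi} (\<lambda>\<theta>. (g \<theta>)\<^sup>2) \<le> integral {0..2 * pi} (\<lambda>\<theta>. (g' \<theta>)\<^sup>2)"
proof -
  define h where "h = (\<lambda>\<theta>. (g' \<theta>)\<^sup>2 - \<beta>\<^sup>2 * (g \<theta>)\<^sup>2)"
  define P where "P = (\<lambda>x. integral {z..x} h)"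
  have contg: "continuous_on A g" for A
    by (rule continuous_at_imp_continuous_on) (auto intro: DERIV_isCont g)
  have conth: "continuous_on A h" for A unfolding h_def
    by (intro continuous_intros contg continuous_on_subset[OF cont]) auto
  have int: "h integrable_on {a..b}" for a b by (intro integrable_continuous_real conth)
  define S where "S = {x \<in> {z..z + 2 * pi}. g x = 0 \<and> P x \<ge> 0}"
  have "continuous_on {z..z + 2 * pi} P" unfolding P_def by (intro indefinite_integral_continuous_1 int)
  have "closed ({x \<in> {z..z + 2 * pi}. g x = 0} \<inter> {x \<in> {z..z + 2 * pi}. P x \<in> {0..}})"
  proof (intro closed_Int)
    show "closed {x \<in> {z..z + 2 * pi}. g x = 0}"
      by (rule continuous_closed_preimage_constant) (auto intro: contg)
    show "closed {x \<in> {z..z + 2 * pi}. P x \<in> {0..}}"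
      using continuous_closed_preimage[OF \<open>continuous_on _ P\<close>, of "{0..}"] by (simp add: vimage_def Int_def)
  qed
  moreover have "S = {x \<in> {z..z + 2 * pi}. g x = 0} \<inter> {x \<in> {z..z + 2 * pi}. P x \<in> {0..}}"
    by (auto simp: S_def)
  ultimately have "closed S" by simp
  have "z \<in> S" using z by (simp add: S_def P_def)
  have bdd: "bdd_above S" by (auto simp: S_def bdd_above_def)
  define m where "m = Sup S"
  have m: "m \<in> S" unfolding m_def by (rule closed_contains_Sup[OF _ bdd \<open>closed S\<close>]) (use \<open>z \<in> S\<close> in auto)
  have "m = z + 2 * pi"
  proof (rule ccontr)
    assume "m \<noteq> z + 2 * pi"
    then have lt: "m < z + 2 * pi" "z \<le> m" "g m = 0" "P m \<ge> 0" using m by (auto simp: S_def)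
    obtain x0 where x0: "m < x0" "x0 < m + el" "g x0 = 0" using zeros by blast
    define x where "x = min x0 (z + 2 * pi)"
    have x: "m < x" "x < m + el" "x \<le> z + 2 * pi" "g x = 0"
      using x0 lt z per(1)[of z] by (auto simp: x_def min_def)
    have "\<beta> * (x - m) \<le> \<beta> * el" using x \<beta> by (intro mult_left_mono) auto
    then have "integral {m..x} h \<ge> 0" unfolding h_def
      using x lt \<beta> by (intro Wirtinger_interval[OF g cont]) auto
    moreover have "P m + integral {m..x} h = P x" unfolding P_def
      by (rule Henstock_Kurzweil_Integration.integral_combine) (use x lt int in auto)
    ultimately have "x \<in> S" using x lt by (auto simp: S_def)
    then have "x \<le> m" unfolding m_def using bdd by (rule cSup_upper)
    then show False using x by simp
  qed
  then have "integral {z..z + 2 * pi} h \<ge> 0" using m by (simp add: S_def P_def)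
  moreover have "integral {z..z + 2 * pi} h = integral {0..2 * pi} h"
    by (rule integral_period) (use z per conth in \<open>auto simp: h_def\<close>)
  moreover have "integral {0..2 * pi} h = integral {0..2 * pi} (\<lambda>\<theta>. (g' \<theta>)\<^sup>2) - integral {0..2 * pi} (\<lambda>\<theta>. \<beta>\<^sup>2 * (g \<theta>)\<^sup>2)"
    unfolding h_def
    by (intro Henstock_Kurzweil_Integration.integral_diff integrable_continuous_real continuous_intros contg continuous_on_subset[OF cont]) auto
  ultimately show ?thesis by simp
qed

text \<open>The longest arcs on which two functions with disjoint supports do not vanish fit together into the circle.\<close>

lemma zero_free_lengths:
  fixes u v :: "real \<Rightarrow> real"
  assumes per: "\<And>\<theta>. u (\<theta> + 2 * pi) = u \<theta>" "\<And>\<theta>. v (\<theta> + 2 * pi) = v \<theta>"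
    and disj: "\<And>\<theta>. u \<theta> = 0 \<or> v \<theta> = 0"
    and l: "l1 > 0" "l2 > 0" "\<And>\<theta>. x < \<theta> \<Longrightarrow> \<theta> < x + l1 \<Longrightarrow> u \<theta> \<noteq> 0" "\<And>\<theta>. y < \<theta> \<Longrightarrow> \<theta> < y + l2 \<Longrightarrow> v \<theta> \<noteq> 0"
  shows "l1 + l2 \<le> 2 * pi"
proof -
  define k where "k = \<lfloor>(y - x) / (2 * pi)\<rfloor>"
  define y' where "y' = y - 2 * pi * of_int k"
  have "of_int k \<le> (y - x) / (2 * pi)" "(y - x) / (2 * pi) < of_int k + 1" unfolding k_def by linarith+
  then have "2 * pi * of_int k \<le> y - x" "y - x < 2 * pi * (of_int k + 1)"
    by (auto simp: field_simps)
  then have y': "x \<le> y'" "y' < x + 2 * pi" by (auto simp: y'_def algebra_simps)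
  have v: "v \<theta> \<noteq> 0" if "y' < \<theta>" "\<theta> < y' + l2" for \<theta>
    using l(4)[of "\<theta> + 2 * pi * of_int k"] that periodic_shift_int[of v \<theta> k, OF per(2)] by (simp add: y'_def)
  have u: "u \<theta> \<noteq> 0" if "x + 2 * pi < \<theta>" "\<theta> < x + 2 * pi + l1" for \<theta>
    using l(3)[of "\<theta> - 2 * pi"] that per(1)[of "\<theta> - 2 * pi"] by simp
  have "x + l1 \<le> y'"
  proof (rule ccontr)
    assume "\<not> x + l1 \<le> y'"
    then obtain \<theta> where "y' < \<theta>" "\<theta> < min (x + l1) (y' + l2)"
      using dense[of y' "min (x + l1) (y' + l2)"] l by auto
    then show False using v[of \<theta>] l(3)[of \<theta>] disj[of \<theta>] y' by auto
  qed
  moreover have "y' + l2 \<le> x + 2 * pi"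
  proof (rule ccontr)
    assume "\<not> y' + l2 \<le> x + 2 * pi"
    then obtain \<theta> where "x + 2 * pi < \<theta>" "\<theta> < min (x + 2 * pi + l1) (y' + l2)"
      using dense[of "x + 2 * pi" "min (x + 2 * pi + l1) (y' + l2)"] l by auto
    then show False using v[of \<theta>] u[of \<theta>] disj[of \<theta>] y' by auto
  qed
  ultimately show ?thesis by simp
qed

lemma zero_free_interval_exists:
  fixes u :: "real \<Rightarrow> real"
  assumes "continuous_on UNIV u" "u \<theta> \<noteq> 0"
  shows "\<exists>l>0. \<exists>x. \<forall>\<theta>. x < \<theta> \<and> \<theta> < x + l \<longrightarrow> u \<theta> \<noteq> 0"
proof -
  have "open {\<theta>. u \<theta> \<noteq> 0}"
    using assms(1) by (intro open_Collect_neq) auto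
  then obtain e where e: "e > 0" "ball \<theta> e \<subseteq> {\<theta>. u \<theta> \<noteq> 0}" using assms(2) openE[of "{\<theta>. u \<theta> \<noteq> 0}" \<theta>] by blast
  have "u t \<noteq> 0" if "\<theta> < t" "t < \<theta> + e" for t
  proof -
    have "t \<in> ball \<theta> e" using that by (simp add: dist_real_def)
    then show ?thesis using e(2) by blast
  qed
  then show ?thesis using e(1) by blast
qed

text \<open>The rate of each function is pi / \<ell>, where \<ell> is the supremum of the lengths of
  its zero-free arcs; as the two suprema add up to at most 2 pi, the rates have a sum of at least 2
  by the inequality between arithmetic and harmonic means. The strict \<beta> < \<alpha> leaves room
  for a length slightly above the supremum, and every open arc of that length contains a
  zero.\<close>

lemma Wirtinger_disjoint:
  fixes u v u' v' :: "real \<Rightarrow> real"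
  assumes u: "\<And>\<theta>. (u has_real_derivative u' \<theta>) (at \<theta>)" and contu: "continuous_on UNIV u'"
    and v: "\<And>\<theta>. (v has_real_derivative v' \<theta>) (at \<theta>)" and contv: "continuous_on UNIV v'"
    and peru: "\<And>\<theta>. u (\<theta> + 2 * pi) = u \<theta>" "\<And>\<theta>. u' (\<theta> + 2 * pi) = u' \<theta>"
    and perv: "\<And>\<theta>. v (\<theta> + 2 * pi) = v \<theta>" "\<And>\<theta>. v' (\<theta> + 2 * pi) = v' \<theta>"
    and disj: "\<And>\<theta>. u \<theta> = 0 \<or> v \<theta> = 0"
    and nz: "0 \<le> zu" "zu \<le> 2 * pi" "u zu \<noteq> 0" "0 \<le> zv" "zv \<le> 2 * pi" "v zv \<noteq> 0"
  shows "\<exists>\<alpha>1 \<alpha>2. \<alpha>1 > 0 \<and> \<alpha>2 > 0 \<and> \<alpha>1 + \<alpha>2 \<ge> 2 \<and>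
    (\<forall>\<beta>. 0 \<le> \<beta> \<and> \<beta> < \<alpha>1 \<longrightarrow> \<beta>\<^sup>2 * integral {0..2 * pi} (\<lambda>\<theta>. (u \<theta>)\<^sup>2) \<le> integral {0..2 * pi} (\<lambda>\<theta>. (u' \<theta>)\<^sup>2)) \<and>
    (\<forall>\<beta>. 0 \<le> \<beta> \<and> \<beta> < \<alpha>2 \<longrightarrow> \<beta>\<^sup>2 * integral {0..2 * pi} (\<lambda>\<theta>. (v \<theta>)\<^sup>2) \<le> integral {0..2 * pi} (\<lambda>\<theta>. (v' \<theta>)\<^sup>2))"
proof -
  define L where "L = (\<lambda>u :: real \<Rightarrow> real. {l. l > 0 \<and> (\<exists>x. \<forall>\<theta>. x < \<theta> \<and> \<theta> < x + l \<longrightarrow> u \<theta> \<noteq> 0)})"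
  have "continuous_on UNIV u" "continuous_on UNIV v"
    by (rule continuous_at_imp_continuous_on; auto intro: DERIV_isCont u v)+
  then have ne: "L u \<noteq> {}" "L v \<noteq> {}"
    using zero_free_interval_exists[of u zu] zero_free_interval_exists[of v zv] nz by (auto simp: L_def)
  have sum: "l1 + l2 \<le> 2 * pi" if "l1 \<in> L u" "l2 \<in> L v" for l1 l2
  proof -
    from that obtain x y where "l1 > 0" "l2 > 0"
      "\<And>\<theta>. x < \<theta> \<Longrightarrow> \<theta> < x + l1 \<Longrightarrow> u \<theta> \<noteq> 0" "\<And>\<theta>. y < \<theta> \<Longrightarrow> \<theta> < y + l2 \<Longrightarrow> v \<theta> \<noteq> 0"
      unfolding L_def by blast
    then show ?thesis using zero_free_lengths[of u v l1 l2 x y] peru(1) perv(1) disj by blast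
  qed
  define el1 el2 where "el1 = Sup (L u)" and "el2 = Sup (L v)"
  have bdd: "bdd_above (L u)" "bdd_above (L v)"
  proof -
    obtain l1 l2 where "l1 \<in> L u" "l2 \<in> L v" using ne by blast
    then show "bdd_above (L u)" "bdd_above (L v)"
      using sum[of _ l2] sum[of l1]
      by (auto intro: bdd_aboveI[of "L u" "2 * pi - l2"] bdd_aboveI[of "L v" "2 * pi - l1"] simp: le_diff_eq add.commute)
  qed
  have pos: "el1 > 0" "el2 > 0"
  proof -
    obtain l1 l2 where l: "l1 \<in> L u" "l2 \<in> L v" using ne by blast
    then have "l1 > 0" "l2 > 0" by (auto simp: L_def)
    then show "el1 > 0" "el2 > 0"
      using cSup_upper[OF l(1) bdd(1)] cSup_upper[OF l(2) bdd(2)] unfolding el1_def el2_def by linarith+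
  qed
  have "el1 \<le> 2 * pi - el2"
    unfolding el1_def
  proof (rule cSup_least[OF ne(1)])
    fix l1 assume l1: "l1 \<in> L u"
    have "el2 \<le> 2 * pi - l1" unfolding el2_def
      by (rule cSup_least[OF ne(2)]) (use sum[OF l1] in force)
    then show "l1 \<le> 2 * pi - el2" by simp
  qed
  then have le: "el1 + el2 \<le> 2 * pi" by simp
  have key: "\<beta>\<^sup>2 * integral {0..2 * pi} (\<lambda>\<theta>. (g \<theta>)\<^sup>2) \<le> integral {0..2 * pi} (\<lambda>\<theta>. (g' \<theta>)\<^sup>2)"
    if hyp: "\<And>\<theta>. (g has_real_derivative g' \<theta>) (at \<theta>)" "continuous_on UNIV g'"
      "\<And>\<theta>. g (\<theta> + 2 * pi) = g \<theta>" "\<And>\<theta>. g' (\<theta> + 2 * pi) = g' \<theta>"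
      "0 \<le> z" "z \<le> 2 * pi" "g z = 0" "bdd_above (L g)" "Sup (L g) > 0" "0 \<le> \<beta>" "\<beta> < pi / Sup (L g)" for g g' z \<beta>
  proof -
    have "\<beta> * Sup (L g) < pi" using hyp by (simp add: pos_less_divide_eq)
    obtain l where l: "Sup (L g) < l" "\<beta> * l < pi"
    proof (cases "\<beta> = 0")
      case True then show ?thesis using hyp(9) by (intro that[of "Sup (L g) + 1"]) auto
    next
      case False
      then have "Sup (L g) < pi / \<beta>" using \<open>\<beta> * Sup (L g) < pi\<close> \<open>0 \<le> \<beta>\<close> by (simp add: field_simps)
      then obtain l where "Sup (L g) < l" "l < pi / \<beta>" using dense by blast
      then show ?thesis using False \<open>0 \<le> \<beta>\<close> by (intro that[of l]) (auto simp: field_simps)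
    qed
    show ?thesis
    proof (rule Wirtinger_periodic[OF hyp(1-7) \<open>0 \<le> \<beta>\<close> l(2)])
      show "l > 0" using l(1) hyp(9) by simp
      fix x
      have "l \<notin> L g" using l(1) cSup_upper[OF _ hyp(8)] by force
      then show "\<exists>\<theta>. x < \<theta> \<and> \<theta> < x + l \<and> g \<theta> = 0" using \<open>l > 0\<close> by (auto simp: L_def)
    qed
  qed
  \<comment> \<open>Each function vanishes where the other does not, which yields the zero at which
    \<open>Wirtinger_periodic\<close> starts.\<close>
  have "u zv = 0" "v zu = 0" using disj nz by blast+
  have "pi / el1 + pi / el2 \<ge> 2"
  proof -
    have "4 * (el1 * el2) \<le> (el1 + el2) * (el1 + el2)"
      using zero_le_square[of "el1 - el2"] by (simp add: algebra_simps)
    also have "\<dots> \<le> 2 * pi * (el1 + el2)" using le pos by (intro mult_right_mono) auto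
    finally have "2 * (el1 * el2) \<le> pi * (el1 + el2)" by simp
    then show ?thesis using pos by (simp add: field_simps)
  qed
  moreover have "pi / el1 > 0" "pi / el2 > 0" using pos by auto
  moreover have "\<beta>\<^sup>2 * integral {0..2 * pi} (\<lambda>\<theta>. (u \<theta>)\<^sup>2) \<le> integral {0..2 * pi} (\<lambda>\<theta>. (u' \<theta>)\<^sup>2)"
    if "0 \<le> \<beta>" "\<beta> < pi / el1" for \<beta>
    by (rule key[OF u contu peru nz(4,5) \<open>u zv = 0\<close> bdd(1)]) (use that pos in \<open>auto simp: el1_def\<close>)
  moreover have "\<beta>\<^sup>2 * integral {0..2 * pi} (\<lambda>\<theta>. (v \<theta>)\<^sup>2) \<le> integral {0..2 * pi} (\<lambda>\<theta>. (v' \<theta>)\<^sup>2)"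
    if "0 \<le> \<beta>" "\<beta> < pi / el2" for \<beta>
    by (rule key[OF v contv perv nz(1,2) \<open>v zu = 0\<close> bdd(2)]) (use that pos in \<open>auto simp: el2_def\<close>)
  ultimately show ?thesis
    by (intro exI[of _ "pi / el1"] exI[of _ "pi / el2"] conjI allI impI) auto
qed

text \<open>The radial and angular variables of \<open>exp (t + \<i> \<theta>)\<close> turn the Laplacian into
  \<open>U\<^sub>t\<^sub>t + U\<^sub>\<theta>\<^sub>\<theta>\<close> up to a positive factor, so the locale describes a nonnegative
  subharmonic function of class \<open>C\<^sup>2\<close> that vanishes near the origin.\<close>

locale log_polar_subharmonic =
  fixes U Ut Uo Utt Uoo :: "real \<Rightarrow> real \<Rightarrow> real" and t0 :: real
  assumes Ut: "((\<lambda>t. U t \<theta>) has_real_derivative Ut t \<theta>) (at t)"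
    and Utt: "((\<lambda>t. Ut t \<theta>) has_real_derivative Utt t \<theta>) (at t)"
    and Uo: "(U t has_real_derivative Uo t \<theta>) (at \<theta>)"
    and Uoo: "(Uo t has_real_derivative Uoo t \<theta>) (at \<theta>)"
    and cont: "continuous_on UNIV (\<lambda>(t, \<theta>). U t \<theta>)" "continuous_on UNIV (\<lambda>(t, \<theta>). Ut t \<theta>)"
      "continuous_on UNIV (\<lambda>(t, \<theta>). Uo t \<theta>)" "continuous_on UNIV (\<lambda>(t, \<theta>). Utt t \<theta>)"
      "continuous_on UNIV (\<lambda>(t, \<theta>). Uoo t \<theta>)"
    and periodic: "U t (\<theta> + 2 * pi) = U t \<theta>" "Uo t (\<theta> + 2 * pi) = Uo t \<theta>"
    and nonneg: "U t \<theta> \<ge> 0" and laplace: "Utt t \<theta> + Uoo t \<theta> \<ge> 0"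
    and zero: "t \<le> t0 \<Longrightarrow> U t \<theta> = 0"
begin

lemma cont_comp [continuous_intros]:
  fixes p :: "'b :: topological_space \<Rightarrow> real"
  assumes "continuous_on S p" "continuous_on S q"
  shows "continuous_on S (\<lambda>x. U (p x) (q x))" "continuous_on S (\<lambda>x. Ut (p x) (q x))"
    "continuous_on S (\<lambda>x. Uo (p x) (q x))" "continuous_on S (\<lambda>x. Utt (p x) (q x))" "continuous_on S (\<lambda>x. Uoo (p x) (q x))"
  using cont[THEN continuous_on_compose2, of S "\<lambda>x. (p x, q x)"] assms
  by (auto intro: continuous_on_Pair)

definition A where "A t = integral {0..2 * pi} (\<lambda>\<theta>. (U t \<theta>)\<^sup>2)"
definition G where "G t = integral {0..2 * pi} (\<lambda>\<theta>. U t \<theta> * Ut t \<theta>)"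
definition H where "H t = integral {0..2 * pi} (\<lambda>\<theta>. (Ut t \<theta>)\<^sup>2 + U t \<theta> * Utt t \<theta>)"

lemma A_deriv: "(A has_real_derivative 2 * G t) (at t)"
proof -
  have "((\<lambda>t. integral (cbox 0 (2 * pi)) (\<lambda>\<theta>. (U t \<theta>)\<^sup>2)) has_field_derivative
      integral (cbox 0 (2 * pi)) (\<lambda>\<theta>. 2 * (U t \<theta> * Ut t \<theta>))) (at t within UNIV)"
    by (rule leibniz_rule_field_derivative)
       (auto intro!: derivative_eq_intros Ut integrable_continuous_real continuous_intros simp: split_beta)
  then show ?thesis by (simp add: A_def[abs_def] G_def)
qed

lemma G_deriv: "(G has_real_derivative H t) (at t)"
proof -
  have "((\<lambda>t. integral (cbox 0 (2 * pi)) (\<lambda>\<theta>. U t \<theta> * Ut t \<theta>)) has_field_derivative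
      integral (cbox 0 (2 * pi)) (\<lambda>\<theta>. (Ut t \<theta>)\<^sup>2 + U t \<theta> * Utt t \<theta>)) (at t within UNIV)"
    by (rule leibniz_rule_field_derivative)
       (auto intro!: derivative_eq_intros Ut Utt integrable_continuous_real continuous_intros simp: split_beta power2_eq_square)
  then show ?thesis by (simp add: G_def[abs_def] H_def)
qed

text \<open>Integration by parts over a period turns the mean of U Uoo into that of - Uo^2, and U
  (Utt + Uoo) \<ge> 0 then bounds the mean of U Utt from below by that of Uo^2.\<close>

lemma H_ge: "H t \<ge> integral {0..2 * pi} (\<lambda>\<theta>. (Ut t \<theta>)\<^sup>2) + integral {0..2 * pi} (\<lambda>\<theta>. (Uo t \<theta>)\<^sup>2)"
proof -
  have int: "f integrable_on {0..2 * pi}" if "continuous_on UNIV f" for f :: "real \<Rightarrow> real"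
    by (intro integrable_continuous_real continuous_on_subset[OF that]) auto
  have "((\<lambda>\<theta>. U t \<theta> * Uo t \<theta>) has_real_derivative (Uo t \<theta>)\<^sup>2 + U t \<theta> * Uoo t \<theta>) (at \<theta>)" for \<theta>
    by (rule DERIV_cong[OF DERIV_mult[OF Uo Uoo]]) (simp add: power2_eq_square)
  then have "((\<lambda>\<theta>. (Uo t \<theta>)\<^sup>2 + U t \<theta> * Uoo t \<theta>) has_integral U t (2 * pi) * Uo t (2 * pi) - U t 0 * Uo t 0) {0..2 * pi}"
    by (intro fundamental_theorem_of_calculus)
       (auto simp: has_real_derivative_iff_has_vector_derivative intro: has_vector_derivative_at_within)
  then have "integral {0..2 * pi} (\<lambda>\<theta>. (Uo t \<theta>)\<^sup>2 + U t \<theta> * Uoo t \<theta>) = 0"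
    using periodic[of t 0] by (simp add: integral_unique)
  then have "integral {0..2 * pi} (\<lambda>\<theta>. (Ut t \<theta>)\<^sup>2) + integral {0..2 * pi} (\<lambda>\<theta>. (Uo t \<theta>)\<^sup>2) =
    integral {0..2 * pi} (\<lambda>\<theta>. (Ut t \<theta>)\<^sup>2) + integral {0..2 * pi} (\<lambda>\<theta>. (Uo t \<theta>)\<^sup>2) - integral {0..2 * pi} (\<lambda>\<theta>. (Uo t \<theta>)\<^sup>2 + U t \<theta> * Uoo t \<theta>)"
    by simp
  also have "\<dots> = integral {0..2 * pi} (\<lambda>\<theta>. (Ut t \<theta>)\<^sup>2 + (Uo t \<theta>)\<^sup>2 - ((Uo t \<theta>)\<^sup>2 + U t \<theta> * Uoo t \<theta>))"
  proof -
    have i: "(\<lambda>\<theta>. (Ut t \<theta>)\<^sup>2) integrable_on {0..2 * pi}" "(\<lambda>\<theta>. (Uo t \<theta>)\<^sup>2) integrable_on {0..2 * pi}"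
      "(\<lambda>\<theta>. (Uo t \<theta>)\<^sup>2 + U t \<theta> * Uoo t \<theta>) integrable_on {0..2 * pi}"
      by (intro int continuous_intros)+
    show ?thesis
      using Henstock_Kurzweil_Integration.integral_add[OF i(1,2)]
        Henstock_Kurzweil_Integration.integral_diff[OF integrable_add[OF i(1,2)] i(3)] by simp
  qed
  also have "\<dots> \<le> H t" unfolding H_def
  proof (rule integral_le)
    fix \<theta> assume "\<theta> \<in> {0..2 * pi}"
    have "0 \<le> U t \<theta> * (Utt t \<theta> + Uoo t \<theta>)" using nonneg laplace by simp
    then show "(Ut t \<theta>)\<^sup>2 + (Uo t \<theta>)\<^sup>2 - ((Uo t \<theta>)\<^sup>2 + U t \<theta> * Uoo t \<theta>) \<le> (Ut t \<theta>)\<^sup>2 + U t \<theta> * Utt t \<theta>"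
      by (simp add: distrib_left)
  qed (intro int continuous_intros)+
  finally show ?thesis .
qed

lemma H_nonneg: "H t \<ge> 0"
proof -
  have "integral {0..2 * pi} (\<lambda>\<theta>. (Ut t \<theta>)\<^sup>2) \<ge> 0" "integral {0..2 * pi} (\<lambda>\<theta>. (Uo t \<theta>)\<^sup>2) \<ge> 0"
    by (intro Henstock_Kurzweil_Integration.integral_nonneg integrable_continuous_real continuous_intros; simp)+
  then show ?thesis using H_ge[of t] by linarith
qed

text \<open>The elementary inequality 2 \<beta> U Ut \<le> \<beta>^2 U^2 + Ut^2 converts a Wirtinger
  constant \<beta> on the circle into a lower bound 2 \<beta> for the logarithmic derivative of
  \<open>G\<close>.\<close>

lemma H_ge_G:
  assumes "\<beta>\<^sup>2 * integral {0..2 * pi} (\<lambda>\<theta>. (U t \<theta>)\<^sup>2) \<le> integral {0..2 * pi} (\<lambda>\<theta>. (Uo t \<theta>)\<^sup>2)"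
  shows "2 * \<beta> * G t \<le> H t"
proof -
  have int: "f integrable_on {0..2 * pi}" if "continuous_on UNIV f" for f :: "real \<Rightarrow> real"
    by (intro integrable_continuous_real continuous_on_subset[OF that]) auto
  have "2 * \<beta> * G t = integral {0..2 * pi} (\<lambda>\<theta>. 2 * \<beta> * (U t \<theta> * Ut t \<theta>))" by (simp add: G_def)
  also have "\<dots> \<le> integral {0..2 * pi} (\<lambda>\<theta>. \<beta>\<^sup>2 * (U t \<theta>)\<^sup>2 + (Ut t \<theta>)\<^sup>2)"
  proof (rule integral_le)
    fix \<theta> show "2 * \<beta> * (U t \<theta> * Ut t \<theta>) \<le> \<beta>\<^sup>2 * (U t \<theta>)\<^sup>2 + (Ut t \<theta>)\<^sup>2"
      using zero_le_power2[of "\<beta> * U t \<theta> - Ut t \<theta>"] by (simp add: power2_eq_square algebra_simps)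
  qed (intro int continuous_intros)+
  also have "\<dots> = \<beta>\<^sup>2 * integral {0..2 * pi} (\<lambda>\<theta>. (U t \<theta>)\<^sup>2) + integral {0..2 * pi} (\<lambda>\<theta>. (Ut t \<theta>)\<^sup>2)"
  proof -
    have i: "(\<lambda>\<theta>. \<beta>\<^sup>2 * (U t \<theta>)\<^sup>2) integrable_on {0..2 * pi}" "(\<lambda>\<theta>. (Ut t \<theta>)\<^sup>2) integrable_on {0..2 * pi}"
      by (intro int continuous_intros)+
    show ?thesis using Henstock_Kurzweil_Integration.integral_add[OF i] by simp
  qed
  also have "\<dots> \<le> H t" using assms H_ge[of t] by linarith
  finally show ?thesis .
qed

lemma G_mono:
  assumes "s \<le> t" shows "G s \<le> G t"
proof (rule DERIV_nonneg_imp_nondecreasing[OF assms])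
  fix x show "\<exists>y. (G has_real_derivative y) (at x) \<and> 0 \<le> y" using G_deriv[of x] H_nonneg[of x] by blast
qed

lemma G_nonneg: "G t \<ge> 0"
proof -
  have "G (min t t0) = 0" unfolding G_def using zero by (simp add: min_def)
  then show ?thesis using G_mono[of "min t t0" t] by simp
qed

lemma G_pos:
  assumes "U t \<theta> \<noteq> 0" shows "\<exists>s. G s > 0"
proof (rule ccontr)
  assume "\<not> (\<exists>s. G s > 0)"
  then have "G s = 0" for s using G_nonneg[of s] by (meson antisym not_le)
  then have "A t = A t0" using A_deriv by (intro DERIV_isconst_all[of A]) auto
  then have "A t = 0" using zero[OF order_refl] by (simp add: A_def)
  then have z: "(U t x)\<^sup>2 = 0" if "x \<in> {0..2 * pi}" for x
    using that unfolding A_def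
    by (subst (asm) integral_eq_0_iff) (auto intro!: continuous_intros)
  define k where "k = \<lfloor>\<theta> / (2 * pi)\<rfloor>"
  have "of_int k \<le> \<theta> / (2 * pi)" "\<theta> / (2 * pi) < of_int k + 1" unfolding k_def by linarith+
  then have "\<theta> + 2 * pi * of_int (- k) \<in> {0..2 * pi}" by (auto simp: field_simps)
  moreover have "U t (\<theta> + 2 * pi * of_int (- k)) = U t \<theta>"
    by (rule periodic_shift_int) (rule periodic)
  ultimately show False using z[of "\<theta> + 2 * pi * of_int (- k)"] assms by simp
qed

text \<open>Growth is assumed for \<open>U\<close> only, while \<open>G\<close> contains a
  derivative. As \<open>G\<close> is nondecreasing and \<open>2 * G\<close> is the derivative of
  \<open>A\<close>, the mean value theorem trades the derivative for one unit of
  \<open>t\<close>.\<close>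

lemma G_le_A: "2 * G t \<le> A (t + 1)"
proof -
  have "A t \<ge> 0" unfolding A_def
    by (intro Henstock_Kurzweil_Integration.integral_nonneg integrable_continuous_real continuous_intros) simp
  obtain z where "t < z" "A (t + 1) - A t = (t + 1 - t) * (2 * G z)"
    using MVT2[of t "t + 1" A "\<lambda>t. 2 * G t"] A_deriv by auto
  then show ?thesis using G_mono[of t z] \<open>A t \<ge> 0\<close> by simp
qed

lemma G_small:
  assumes "\<And>\<theta>. U (t + 1) \<theta> \<le> B"
  shows "G t \<le> pi * B\<^sup>2"
proof -
  have "A (t + 1) \<le> integral {0..2 * pi} (\<lambda>_. B\<^sup>2)" unfolding A_def
    using assms nonneg by (intro integral_le integrable_continuous_real continuous_intros power_mono) auto
  then show ?thesis using G_le_A[of t] by simp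
qed

end

text \<open>On each circle the two functions live on arcs whose lengths \<open>\<ell>\<close> and \<open>\<ell>'\<close> satisfy
  \<open>\<ell> + \<ell>' \<le> 2 \<pi>\<close>. By Wirtinger's inequality their mean squares grow at least at the logarithmic
  rates \<open>2 \<pi> / \<ell>\<close> and \<open>2 \<pi> / \<ell>'\<close>, whose sum is at least 4; this is too fast for two functions that
  are \<open>o(exp t)\<close>.\<close>

lemma log_polar_disjoint_growth:
  assumes "log_polar_subharmonic U Ut Uo Utt Uoo t0" "log_polar_subharmonic V Vt Vo Vtt Voo t1"
    and disj: "\<And>t \<theta>. U t \<theta> = 0 \<or> V t \<theta> = 0"
    and smallU: "\<And>\<epsilon>. \<epsilon> > 0 \<Longrightarrow> \<exists>T. \<forall>t\<ge>T. \<forall>\<theta>. U t \<theta> \<le> \<epsilon> * exp t"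
    and smallV: "\<And>\<epsilon>. \<epsilon> > 0 \<Longrightarrow> \<exists>T. \<forall>t\<ge>T. \<forall>\<theta>. V t \<theta> \<le> \<epsilon> * exp t"
    and nz: "U t2 \<theta>2 \<noteq> 0" "V t3 \<theta>3 \<noteq> 0"
  shows False
proof -
  interpret u: log_polar_subharmonic U Ut Uo Utt Uoo t0 by fact
  interpret v: log_polar_subharmonic V Vt Vo Vtt Voo t1 by fact
  \<comment> \<open>Multiplied out rather than stated for logarithmic derivatives, because
    \<open>u.G\<close> and \<open>v.G\<close> may vanish. The 4 is twice the lower bound 2 for
    \<alpha>1 + \<alpha>2.\<close>
  have ode: "u.H t * v.G t + u.G t * v.H t \<ge> 4 * (u.G t * v.G t)" for t
  proof (cases "u.G t = 0 \<or> v.G t = 0")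
    case True then show ?thesis using u.H_nonneg v.H_nonneg u.G_nonneg v.G_nonneg by auto
  next
    case False
    then have pos: "u.G t > 0" "v.G t > 0" using u.G_nonneg[of t] v.G_nonneg[of t] by auto
    have "\<exists>z\<in>{0..2 * pi}. U t z \<noteq> 0"
    proof (rule ccontr)
      assume "\<not> ?thesis"
      then have "u.G t = integral {0..2 * pi} (\<lambda>_. 0)" unfolding u.G_def by (intro integral_cong) auto
      then show False using False by simp
    qed
    then obtain zu where zu: "0 \<le> zu" "zu \<le> 2 * pi" "U t zu \<noteq> 0" by auto
    have "\<exists>z\<in>{0..2 * pi}. V t z \<noteq> 0"
    proof (rule ccontr)
      assume "\<not> ?thesis"
      then have "v.G t = integral {0..2 * pi} (\<lambda>_. 0)" unfolding v.G_def by (intro integral_cong) auto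
      then show False using False by simp
    qed
    then obtain zv where zv: "0 \<le> zv" "zv \<le> 2 * pi" "V t zv \<noteq> 0" by auto
    have "continuous_on UNIV (Uo t)" "continuous_on UNIV (Vo t)"
      by (intro continuous_intros)+
    from Wirtinger_disjoint[OF u.Uo this(1) v.Uo this(2) u.periodic[of t] v.periodic[of t] disj zu zv]
    obtain \<alpha>1 \<alpha>2 where \<alpha>: "\<alpha>1 > 0" "\<alpha>2 > 0" "\<alpha>1 + \<alpha>2 \<ge> 2"
      and w1: "\<And>\<beta>. 0 \<le> \<beta> \<Longrightarrow> \<beta> < \<alpha>1 \<Longrightarrow> \<beta>\<^sup>2 * integral {0..2 * pi} (\<lambda>\<theta>. (U t \<theta>)\<^sup>2) \<le> integral {0..2 * pi} (\<lambda>\<theta>. (Uo t \<theta>)\<^sup>2)"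
      and w2: "\<And>\<beta>. 0 \<le> \<beta> \<Longrightarrow> \<beta> < \<alpha>2 \<Longrightarrow> \<beta>\<^sup>2 * integral {0..2 * pi} (\<lambda>\<theta>. (V t \<theta>)\<^sup>2) \<le> integral {0..2 * pi} (\<lambda>\<theta>. (Vo t \<theta>)\<^sup>2)"
      by blast
    have "\<alpha>1 \<le> u.H t / (2 * u.G t)"
    proof (rule dense_le_bounded[of 0])
      fix \<beta> assume "0 < \<beta>" "\<beta> < \<alpha>1"
      then show "\<beta> \<le> u.H t / (2 * u.G t)" using u.H_ge_G[OF w1[of \<beta>]] pos by (simp add: field_simps)
    qed (use \<alpha> in auto)
    moreover have "\<alpha>2 \<le> v.H t / (2 * v.G t)"
    proof (rule dense_le_bounded[of 0])
      fix \<beta> assume "0 < \<beta>" "\<beta> < \<alpha>2"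
      then show "\<beta> \<le> v.H t / (2 * v.G t)" using v.H_ge_G[OF w2[of \<beta>]] pos by (simp add: field_simps)
    qed (use \<alpha> in auto)
    ultimately have "2 \<le> u.H t / (2 * u.G t) + v.H t / (2 * v.G t)" using \<alpha>(3) by linarith
    then show ?thesis using pos by (simp add: field_simps)
  qed
  \<comment> \<open>By \<open>ode\<close> this is nondecreasing, and it is positive somewhere. But U
    and V of size o(exp t) make \<open>u.G\<close> and \<open>v.G\<close> of size o(exp (2 t)), so
    \<open>J\<close> tends to 0, a contradiction.\<close>
  define J where "J = (\<lambda>t. exp (- 4 * t) * (u.G t * v.G t))"
  have J_mono: "J s \<le> J t" if "s \<le> t" for s t
  proof (rule DERIV_nonneg_imp_nondecreasing[OF that])
    fix x
    have "(J has_real_derivative exp (- 4 * x) * ((u.H x * v.G x + u.G x * v.H x) - 4 * (u.G x * v.G x))) (at x)"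
      unfolding J_def by (auto intro!: derivative_eq_intros u.G_deriv v.G_deriv simp: algebra_simps)
    moreover have "exp (- 4 * x) * ((u.H x * v.G x + u.G x * v.H x) - 4 * (u.G x * v.G x)) \<ge> 0"
      using ode[of x] by simp
    ultimately show "\<exists>y. (J has_real_derivative y) (at x) \<and> 0 \<le> y" by blast
  qed
  obtain s1 s2 where s: "u.G s1 > 0" "v.G s2 > 0" using u.G_pos[OF nz(1)] v.G_pos[OF nz(2)] by blast
  define s where "s = max s1 s2"
  have "u.G s > 0" "v.G s > 0" using s u.G_mono[of s1 s] v.G_mono[of s2 s] by (auto simp: s_def)
  then have Js: "J s > 0" by (simp add: J_def)
  have J_le: "J s \<le> (pi * \<epsilon>\<^sup>2 * exp 2)\<^sup>2" if "\<epsilon> > 0" for \<epsilon>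
  proof -
    obtain T1 T2 where T: "\<And>t \<theta>. t \<ge> T1 \<Longrightarrow> U t \<theta> \<le> \<epsilon> * exp t" "\<And>t \<theta>. t \<ge> T2 \<Longrightarrow> V t \<theta> \<le> \<epsilon> * exp t"
      using smallU[OF \<open>\<epsilon> > 0\<close>] smallV[OF \<open>\<epsilon> > 0\<close>] by blast
    define t where "t = max s (max T1 T2)"
    have "u.G t \<le> pi * (\<epsilon> * exp (t + 1))\<^sup>2" by (rule u.G_small) (rule T, simp add: t_def)
    moreover have "v.G t \<le> pi * (\<epsilon> * exp (t + 1))\<^sup>2" by (rule v.G_small) (rule T, simp add: t_def)
    ultimately have "u.G t * v.G t \<le> (pi * (\<epsilon> * exp (t + 1))\<^sup>2) * (pi * (\<epsilon> * exp (t + 1))\<^sup>2)"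
      using u.G_nonneg[of t] v.G_nonneg[of t] by (intro mult_mono) auto
    then have "J t \<le> exp (- 4 * t) * ((pi * (\<epsilon> * exp (t + 1))\<^sup>2) * (pi * (\<epsilon> * exp (t + 1))\<^sup>2))"
      unfolding J_def by (intro mult_left_mono) auto
    also have "\<dots> = (pi * \<epsilon>\<^sup>2 * exp 2)\<^sup>2"
    proof -
      have "exp (- 4 * t) * ((pi * (\<epsilon> * exp (t + 1))\<^sup>2) * (pi * (\<epsilon> * exp (t + 1))\<^sup>2)) =
         (exp (- 4 * t) * ((exp (t + 1) * exp (t + 1)) * (exp (t + 1) * exp (t + 1)))) * (pi * \<epsilon>\<^sup>2)\<^sup>2"
        by (simp add: power2_eq_square)
      also have "exp (- 4 * t) * ((exp (t + 1) * exp (t + 1)) * (exp (t + 1) * exp (t + 1))) = exp 2 * exp 2"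
        by (simp flip: exp_add)
      finally show ?thesis by (simp only: power2_eq_square mult_ac)
    qed
    finally show ?thesis using J_mono[of s t] by (simp add: t_def)
  qed
  have "((\<lambda>\<epsilon>. (pi * \<epsilon>\<^sup>2 * exp 2)\<^sup>2) \<longlongrightarrow> (pi * 0\<^sup>2 * exp 2)\<^sup>2) (at_right 0)" by (intro tendsto_intros)
  moreover have "\<forall>\<^sub>F \<epsilon> in at_right 0. J s \<le> (pi * \<epsilon>\<^sup>2 * exp 2)\<^sup>2"
    using J_le by (auto simp: eventually_at_right_field intro!: exI[of _ 1])
  ultimately have "J s \<le> (pi * 0\<^sup>2 * exp 2)\<^sup>2" by (rule tendsto_lowerbound) simp
  then show False using Js by simp
qed

text \<open>A \<open>C\<^sup>2\<close> substitute for \<open>s \<mapsto> ln\<^sup>+ s\<close> that is convex as a function of \<open>ln s\<close>.\<close>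

definition smooth_ln_pos :: "real \<Rightarrow> real" where
  "smooth_ln_pos s = ln (max 1 s) + 2 / max 1 s - 1 / (2 * (max 1 s)\<^sup>2) - 3 / 2"

text \<open>For s \<ge> 1, s times this function is (1 - 1/s)^2, which is nondecreasing: that is
  convexity in ln s. The double zero at 1 keeps the extension by 0 continuously differentiable.
  \<open>smooth_ln_pos\<close> is the antiderivative, and its constant 3/2 makes it vanish at
  1.\<close>

definition smooth_ln_pos' :: "real \<Rightarrow> real" where
  "smooth_ln_pos' s = (max 1 s - 1)\<^sup>2 / (max 1 s) ^ 3"

definition smooth_ln_pos'' :: "real \<Rightarrow> real" where
  "smooth_ln_pos'' s = (max 1 s - 1) * (3 - max 1 s) / (max 1 s) ^ 4"

lemma has_real_derivative_max_1:
  fixes f f' :: "real \<Rightarrow> real"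
  assumes "\<And>s. s \<ge> 1 \<Longrightarrow> (f has_real_derivative f' s) (at s)" "f' 1 = 0"
  shows "((\<lambda>s. f (max 1 s)) has_real_derivative f' (max 1 s)) (at s)"
proof -
  have "((\<lambda>x. if x \<le> 1 then f 1 else f x) has_vector_derivative (if s \<le> 1 then 0 else f' s)) (at s)"
    by (rule has_vector_derivative_glue)
       (use assms in \<open>auto simp: has_real_derivative_iff_has_vector_derivative\<close>)
  moreover have "(\<lambda>x. if x \<le> 1 then f 1 else f x) = (\<lambda>s. f (max 1 s))" by (auto simp: max_def)
  moreover have "(if s \<le> 1 then 0 else f' s) = f' (max 1 s)" using assms(2) by (auto simp: max_def)
  ultimately show ?thesis by (simp add: has_real_derivative_iff_has_vector_derivative)
qed

lemma smooth_ln_pos_deriv: "(smooth_ln_pos has_real_derivative smooth_ln_pos' s) (at s)"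
  unfolding smooth_ln_pos_def[abs_def] smooth_ln_pos'_def
  by (rule has_real_derivative_max_1[where f = "\<lambda>s. ln s + 2 / s - 1 / (2 * s\<^sup>2) - 3 / 2"])
     (auto intro!: derivative_eq_intros simp: power2_eq_square power3_eq_cube field_simps)

lemma smooth_ln_pos'_deriv: "(smooth_ln_pos' has_real_derivative smooth_ln_pos'' s) (at s)"
  unfolding smooth_ln_pos'_def[abs_def] smooth_ln_pos''_def
  by (rule has_real_derivative_max_1[where f = "\<lambda>s. (s - 1)\<^sup>2 / s ^ 3"])
     (auto intro!: derivative_eq_intros simp: power2_eq_square power3_eq_cube power4_eq_xxxx field_simps)

lemma smooth_ln_pos_cont [continuous_intros]:
  assumes "continuous_on S p"
  shows "continuous_on S (\<lambda>x. smooth_ln_pos (p x))" "continuous_on S (\<lambda>x. smooth_ln_pos' (p x))"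
    "continuous_on S (\<lambda>x. smooth_ln_pos'' (p x))"
proof -
  have "max 1 (p x) \<noteq> 0" for x by (simp add: max_def)
  then show "continuous_on S (\<lambda>x. smooth_ln_pos (p x))" "continuous_on S (\<lambda>x. smooth_ln_pos' (p x))"
    "continuous_on S (\<lambda>x. smooth_ln_pos'' (p x))"
    unfolding smooth_ln_pos_def smooth_ln_pos'_def smooth_ln_pos''_def
    by (auto intro!: continuous_intros assms)
qed

lemma smooth_ln_pos_convex: "smooth_ln_pos' s + s * smooth_ln_pos'' s \<ge> 0"
proof (cases "s \<le> 1")
  case False
  then have "smooth_ln_pos' s + s * smooth_ln_pos'' s = 2 * (s - 1) / s ^ 3"
    by (simp add: smooth_ln_pos'_def smooth_ln_pos''_def max_def power2_eq_square power3_eq_cube power4_eq_xxxx field_simps)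
  then show ?thesis using False by simp
qed (simp add: smooth_ln_pos'_def smooth_ln_pos''_def max_def)

lemma smooth_ln_pos_zero: "s \<le> 1 \<Longrightarrow> smooth_ln_pos s = 0"
  by (simp add: smooth_ln_pos_def max_def)

lemma smooth_ln_pos_mono:
  assumes "a \<le> b" shows "smooth_ln_pos a \<le> smooth_ln_pos b"
proof (rule DERIV_nonneg_imp_nondecreasing[OF assms])
  fix x
  have "smooth_ln_pos' x \<ge> 0" by (auto simp: smooth_ln_pos'_def max_def)
  then show "\<exists>y. (smooth_ln_pos has_real_derivative y) (at x) \<and> 0 \<le> y" using smooth_ln_pos_deriv by blast
qed

lemma smooth_ln_pos_nonneg_pos: "smooth_ln_pos s \<ge> 0" "s > 1 \<Longrightarrow> smooth_ln_pos s > 0"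
proof -
  show "smooth_ln_pos s \<ge> 0" using smooth_ln_pos_mono[of "min s 1" s] smooth_ln_pos_zero[of "min s 1"] by simp
  show "smooth_ln_pos s > 0" if "s > 1"
  proof -
    obtain z where "1 < z" "z < s" "smooth_ln_pos s - smooth_ln_pos 1 = (s - 1) * smooth_ln_pos' z"
      using MVT2[OF \<open>s > 1\<close>, of smooth_ln_pos smooth_ln_pos'] smooth_ln_pos_deriv by blast
    then show ?thesis using smooth_ln_pos_zero[of 1] that by (simp add: smooth_ln_pos'_def)
  qed
qed

lemma smooth_ln_pos_le: "s \<ge> 1 \<Longrightarrow> smooth_ln_pos s \<le> ln s + 1 / 2"
proof -
  assume "s \<ge> 1"
  then have "2 / s \<le> 2" "0 \<le> 1 / (2 * s\<^sup>2)" "max 1 s = s" by (auto simp: divide_le_eq)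
  then show ?thesis unfolding smooth_ln_pos_def by linarith
qed

section \<open>Logarithms of entire functions in polar coordinates\<close>

lemma Re_mult_cnj_has_derivative:
  assumes "(v has_vector_derivative v') (at t)" "(w has_vector_derivative w') (at t)"
  shows "((\<lambda>t. Re (v t * cnj (w t))) has_real_derivative Re (v' * cnj (w t) + v t * cnj w')) (at t)"
proof -
  have "((\<lambda>t. v t * cnj (w t)) has_vector_derivative v t * cnj w' + v' * cnj (w t)) (at t)"
    by (intro has_vector_derivative_mult assms bounded_linear.has_vector_derivative[OF bounded_linear_cnj])
  then have "((\<lambda>t. Re (v t * cnj (w t))) has_vector_derivative Re (v t * cnj w' + v' * cnj (w t))) (at t)"
    by (rule bounded_linear.has_vector_derivative[OF bounded_linear_Re])
  then show ?thesis by (simp add: has_real_derivative_iff_has_vector_derivative add.commute)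
qed

text \<open>Let m = f o exp and n = |m|^2. The derivatives of n in t and \<theta> are the real parts
  of 2 m' cnj m and of i times it, so their squares add up to 4 |m'|^2 n, and the Laplacian of n is
  4 |m'|^2. The Laplacian of the composite is therefore 4 |m'|^2 times the expression in
  \<open>smooth_ln_pos_convex\<close>. The condition at 0 makes the function vanish for t near minus
  infinity.\<close>

lemma log_polar_subharmonic_of_holomorphic:
  fixes f :: "complex \<Rightarrow> complex"
  assumes f: "f holomorphic_on UNIV" and f0: "norm (f 0) < 1"
  shows "\<exists>Ut Uo Utt Uoo t0. log_polar_subharmonic
    (\<lambda>t \<theta>. smooth_ln_pos ((norm (f (exp (of_real t + \<i> * of_real \<theta>))))\<^sup>2)) Ut Uo Utt Uoo t0"
proof -
  define m where "m = (\<lambda>z. f (exp z))"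
  define m1 where "m1 = deriv m"
  define m2 where "m2 = deriv m1"
  define Z where "Z = (\<lambda>t \<theta>. complex_of_real t + \<i> * of_real \<theta>)"
  have m: "m holomorphic_on UNIV" unfolding m_def
    by (rule holomorphic_on_compose_gen[OF _ f, unfolded o_def]) (auto intro!: holomorphic_intros)
  then have m1: "m1 holomorphic_on UNIV" unfolding m1_def by (rule holomorphic_deriv) simp
  then have m2: "m2 holomorphic_on UNIV" unfolding m2_def by (rule holomorphic_deriv) simp
  have dm: "(m has_field_derivative m1 z) (at z)" "(m1 has_field_derivative m2 z) (at z)" for z
    unfolding m1_def m2_def using m m1 by (auto intro!: holomorphic_derivI[of _ UNIV] simp: m1_def)
  have dZt: "((\<lambda>t. Z t \<theta>) has_vector_derivative 1) (at t)" for t \<theta>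
    unfolding Z_def by (auto intro!: derivative_eq_intros)
  have dZo: "(Z t has_vector_derivative \<i>) (at \<theta>)" for t \<theta>
    unfolding Z_def by (auto intro!: derivative_eq_intros)
  have mt: "((\<lambda>t. m (Z t \<theta>)) has_vector_derivative m1 (Z t \<theta>)) (at t)"
    and m1t: "((\<lambda>t. m1 (Z t \<theta>)) has_vector_derivative m2 (Z t \<theta>)) (at t)"
    and mo: "((\<lambda>\<theta>. m (Z t \<theta>)) has_vector_derivative \<i> * m1 (Z t \<theta>)) (at \<theta>)"
    and m1o: "((\<lambda>\<theta>. \<i> * m1 (Z t \<theta>)) has_vector_derivative - m2 (Z t \<theta>)) (at \<theta>)" for t \<theta>
    using field_vector_diff_chain_at[OF dZt dm(1)] field_vector_diff_chain_at[OF dZt dm(2)]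
      field_vector_diff_chain_at[OF dZo dm(1)]
      has_vector_derivative_mult_right[OF field_vector_diff_chain_at[OF dZo dm(2)], of \<i>]
    by (auto simp: o_def)
  define n where "n = (\<lambda>t \<theta>. Re (m (Z t \<theta>) * cnj (m (Z t \<theta>))))"
  define nt where "nt = (\<lambda>t \<theta>. 2 * Re (m1 (Z t \<theta>) * cnj (m (Z t \<theta>))))"
  define no where "no = (\<lambda>t \<theta>. 2 * Re (\<i> * m1 (Z t \<theta>) * cnj (m (Z t \<theta>))))"
  define ntt where "ntt = (\<lambda>t \<theta>. 2 * Re (m2 (Z t \<theta>) * cnj (m (Z t \<theta>)) + m1 (Z t \<theta>) * cnj (m1 (Z t \<theta>))))"
  define noo where "noo = (\<lambda>t \<theta>. 2 * Re (- m2 (Z t \<theta>) * cnj (m (Z t \<theta>)) + m1 (Z t \<theta>) * cnj (m1 (Z t \<theta>))))"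
  have n: "n t \<theta> = (norm (f (exp (of_real t + \<i> * of_real \<theta>))))\<^sup>2" for t \<theta>
    unfolding cmod_power2 by (simp add: n_def m_def Z_def power2_eq_square)
  have dn: "((\<lambda>t. n t \<theta>) has_real_derivative nt t \<theta>) (at t)" "((\<lambda>t. nt t \<theta>) has_real_derivative ntt t \<theta>) (at t)"
    "(n t has_real_derivative no t \<theta>) (at \<theta>)" "(no t has_real_derivative noo t \<theta>) (at \<theta>)" for t \<theta>
  proof -
    show "((\<lambda>t. n t \<theta>) has_real_derivative nt t \<theta>) (at t)" unfolding n_def
      by (rule DERIV_cong[OF Re_mult_cnj_has_derivative[OF mt mt]]) (simp add: nt_def)
    show "(n t has_real_derivative no t \<theta>) (at \<theta>)" unfolding n_def
      by (rule DERIV_cong[OF Re_mult_cnj_has_derivative[OF mo mo]]) (simp add: no_def)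
    show "((\<lambda>t. nt t \<theta>) has_real_derivative ntt t \<theta>) (at t)" unfolding nt_def
      by (rule DERIV_cong[OF DERIV_cmult[OF Re_mult_cnj_has_derivative[OF m1t mt]]]) (simp add: ntt_def)
    show "(no t has_real_derivative noo t \<theta>) (at \<theta>)" unfolding no_def
      by (rule DERIV_cong[OF DERIV_cmult[OF Re_mult_cnj_has_derivative[OF m1o mo]]]) (simp add: noo_def)
  qed
  let ?U = "\<lambda>t \<theta>. smooth_ln_pos (n t \<theta>)"
  define Ut where "Ut = (\<lambda>t \<theta>. smooth_ln_pos' (n t \<theta>) * nt t \<theta>)"
  define Uo where "Uo = (\<lambda>t \<theta>. smooth_ln_pos' (n t \<theta>) * no t \<theta>)"
  define Utt where "Utt = (\<lambda>t \<theta>. smooth_ln_pos'' (n t \<theta>) * nt t \<theta> * nt t \<theta> + smooth_ln_pos' (n t \<theta>) * ntt t \<theta>)"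
  define Uoo where "Uoo = (\<lambda>t \<theta>. smooth_ln_pos'' (n t \<theta>) * no t \<theta> * no t \<theta> + smooth_ln_pos' (n t \<theta>) * noo t \<theta>)"
  have contm: "continuous_on UNIV m" "continuous_on UNIV m1" "continuous_on UNIV m2"
    using m m1 m2 by (auto intro: holomorphic_on_imp_continuous_on)
  have cZ: "continuous_on UNIV (\<lambda>p. k (Z (fst p) (snd p)))" if "continuous_on UNIV k" for k
    by (rule continuous_on_compose2[OF that]) (auto simp: Z_def intro!: continuous_intros)
  have cn: "continuous_on UNIV (\<lambda>p. n (fst p) (snd p))" "continuous_on UNIV (\<lambda>p. nt (fst p) (snd p))"
    "continuous_on UNIV (\<lambda>p. no (fst p) (snd p))" "continuous_on UNIV (\<lambda>p. ntt (fst p) (snd p))"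
    "continuous_on UNIV (\<lambda>p. noo (fst p) (snd p))"
    unfolding n_def nt_def no_def ntt_def noo_def by (intro continuous_intros cZ contm)+
  have per: "m (Z t (\<theta> + 2 * pi)) = m (Z t \<theta>)" for t \<theta>
  proof -
    have "exp (Z t (\<theta> + 2 * pi)) = exp (Z t \<theta> + \<i> * (of_real 2 * of_real pi))" by (simp add: Z_def algebra_simps)
    then show ?thesis by (simp add: m_def exp_plus_2pin[of _ 1, simplified] mult.commute mult.left_commute)
  qed
  have per1: "m1 (Z t (\<theta> + 2 * pi)) = m1 (Z t \<theta>)" for t \<theta>
  proof -
    have "((\<lambda>\<theta>. m (Z t \<theta>)) has_vector_derivative \<i> * m1 (Z t (\<theta> + 2 * pi))) (at \<theta>)"
    proof -
      have "((\<lambda>\<theta>. \<theta> + 2 * pi) has_vector_derivative 1) (at \<theta>)" by (auto intro!: derivative_eq_intros)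
      from vector_diff_chain_at[OF this mo[of t "\<theta> + 2 * pi"]] show ?thesis by (simp add: o_def per)
    qed
    from vector_derivative_unique_at[OF this mo[of t \<theta>]] show ?thesis by simp
  qed
  have "continuous (at 0) f"
    using holomorphic_on_imp_continuous_on[OF f] continuous_on_eq_continuous_at by blast
  then have "\<forall>\<^sub>F z in at 0. norm (f z) < 1"
    using f0 by (intro order_tendstoD(2)[of _ "norm (f 0)"] tendsto_norm) (auto simp: continuous_at)
  then obtain d where d: "d > 0" "\<And>z. norm z < d \<Longrightarrow> norm (f z) < 1"
    using f0 unfolding eventually_at by (auto simp: dist_norm) (metis norm_zero)
  have "log_polar_subharmonic ?U Ut Uo Utt Uoo (ln (d / 2))"
  proof
    show "((\<lambda>t. ?U t \<theta>) has_real_derivative Ut t \<theta>) (at t)" for t \<theta>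
      unfolding Ut_def by (rule DERIV_chain2[OF smooth_ln_pos_deriv dn(1)])
    show "((\<lambda>t. Ut t \<theta>) has_real_derivative Utt t \<theta>) (at t)" for t \<theta>
      unfolding Ut_def Utt_def
      by (rule DERIV_cong[OF DERIV_mult[OF DERIV_chain2[OF smooth_ln_pos'_deriv dn(1)] dn(2)]]) (simp add: algebra_simps)
    show "(?U t has_real_derivative Uo t \<theta>) (at \<theta>)" for t \<theta>
      unfolding Uo_def by (rule DERIV_chain2[OF smooth_ln_pos_deriv dn(3)])
    show "(Uo t has_real_derivative Uoo t \<theta>) (at \<theta>)" for t \<theta>
      unfolding Uo_def Uoo_def
      by (rule DERIV_cong[OF DERIV_mult[OF DERIV_chain2[OF smooth_ln_pos'_deriv dn(3)] dn(4)]]) (simp add: algebra_simps)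
    show "continuous_on UNIV (\<lambda>(t, \<theta>). ?U t \<theta>)" "continuous_on UNIV (\<lambda>(t, \<theta>). Ut t \<theta>)"
      "continuous_on UNIV (\<lambda>(t, \<theta>). Uo t \<theta>)" "continuous_on UNIV (\<lambda>(t, \<theta>). Utt t \<theta>)"
      "continuous_on UNIV (\<lambda>(t, \<theta>). Uoo t \<theta>)"
      unfolding Ut_def Uo_def Utt_def Uoo_def split_beta by (intro continuous_intros cn)+
    show "?U t (\<theta> + 2 * pi) = ?U t \<theta>" "Uo t (\<theta> + 2 * pi) = Uo t \<theta>" for t \<theta>
      by (simp_all add: n_def no_def Uo_def per per1)
    show "?U t \<theta> \<ge> 0" for t \<theta> by (rule smooth_ln_pos_nonneg_pos)
    show "Utt t \<theta> + Uoo t \<theta> \<ge> 0" for t \<theta>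
    proof -
      define a b where "a = m1 (Z t \<theta>)" and "b = m (Z t \<theta>)"
      have 1: "nt t \<theta> * nt t \<theta> + no t \<theta> * no t \<theta> = 4 * (norm a)\<^sup>2 * n t \<theta>"
        unfolding cmod_power2 by (simp add: nt_def no_def n_def a_def b_def power2_eq_square algebra_simps)
      have 2: "ntt t \<theta> + noo t \<theta> = 4 * (norm a)\<^sup>2"
        unfolding cmod_power2 by (simp add: ntt_def noo_def a_def power2_eq_square algebra_simps)
      have "Utt t \<theta> + Uoo t \<theta> = smooth_ln_pos'' (n t \<theta>) * (nt t \<theta> * nt t \<theta> + no t \<theta> * no t \<theta>) + smooth_ln_pos' (n t \<theta>) * (ntt t \<theta> + noo t \<theta>)"
        by (simp add: Utt_def Uoo_def algebra_simps)
      also have "\<dots> = 4 * (norm a)\<^sup>2 * (smooth_ln_pos' (n t \<theta>) + n t \<theta> * smooth_ln_pos'' (n t \<theta>))"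
        unfolding 1 2 by (simp add: algebra_simps)
      finally show ?thesis using smooth_ln_pos_convex by simp
    qed
    show "?U t \<theta> = 0" if "t \<le> ln (d / 2)" for t \<theta>
    proof (rule smooth_ln_pos_zero)
      have "exp t \<le> d / 2" using that \<open>d > 0\<close> by (metis exp_le_cancel_iff exp_ln half_gt_zero)
      then have "norm (exp (of_real t + \<i> * of_real \<theta>)) < d" using \<open>d > 0\<close> by simp
      from d(2)[OF this] show "n t \<theta> \<le> 1" unfolding n by (simp add: power_le_one)
    qed
  qed
  then show ?thesis unfolding n by blast
qed

text \<open>The smoothed logarithms of |f|^2 and |g|^2 have disjoint supports by \<open>min\<close>,
  and type zero makes them o(|z|). If neither vanished identically,
  \<open>log_polar_disjoint_growth\<close> would be contradicted.\<close>

lemma entire_min_le_1: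
  fixes f g :: "complex \<Rightarrow> complex"
  assumes f: "f holomorphic_on UNIV" and g: "g holomorphic_on UNIV"
    and tf: "\<And>\<epsilon>. \<epsilon> > 0 \<Longrightarrow> \<exists>C. \<forall>z. norm (f z) \<le> C * exp (\<epsilon> * norm z)"
    and tg: "\<And>\<epsilon>. \<epsilon> > 0 \<Longrightarrow> \<exists>C. \<forall>z. norm (g z) \<le> C * exp (\<epsilon> * norm z)"
    and min: "\<And>z. norm (f z) \<le> 1 \<or> norm (g z) \<le> 1" and 0: "norm (f 0) < 1" "norm (g 0) < 1"
  shows "(\<forall>z. norm (f z) \<le> 1) \<or> (\<forall>z. norm (g z) \<le> 1)"
proof (rule ccontr)
  assume "\<not> ?thesis"
  then obtain z1 z2 where z: "norm (f z1) > 1" "norm (g z2) > 1" by (auto simp: not_le)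
  let ?U = "\<lambda>f t \<theta>. smooth_ln_pos ((norm (f (exp (of_real t + \<i> * of_real \<theta>)) :: complex))\<^sup>2)"
  have nz: "\<exists>t \<theta>. ?U h t \<theta> \<noteq> 0" if "norm (h z) > 1" "norm (h 0) < 1" for h z
  proof -
    have "z \<noteq> 0" using that by auto
    then have "exp (of_real (ln (norm z)) + \<i> * of_real (Arg z)) = z"
      by (simp add: exp_add exp_of_real Arg_eq[symmetric] mult.commute)
    then have "?U h (ln (norm z)) (Arg z) > 0"
      using that by (intro smooth_ln_pos_nonneg_pos(2)) simp
    then show ?thesis by (metis less_irrefl)
  qed
  have small: "\<exists>T. \<forall>t\<ge>T. \<forall>\<theta>. ?U h t \<theta> \<le> \<epsilon> * exp t"
    if th: "\<And>\<epsilon>. \<epsilon> > 0 \<Longrightarrow> \<exists>C. \<forall>z. norm (h z) \<le> C * exp (\<epsilon> * norm z)" and "\<epsilon> > 0" for h \<epsilon>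
  proof -
    \<comment> \<open>Squaring doubles the exponent to \<epsilon>/2; the other half of \<epsilon>
      absorbs the additive constants.\<close>
    obtain C where C: "\<And>z. norm (h z) \<le> C * exp (\<epsilon> / 4 * norm z)" using th[of "\<epsilon> / 4"] \<open>\<epsilon> > 0\<close> by auto
    define K where "K = max C 1"
    have "\<forall>\<^sub>F t in at_top. 2 * ln K + 1 / 2 \<le> \<epsilon> / 2 * exp t" using \<open>\<epsilon> > 0\<close> by real_asymp
    then obtain T where T: "\<And>t. t \<ge> T \<Longrightarrow> 2 * ln K + 1 / 2 \<le> \<epsilon> / 2 * exp t" by (auto simp: eventually_at_top_linorder)
    have "?U h t \<theta> \<le> \<epsilon> * exp t" if "t \<ge> T" for t \<theta>
    proof -
      define X where "X = K * exp (\<epsilon> / 4 * exp t)"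
      have "1 * 1 \<le> X" unfolding X_def using \<open>\<epsilon> > 0\<close> by (intro mult_mono) (auto simp: K_def)
      then have "X \<ge> 1" by simp
      have "norm (h (exp (of_real t + \<i> * of_real \<theta>))) \<le> C * exp (\<epsilon> / 4 * exp t)"
        using C[of "exp (of_real t + \<i> * of_real \<theta>)"] by simp
      also have "\<dots> \<le> X" unfolding X_def K_def by (intro mult_right_mono) auto
      finally have "?U h t \<theta> \<le> smooth_ln_pos (X\<^sup>2)" by (intro smooth_ln_pos_mono power_mono) auto
      also have "\<dots> \<le> ln (X\<^sup>2) + 1 / 2" using \<open>X \<ge> 1\<close> by (intro smooth_ln_pos_le) (simp add: one_le_power)
      also have "ln (X\<^sup>2) = 2 * ln X" using \<open>X \<ge> 1\<close> by (simp add: ln_realpow)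
      also have "ln X = ln K + \<epsilon> / 4 * exp t" unfolding X_def by (subst ln_mult) (auto simp: K_def)
      also have "2 * (ln K + \<epsilon> / 4 * exp t) + 1 / 2 = (2 * ln K + 1 / 2) + \<epsilon> / 2 * exp t" by simp
      also have "\<dots> \<le> \<epsilon> * exp t" using T[OF that] by simp
      finally show ?thesis .
    qed
    then show ?thesis by blast
  qed
  obtain Ut Uo Utt Uoo t0 where U: "log_polar_subharmonic (?U f) Ut Uo Utt Uoo t0"
    using log_polar_subharmonic_of_holomorphic[OF f 0(1)] by blast
  obtain Vt Vo Vtt Voo t1 where V: "log_polar_subharmonic (?U g) Vt Vo Vtt Voo t1"
    using log_polar_subharmonic_of_holomorphic[OF g 0(2)] by blast
  obtain t2 \<theta>2 t3 \<theta>3 where nz': "?U f t2 \<theta>2 \<noteq> 0" "?U g t3 \<theta>3 \<noteq> 0"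
    using nz[OF z(1) 0(1)] nz[OF z(2) 0(2)] by blast
  have disj: "?U f t \<theta> = 0 \<or> ?U g t \<theta> = 0" for t \<theta>
    using min[of "exp (of_real t + \<i> * of_real \<theta>)"] smooth_ln_pos_zero by (auto simp: power_le_one)
  show False
    by (rule log_polar_disjoint_growth[OF U V disj small[OF tf] small[OF tg] nz'])
qed

section \<open>From a bounded to a polynomially bounded minimum\<close>

lemma zero_type_cmult:
  fixes f :: "complex \<Rightarrow> complex"
  assumes "\<And>\<epsilon>. \<epsilon> > 0 \<Longrightarrow> \<exists>C. \<forall>z. norm (f z) \<le> C * exp (\<epsilon> * norm z)" "\<epsilon> > 0" "K > 0"
  shows "\<exists>C. \<forall>z. norm (f z / of_real K) \<le> C * exp (\<epsilon> * norm z)"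
proof -
  obtain C where C: "\<And>z. norm (f z) \<le> C * exp (\<epsilon> * norm z)" using assms by blast
  have "norm (f z / of_real K) \<le> C / K * exp (\<epsilon> * norm z)" for z
    using C[of z] \<open>K > 0\<close> by (simp add: norm_divide divide_right_mono)
  then show ?thesis by blast
qed

lemma divide_out_zero:
  fixes f :: "complex \<Rightarrow> complex"
  assumes f: "f holomorphic_on UNIV"
    and tf: "\<And>\<epsilon>. \<epsilon> > 0 \<Longrightarrow> \<exists>C. \<forall>z. norm (f z) \<le> C * exp (\<epsilon> * norm z)"
  obtains f1 K where "f1 holomorphic_on UNIV" "\<And>z. f z = f 0 + z * f1 z"
    "\<And>\<epsilon>. \<epsilon> > 0 \<Longrightarrow> \<exists>C. \<forall>z. norm (f1 z) \<le> C * exp (\<epsilon> * norm z)"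
    "K \<ge> 0" "\<And>z. norm (f1 z) * (1 + norm z) \<le> 2 * norm (f z) + K"
proof -
  define f1 where "f1 = (\<lambda>z. if z = 0 then deriv f 0 else (f z - f 0) / (z - 0))"
  have f1: "f1 holomorphic_on UNIV" unfolding f1_def by (rule pole_lemma_open[OF f]) simp
  have eq: "f z = f 0 + z * f1 z" for z by (simp add: f1_def)
  have "continuous_on (cball 0 1) f1"
    using f1 by (meson continuous_on_subset holomorphic_on_imp_continuous_on subset_UNIV)
  then have "bounded (f1 ` cball 0 1)" by (intro compact_imp_bounded compact_continuous_image) auto
  then obtain B where "B > 0" and B': "\<And>x. x \<in> f1 ` cball 0 1 \<Longrightarrow> norm x \<le> B"
    unfolding bounded_pos by blast
  have B: "norm (f1 z) \<le> B" if "norm z \<le> 1" for z by (rule B') (use that in auto)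
  define K where "K = 2 * norm (f 0) + 2 * B"
  have K: "norm (f1 z) * (1 + norm z) \<le> 2 * norm (f z) + K" for z
  proof (cases "norm z \<le> 1")
    case True
    have "norm (f1 z) * (1 + norm z) \<le> B * 2" using B[OF True] True \<open>B > 0\<close> by (intro mult_mono) auto
    then show ?thesis by (simp add: K_def add_increasing)
  next
    case False
    have "norm (f1 z) * (1 + norm z) \<le> norm (f1 z) * (2 * norm z)" using False by (intro mult_left_mono) auto
    also have "\<dots> = 2 * norm (z * f1 z)" by (simp add: norm_mult)
    also have "z * f1 z = f z - f 0" using eq[of z] by simp
    also have "norm (f z - f 0) \<le> norm (f z) + norm (f 0)" by (rule norm_triangle_ineq4)
    finally show ?thesis using \<open>B > 0\<close> by (simp add: K_def)
  qed
  have "K \<ge> 0" using \<open>B > 0\<close> by (simp add: K_def)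
  have "\<exists>C. \<forall>z. norm (f1 z) \<le> C * exp (\<epsilon> * norm z)" if "\<epsilon> > 0" for \<epsilon>
  proof -
    obtain C where C: "\<And>z. norm (f z) \<le> C * exp (\<epsilon> * norm z)" using tf[OF \<open>\<epsilon> > 0\<close>] by blast
    have "norm (f1 z) \<le> (2 * C + K) * exp (\<epsilon> * norm z)" for z
    proof -
      have "norm (f1 z) * 1 \<le> norm (f1 z) * (1 + norm z)" by (intro mult_left_mono) auto
      also note K
      also have "2 * norm (f z) + K \<le> 2 * (C * exp (\<epsilon> * norm z)) + K * exp (\<epsilon> * norm z)"
        using C[of z] \<open>K \<ge> 0\<close> that by (intro add_mono mult_left_mono mult_left_le[THEN order_trans]) (auto simp: mult_le_cancel_left1)
      finally show ?thesis by (simp add: algebra_simps)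
    qed
    then show ?thesis by blast
  qed
  with f1 eq \<open>K \<ge> 0\<close> K show ?thesis using that by blast
qed

text \<open>Induction on the degree: passing to (f - f 0) / z and (g - g 0) / z keeps type zero and
  lowers the degree of the pointwise bound by one, and multiplication by z carries the conclusion
  back. In degree 0 a common scaling makes both values at the origin smaller than 1, as
  \<open>entire_min_le_1\<close> requires.\<close>

theorem entire_min_polynomial:
  fixes f g :: "complex \<Rightarrow> complex"
  assumes "f holomorphic_on UNIV" "g holomorphic_on UNIV"
    and "\<And>\<epsilon>. \<epsilon> > 0 \<Longrightarrow> \<exists>C. \<forall>z. norm (f z) \<le> C * exp (\<epsilon> * norm z)"
    and "\<And>\<epsilon>. \<epsilon> > 0 \<Longrightarrow> \<exists>C. \<forall>z. norm (g z) \<le> C * exp (\<epsilon> * norm z)"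
    and "\<And>z. norm (f z) \<le> C * (1 + norm z) ^ p \<or> norm (g z) \<le> C * (1 + norm z) ^ p"
  shows "(\<exists>C. \<forall>z. norm (f z) \<le> C * (1 + norm z) ^ p) \<or> (\<exists>C. \<forall>z. norm (g z) \<le> C * (1 + norm z) ^ p)"
  using assms
proof (induction p arbitrary: f g C)
  case (0 f g C)
  define K where "K = max C (max (norm (f 0)) (norm (g 0))) + 1"
  have K: "K > 0" "C \<le> K" "norm (f 0) < K" "norm (g 0) < K"
    unfolding K_def using norm_ge_zero[of "f 0"] by linarith+
  have "(\<forall>z. norm (f z / of_real K) \<le> 1) \<or> (\<forall>z. norm (g z / of_real K) \<le> 1)"
  proof (rule entire_min_le_1)
    show "(\<lambda>z. f z / of_real K) holomorphic_on UNIV" "(\<lambda>z. g z / of_real K) holomorphic_on UNIV"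
      using K(1) by (auto intro!: holomorphic_intros 0)
    show "norm (f z / of_real K) \<le> 1 \<or> norm (g z / of_real K) \<le> 1" for z
      using 0(5)[of z] K by (auto simp: norm_divide)
  qed (use zero_type_cmult 0 K in \<open>auto simp: norm_divide\<close>)
  then show ?case using K by (auto simp: norm_divide)
next
  case (Suc p f g C)
  obtain f1 Kf where f1: "f1 holomorphic_on UNIV" "\<And>z. f z = f 0 + z * f1 z"
    "\<And>\<epsilon>. \<epsilon> > 0 \<Longrightarrow> \<exists>C. \<forall>z. norm (f1 z) \<le> C * exp (\<epsilon> * norm z)"
    "Kf \<ge> 0" "\<And>z. norm (f1 z) * (1 + norm z) \<le> 2 * norm (f z) + Kf"
    using divide_out_zero[OF Suc.prems(1,3)] by metis
  obtain g1 Kg where g1: "g1 holomorphic_on UNIV" "\<And>z. g z = g 0 + z * g1 z"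
    "\<And>\<epsilon>. \<epsilon> > 0 \<Longrightarrow> \<exists>C. \<forall>z. norm (g1 z) \<le> C * exp (\<epsilon> * norm z)"
    "Kg \<ge> 0" "\<And>z. norm (g1 z) * (1 + norm z) \<le> 2 * norm (g z) + Kg"
    using divide_out_zero[OF Suc.prems(2,4)] by metis
  define C1 where "C1 = 2 * C + Kf + Kg"
  have down: "x \<le> C1 * (1 + norm z) ^ p"
    if "x * (1 + norm z) \<le> 2 * y + K" "y \<le> C * (1 + norm z) ^ Suc p" "0 \<le> K" "K \<le> Kf + Kg" for x y K and z :: complex
  proof -
    have "1 \<le> (1 + norm z) ^ Suc p" by (rule one_le_power) simp
    then have "K * 1 \<le> (Kf + Kg) * (1 + norm z) ^ Suc p" using that by (intro mult_mono) auto
    then have "x * (1 + norm z) \<le> C1 * (1 + norm z) ^ Suc p" using that by (simp add: C1_def algebra_simps)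
    then have "x * (1 + norm z) \<le> (C1 * (1 + norm z) ^ p) * (1 + norm z)" by (simp add: algebra_simps)
    then show ?thesis by (simp add: add_pos_nonneg)
  qed
  have up: "\<exists>C. \<forall>z. norm (h z) \<le> C * (1 + norm z) ^ Suc p"
    if h: "\<And>z. h z = h 0 + z * h1 z" "\<exists>C. \<forall>z. norm (h1 z) \<le> C * (1 + norm z) ^ p" for h h1 :: "complex \<Rightarrow> complex"
  proof -
    obtain D where D: "\<And>z. norm (h1 z) \<le> D * (1 + norm z) ^ p" using h(2) by blast
    have "norm (h z) \<le> (norm (h 0) + D) * (1 + norm z) ^ Suc p" for z
    proof -
      have "norm (h z) \<le> norm (h 0) + norm z * norm (h1 z)"
        using norm_triangle_ineq[of "h 0" "z * h1 z"] h(1)[of z] by (simp add: norm_mult)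
      moreover have "norm z * norm (h1 z) \<le> (1 + norm z) * (D * (1 + norm z) ^ p)"
        using D[of z] by (intro mult_mono) auto
      moreover have "norm (h 0) * 1 \<le> norm (h 0) * (1 + norm z) ^ Suc p"
        by (intro mult_left_mono one_le_power) auto
      moreover have "(norm (h 0) + D) * (1 + norm z) ^ Suc p = norm (h 0) * (1 + norm z) ^ Suc p + (1 + norm z) * (D * (1 + norm z) ^ p)"
        by (simp add: algebra_simps)
      ultimately show ?thesis by linarith
    qed
    then show ?thesis by blast
  qed
  have "norm (f1 z) \<le> C1 * (1 + norm z) ^ p \<or> norm (g1 z) \<le> C1 * (1 + norm z) ^ p" for z
    using Suc.prems(5)[of z] down[OF f1(5)[of z]] down[OF g1(5)[of z]] f1(4) g1(4) by auto
  from Suc.IH[OF f1(1) g1(1) f1(3) g1(3) this] show ?case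
    using up[of f f1] up[of g g1] f1(2) g1(2) by blast
qed

section \<open>Division of entire functions\<close>

lemma divide_polynomial_bound:
  fixes N :: "complex \<Rightarrow> complex"
  assumes N: "N holomorphic_on UNIV" and le: "\<And>l. norm (l * N l + d) \<le> C * (1 + norm l) ^ Suc q"
  shows "\<exists>C. \<forall>l. norm (N l) \<le> C * (1 + norm l) ^ q"
proof -
  have "continuous_on (cball 0 1) N"
    using N by (meson continuous_on_subset holomorphic_on_imp_continuous_on subset_UNIV)
  then have "bounded (N ` cball 0 1)" by (intro compact_imp_bounded compact_continuous_image) auto
  then obtain B where "B > 0" and B': "\<And>x. x \<in> N ` cball 0 1 \<Longrightarrow> norm x \<le> B"
    unfolding bounded_pos by blast
  have "norm (N l) \<le> (B + 2 * C + 2 * norm d) * (1 + norm l) ^ q" for l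
  proof -
    have p: "1 \<le> (1 + norm l) ^ q" "1 \<le> (1 + norm l) ^ Suc q" by (rule one_le_power, simp)+
    have "norm d \<le> C" using le[of 0] by simp
    then have "C \<ge> 0" using norm_ge_zero order_trans by blast
    show ?thesis
    proof (cases "norm l \<le> 1")
      case True
      have "norm (N l) \<le> B" by (rule B') (use True in auto)
      also have "B = B * 1" by simp
      also have "\<dots> \<le> (B + 2 * C + 2 * norm d) * (1 + norm l) ^ q"
        using p \<open>B > 0\<close> \<open>C \<ge> 0\<close> by (intro mult_mono) auto
      finally show ?thesis .
    next
      case False
      have "norm (l * N l) \<le> norm (l * N l + d) + norm d" using norm_triangle_ineq4[of "l * N l + d" d] by simp
      also have "\<dots> \<le> C * (1 + norm l) ^ Suc q + norm d * (1 + norm l) ^ Suc q"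
        using le[of l] p(2) by (intro add_mono mult_right_mono[of 1, simplified] mult_left_mono[of 1, simplified]) (auto simp: mult_le_cancel_left1)
      also have "\<dots> = (C + norm d) * (1 + norm l) ^ q * (1 + norm l)" by (simp add: algebra_simps)
      also have "\<dots> \<le> (C + norm d) * (1 + norm l) ^ q * (2 * norm l)"
        using False \<open>C \<ge> 0\<close> by (intro mult_left_mono mult_nonneg_nonneg) auto
      also have "\<dots> = norm l * (2 * (C + norm d) * (1 + norm l) ^ q)" by (simp only: mult_ac)
      finally have "norm l * norm (N l) \<le> norm l * (2 * (C + norm d) * (1 + norm l) ^ q)"
        by (simp only: norm_mult)
      moreover have "norm l > 0" using False by linarith
      ultimately have "norm (N l) \<le> 2 * (C + norm d) * (1 + norm l) ^ q" by simp
      also have "\<dots> \<le> (B + 2 * C + 2 * norm d) * (1 + norm l) ^ q"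
        using \<open>B > 0\<close> by (intro mult_right_mono) auto
      finally show ?thesis .
    qed
  qed
  then show ?thesis by blast
qed

lemma divide_constant_bound:
  fixes N :: "complex \<Rightarrow> complex"
  assumes N: "N holomorphic_on UNIV" and le: "\<And>l. norm (l * N l + d) \<le> C"
  shows "N l = 0"
proof (rule Liouville_weak_0[OF N])
  show "(N \<longlongrightarrow> 0) at_infinity"
  proof (rule Lim_null_comparison)
    show "\<forall>\<^sub>F l in at_infinity. norm (N l) \<le> (C + norm d) * norm (inverse l)"
      unfolding eventually_at_infinity
    proof (intro exI[of _ 1] allI impI)
      fix l :: complex assume "1 \<le> norm l"
      have "norm (l * N l) \<le> C + norm d" using norm_triangle_ineq4[of "l * N l + d" d] le[of l] by simp
      moreover have "norm l > 0" using \<open>1 \<le> norm l\<close> by linarith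
      ultimately have "norm (N l) \<le> (C + norm d) / norm l"
        by (simp only: norm_mult pos_le_divide_eq mult.commute)
      then show "norm (N l) \<le> (C + norm d) * norm (inverse l)" by (simp only: norm_inverse divide_inverse)
    qed
    have "((\<lambda>l::complex. (C + norm d) * norm (inverse l)) \<longlongrightarrow> (C + norm d) * norm (0::complex)) at_infinity"
      by (intro tendsto_intros tendsto_inverse_0)
    then show "((\<lambda>l::complex. (C + norm d) * norm (inverse l)) \<longlongrightarrow> 0) at_infinity" by simp
  qed
qed

text \<open>The degree of \<open>M k\<close> would have to grow with \<open>k\<close>, unless everything vanishes.\<close>

lemma shifted_sequence_trivial:
  fixes M :: "nat \<Rightarrow> complex \<Rightarrow> complex"
  assumes M: "\<And>k. M k holomorphic_on UNIV" and rec: "\<And>k l. M (Suc k) l = l * M k l + d k"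
    and le: "\<And>l. norm (M (p + 2) l) \<le> C * (1 + norm l) ^ p"
  shows "d 0 = 0"
proof -
  \<comment> \<open>Descending from \<open>q = p\<close>, each division by \<open>l\<close> lowers
    index and degree together. At \<open>q = 0\<close> the function \<open>M 2\<close> is bounded,
    so \<open>M 1 = 0\<close> by Liouville, and the recursion at \<open>l = 0\<close> reads
    \<open>M 1 0 = d 0\<close>; hence the offset 2.\<close>
  have "\<exists>C. \<forall>l. norm (M (q + 2) l) \<le> C * (1 + norm l) ^ q" if "q \<le> p" for q
    using that
  proof (induction rule: inc_induct)
    case base then show ?case using le by blast
  next
    case (step q)
    then obtain C where "\<And>l. norm (M (Suc (q + 2)) l) \<le> C * (1 + norm l) ^ Suc q" by auto
    then show ?case by (intro divide_polynomial_bound[OF M, where d = "d (q + 2)"]) (simp only: rec)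
  qed
  from this[of 0] obtain C where "\<And>l. norm (M (Suc 1) l) \<le> C" by (auto simp: numeral_2_eq_2)
  then have "M 1 l = 0" for l by (intro divide_constant_bound[OF M, where d = "d 1"]) (simp only: rec)
  from this[of 0] show ?thesis using rec[of 0 0] by simp
qed

lemma entire_isCont:
  fixes f :: "complex \<Rightarrow> complex"
  assumes "f holomorphic_on UNIV" shows "isCont f z"
  using holomorphic_on_imp_continuous_on[OF assms] by (simp add: continuous_on_eq_continuous_at)

lemma entire_zero_isolated:
  fixes G :: "complex \<Rightarrow> complex"
  assumes G: "G holomorphic_on UNIV" and nz: "G w \<noteq> 0"
  shows "\<forall>\<^sub>F l in at m. G l \<noteq> 0"
proof (cases "G m = 0")
  case True
  have "\<exists>r>0. \<forall>z\<in>ball m r - {m}. G z \<noteq> 0"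
    by (rule isolated_zeros[OF G open_UNIV connected_UNIV UNIV_I True UNIV_I nz]) blast
  then obtain r where r: "0 < r" "\<And>z. z \<in> ball m r - {m} \<Longrightarrow> G z \<noteq> 0" by blast
  then show ?thesis by (auto simp: eventually_at dist_commute intro!: exI[of _ r])
next
  case False
  have "isCont G m" by (rule entire_isCont[OF G])
  then show ?thesis using False by (simp add: isCont_def tendsto_imp_eventually_ne)
qed

lemma entire_cancel:
  fixes G M N :: "complex \<Rightarrow> complex"
  assumes "G holomorphic_on UNIV" "G w \<noteq> 0" "M holomorphic_on UNIV" "N holomorphic_on UNIV"
    and eq: "\<And>l. M l * G l = N l * G l"
  shows "M l = N l"
proof -
  have "isCont M l" "isCont N l"
    by (intro entire_isCont assms)+
  then have "(M \<longlongrightarrow> M l) (at l)" "(N \<longlongrightarrow> N l) (at l)" by (auto simp: isCont_def)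
  moreover have "\<forall>\<^sub>F z in at l. M z = N z"
    using entire_zero_isolated[OF assms(1,2), of l] by eventually_elim (use eq in auto)
  ultimately show ?thesis using tendsto_cong[of M N] tendsto_unique[of "at l"] by (metis at_neq_bot)
qed

text \<open>The local quotients are forced: off the isolated zeros of \<open>G u0\<close> they equal
  \<open>F u0 / G u0\<close>, so they agree with its limit. Defining \<open>M\<close> by that limit
  avoids a choice among the local pieces, and their identities for all \<open>u\<close> carry
  over.\<close>

lemma glue_quotients:
  fixes F G :: "'i \<Rightarrow> complex \<Rightarrow> complex"
  assumes loc: "\<And>m. \<exists>\<epsilon>>0. \<exists>h. h holomorphic_on ball m \<epsilon> \<and> (\<forall>l\<in>ball m \<epsilon>. \<forall>u\<in>H. h l * G u l = F u l)"
    and u0: "u0 \<in> H" "G u0 holomorphic_on UNIV" "G u0 w \<noteq> 0"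
  shows "\<exists>M. M holomorphic_on UNIV \<and> (\<forall>l. \<forall>u\<in>H. M l * G u l = F u l)"
proof -
  define M where "M = (\<lambda>l. Lim (at l) (\<lambda>z. F u0 z / G u0 z))"
  have eq: "M l = h l"
    if h: "\<epsilon> > 0" "h holomorphic_on ball m \<epsilon>" "\<And>l. l \<in> ball m \<epsilon> \<Longrightarrow> h l * G u0 l = F u0 l" and l: "l \<in> ball m \<epsilon>" for m \<epsilon> h l
  proof -
    have "continuous_on (ball m \<epsilon>) h" using h(2) by (rule holomorphic_on_imp_continuous_on)
    then have "isCont h l" using l by (simp add: continuous_on_eq_continuous_at)
    then have "(h \<longlongrightarrow> h l) (at l)" by (simp add: isCont_def)
    moreover have "\<forall>\<^sub>F z in at l. h z = F u0 z / G u0 z"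
    proof -
      have "\<forall>\<^sub>F z in at l. z \<in> ball m \<epsilon>" using l by (intro eventually_at_in_open') auto
      then show ?thesis using entire_zero_isolated[OF u0(2,3), of l]
        by eventually_elim (use h(3) in \<open>auto simp: field_simps\<close>)
    qed
    ultimately have "((\<lambda>z. F u0 z / G u0 z) \<longlongrightarrow> h l) (at l)" using tendsto_cong by force
    then show ?thesis unfolding M_def by (intro tendsto_Lim) auto
  qed
  have "\<exists>\<epsilon>>0. M holomorphic_on ball m \<epsilon> \<and> (\<forall>l\<in>ball m \<epsilon>. \<forall>u\<in>H. M l * G u l = F u l)" for m
  proof -
    obtain \<epsilon> h where h: "\<epsilon> > 0" "h holomorphic_on ball m \<epsilon>" "\<And>l u. l \<in> ball m \<epsilon> \<Longrightarrow> u \<in> H \<Longrightarrow> h l * G u l = F u l"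
      using loc by meson
    have Mh: "M l = h l" if "l \<in> ball m \<epsilon>" for l
      by (rule eq[OF h(1,2) _ that]) (use h(3) u0(1) in auto)
    then have "M holomorphic_on ball m \<epsilon>" using h(2) holomorphic_cong[OF refl] by (metis (no_types, lifting))
    then show ?thesis using Mh h by auto
  qed
  then have loc': "\<And>m. \<exists>\<epsilon>>0. M holomorphic_on ball m \<epsilon>" and all: "\<And>l u. u \<in> H \<Longrightarrow> M l * G u l = F u l"
    by (meson, meson centre_in_ball)
  have "M field_differentiable at l" for l
    using loc'[of l] holomorphic_on_imp_differentiable_at open_ball centre_in_ball by blast
  then have "M holomorphic_on UNIV" by (simp add: holomorphic_on_def field_differentiable_at_within)
  then show ?thesis using all by blast
qed

section \<open>Flat functions, and complex derivatives from quadratic remainders\<close>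

text \<open>The polynomial factor makes the family closed under differentiation: P(y) becomes y^2
  (P(y) - P'(y)) with y = 1/x, so smoothness at 0 reduces to the decay of an exponential against a
  polynomial.\<close>

definition flat :: "real poly \<Rightarrow> real \<Rightarrow> real" where
  "flat P x = (if x \<le> 0 then 0 else poly P (1 / x) * exp (- (1 / x)))"

lemma poly_exp_tendsto_0:
  fixes P :: "real poly"
  shows "((\<lambda>y. poly P y * exp (- y)) \<longlongrightarrow> 0) at_top"
proof -
  have "((\<lambda>y. \<Sum>i\<le>degree P. coeff P i * (y ^ i / exp y)) \<longlongrightarrow> (\<Sum>i\<le>degree P. coeff P i * 0)) at_top"
    by (intro tendsto_intros tendsto_power_div_exp_0)
  moreover have "(\<lambda>y. \<Sum>i\<le>degree P. coeff P i * (y ^ i / exp y)) = (\<lambda>y. poly P y * exp (- y))"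
  proof
    fix y show "(\<Sum>i\<le>degree P. coeff P i * (y ^ i / exp y)) = poly P y * exp (- y)"
      unfolding poly_altdef sum_distrib_right by (intro sum.cong) (auto simp: exp_minus divide_inverse)
  qed
  ultimately show ?thesis by simp
qed

lemma flat_deriv: "(flat P has_real_derivative flat ([:0, 0, 1:] * (P - pderiv P)) x) (at x)"
proof -
  consider "x < 0" | "x > 0" | "x = 0" by linarith
  then show ?thesis
  proof cases
    case 1
    have "(flat P has_real_derivative 0) (at x)"
      by (rule has_field_derivative_transform_within_open[of "\<lambda>_. 0" _ _ "{..<0}"]) (use 1 in \<open>auto simp: flat_def\<close>)
    then show ?thesis using 1 by (simp add: flat_def)
  next
    case 2
    have "((\<lambda>x. 1 / x) has_real_derivative - (1 / x\<^sup>2)) (at x)"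
      using 2 by (auto intro!: derivative_eq_intros simp: power2_eq_square)
    moreover have "((\<lambda>x. poly P (1 / x)) has_real_derivative poly (pderiv P) (1 / x) * - (1 / x\<^sup>2)) (at x)"
      by (rule DERIV_chain2[OF poly_DERIV calculation])
    moreover have "((\<lambda>x. exp (- (1 / x))) has_real_derivative exp (- (1 / x)) * (1 / x\<^sup>2)) (at x)"
      by (rule DERIV_cong[OF DERIV_chain2[OF DERIV_exp DERIV_minus[OF calculation(1)]]]) simp
    ultimately have "((\<lambda>x. poly P (1 / x) * exp (- (1 / x))) has_real_derivative
       poly ([:0, 0, 1:] * (P - pderiv P)) (1 / x) * exp (- (1 / x))) (at x)"
      using 2 by (intro DERIV_cong[OF DERIV_mult]) (auto simp: power2_eq_square field_simps)
    then have "(flat P has_real_derivative poly ([:0, 0, 1:] * (P - pderiv P)) (1 / x) * exp (- (1 / x))) (at x)"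
      by (rule has_field_derivative_transform_within_open[of _ _ _ "{0<..}"]) (use 2 in \<open>auto simp: flat_def\<close>)
    then show ?thesis using 2 by (simp add: flat_def)
  next
    case 3
    have "((\<lambda>h. flat P h / h) \<longlongrightarrow> 0) (at_left 0)"
      by (rule tendsto_eventually) (auto simp: eventually_at_left_field flat_def intro!: exI[of _ "-1"])
    moreover have "((\<lambda>h. flat P h / h) \<longlongrightarrow> 0) (at_right 0)"
    proof -
      have "((\<lambda>h. poly ([:0, 1:] * P) (inverse h) * exp (- inverse h)) \<longlongrightarrow> 0) (at_right (0::real))"
        by (rule filterlim_compose[OF poly_exp_tendsto_0 filterlim_inverse_at_top_right])
      moreover have "\<forall>\<^sub>F h in at_right (0::real). poly ([:0, 1:] * P) (inverse h) * exp (- inverse h) = flat P h / h"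
        by (auto simp: eventually_at_right_field flat_def field_simps intro!: exI[of _ 1])
      ultimately show ?thesis using tendsto_cong by force
    qed
    ultimately have "((\<lambda>h. flat P h / h) \<longlongrightarrow> 0) (at 0)" by (simp add: filterlim_split_at)
    then show ?thesis using 3 by (simp add: DERIV_def flat_def)
  qed
qed

text \<open>This is the shape that two applications of a resolvent identity produce. A local bound
  on the remainder is enough, so continuity in \<open>l\<close> need not be known in
  advance.\<close>

lemma has_field_derivative_quadratic:
  fixes F :: "complex \<Rightarrow> complex"
  assumes eq: "\<And>l. norm (l - m) < 1 \<Longrightarrow> F l - F m = (l - m) * (d + (l - m) * R l)"
    and R: "\<And>l. norm (l - m) < 1 \<Longrightarrow> norm (R l) \<le> B"
  shows "(F has_field_derivative d) (at m)"
proof -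
  have B: "((\<lambda>l. norm (l - m) * B) \<longlongrightarrow> norm (m - m) * B) (at m)" by (intro tendsto_intros)
  have ev: "\<forall>\<^sub>F l in at m. l \<noteq> m \<and> norm (l - m) < 1"
    by (auto simp: eventually_at dist_norm intro!: exI[of _ 1])
  have "((\<lambda>l. (F l - F m) / (l - m) - d) \<longlongrightarrow> 0) (at m)"
  proof (rule Lim_null_comparison)
    show "\<forall>\<^sub>F l in at m. norm ((F l - F m) / (l - m) - d) \<le> norm (l - m) * B"
      using ev
    proof eventually_elim
      case (elim l)
      then have "(F l - F m) / (l - m) - d = (l - m) * R l" using eq[of l] by simp
      then show ?case using R[of l] elim by (simp add: norm_mult mult_left_mono)
    qed
    show "((\<lambda>l. norm (l - m) * B) \<longlongrightarrow> 0) (at m)" using B by simp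
  qed
  then show ?thesis by (simp add: has_field_derivative_iff LIM_zero_iff)
qed

section \<open>Separation by linear functionals\<close>

lemma cInf_le_add:
  fixes A B C :: "real set"
  assumes "B \<noteq> {}" "C \<noteq> {}" "bdd_below A" "\<And>b c. b \<in> B \<Longrightarrow> c \<in> C \<Longrightarrow> \<exists>a\<in>A. a \<le> b + c"
  shows "Inf A \<le> Inf B + Inf C"
proof -
  have "Inf A - b \<le> c" if "b \<in> B" "c \<in> C" for b c
    using assms(4)[OF that] cInf_lower[OF _ assms(3)] by fastforce
  then have "Inf A - b \<le> Inf C" if "b \<in> B" for b using that assms(2) by (intro cInf_greatest) auto
  then have "Inf A - Inf C \<le> b" if "b \<in> B" for b using that by fastforce
  then have "Inf A - Inf C \<le> Inf B" using assms(1) by (intro cInf_greatest) auto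
  then show ?thesis by simp
qed

lemma cInf_le_mult:
  fixes A B :: "real set"
  assumes "B \<noteq> {}" "bdd_below A" "r > 0" "\<And>b. b \<in> B \<Longrightarrow> \<exists>a\<in>A. a \<le> r * b"
  shows "Inf A \<le> r * Inf B"
proof -
  have "Inf A / r \<le> b" if "b \<in> B" for b
    using assms(4)[OF that] cInf_lower[OF _ assms(2)] \<open>r > 0\<close> by (fastforce simp: pos_divide_le_eq mult.commute)
  then have "Inf A / r \<le> Inf B" using assms(1) by (intro cInf_greatest) auto
  then show ?thesis using \<open>r > 0\<close> by (simp add: pos_divide_le_eq mult.commute)
qed

definition cscale :: "complex \<Rightarrow> (real \<Rightarrow> complex) \<Rightarrow> real \<Rightarrow> complex" where
  "cscale c x = (\<lambda>t. c * x t)"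

lemma cscale_simps [simp]:
  "cscale 1 x = x" "cscale 0 x = 0" "cscale c 0 = 0" "cscale c (cscale d x) = cscale (c * d) x"
  by (auto simp: cscale_def fun_eq_iff)

lemma cscale_add: "cscale c (x + y) = cscale c x + cscale c y" "cscale (c + d) x = cscale c x + cscale d x"
  by (auto simp: cscale_def fun_eq_iff algebra_simps)

lemma cscale_minus [simp]: "cscale (- c) x = - cscale c x" "cscale c (- x) = - cscale c x"
  by (auto simp: cscale_def fun_eq_iff)

section \<open>Minimal sublinear functionals and the Hahn-Banach theorem\<close>

locale complex_function_space =
  fixes S :: "(real \<Rightarrow> complex) set"
  assumes add: "x \<in> S \<Longrightarrow> y \<in> S \<Longrightarrow> x + y \<in> S" and scale: "x \<in> S \<Longrightarrow> cscale c x \<in> S"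
    and nonempty: "0 \<in> S"
begin

lemma minus: "x \<in> S \<Longrightarrow> - x \<in> S"
  using scale[of x "- 1"] by simp

text \<open>Homogeneity is asked as an inequality only, which infima inherit easily; scaling back by
  1 / r recovers equality. Fixing the value 0 outside \<open>S\<close> makes the pointwise order
  compare functions on \<open>S\<close> alone, so that minimality can be an equality of
  functions.\<close>

definition sublinear :: "((real \<Rightarrow> complex) \<Rightarrow> real) \<Rightarrow> bool" where
  "sublinear q \<longleftrightarrow> (\<forall>x\<in>S. \<forall>y\<in>S. q (x + y) \<le> q x + q y) \<and>
     (\<forall>x\<in>S. \<forall>r>0. q (cscale (of_real r) x) \<le> r * q x) \<and> (\<forall>x. x \<notin> S \<longrightarrow> q x = 0)"

lemma sublinear_add: "sublinear q \<Longrightarrow> x \<in> S \<Longrightarrow> y \<in> S \<Longrightarrow> q (x + y) \<le> q x + q y"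
  and sublinear_outside: "sublinear q \<Longrightarrow> x \<notin> S \<Longrightarrow> q x = 0"
  by (auto simp: sublinear_def)

lemma sublinear_scale:
  assumes q: "sublinear q" and x: "x \<in> S" and r: "r > 0"
  shows "q (cscale (of_real r) x) = r * q x"
proof (rule antisym)
  show "q (cscale (of_real r) x) \<le> r * q x" using assms by (auto simp: sublinear_def)
  have "q (cscale (of_real (1 / r)) (cscale (of_real r) x)) \<le> 1 / r * q (cscale (of_real r) x)"
    using q scale[OF x] r unfolding sublinear_def by (metis zero_less_divide_1_iff)
  then show "r * q x \<le> q (cscale (of_real r) x)" using r by (simp add: field_simps)
qed

lemma sublinear_0: "sublinear q \<Longrightarrow> q 0 = 0"
  using sublinear_scale[of q 0 2] nonempty by simp

lemma sublinear_scale_nonneg: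
  assumes "sublinear q" "x \<in> S" "r \<ge> 0" shows "q (cscale (of_real r) x) = r * q x"
  using assms sublinear_scale[of q x r] sublinear_0[of q] by (cases "r = 0") auto

lemma sublinear_minus: "sublinear q \<Longrightarrow> x \<in> S \<Longrightarrow> - q (- x) \<le> q x"
  using sublinear_add[of q x "- x"] sublinear_0[of q] minus[of x] by simp

lemma sublinear_Inf:
  assumes ne: "\<And>x. x \<in> S \<Longrightarrow> A x \<noteq> {}" and bdd: "\<And>x. x \<in> S \<Longrightarrow> bdd_below (A x)"
    and add': "\<And>x y u v. x \<in> S \<Longrightarrow> y \<in> S \<Longrightarrow> u \<in> A x \<Longrightarrow> v \<in> A y \<Longrightarrow> \<exists>w\<in>A (x + y). w \<le> u + v"
    and mult': "\<And>x r u. x \<in> S \<Longrightarrow> r > 0 \<Longrightarrow> u \<in> A x \<Longrightarrow> \<exists>w\<in>A (cscale (of_real r) x). w \<le> r * u"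
  shows "sublinear (\<lambda>x. if x \<in> S then Inf (A x) else 0)"
  unfolding sublinear_def
proof (intro conjI ballI allI impI)
  fix x y assume "x \<in> S" "y \<in> S"
  then show "(if x + y \<in> S then Inf (A (x + y)) else 0) \<le> (if x \<in> S then Inf (A x) else 0) + (if y \<in> S then Inf (A y) else 0)"
    using cInf_le_add[OF ne[of x] ne[of y] bdd[of "x + y"] add'[of x y]] by (simp add: add)
next
  fix x and r :: real assume "x \<in> S" "r > 0"
  then show "(if cscale (of_real r) x \<in> S then Inf (A (cscale (of_real r) x)) else 0) \<le> r * (if x \<in> S then Inf (A x) else 0)"
    using cInf_le_mult[OF ne[of x] bdd[of "cscale (of_real r) x"] _ mult'[of x r]] by (simp add: scale)
qed simp

text \<open>Zorn's lemma: the infimum of a chain is finite because - p (- x) bounds every member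
  from below at x, and it is subadditive because, of any two members, the smaller one serves both
  arguments.\<close>

lemma minimal_sublinear_exists:
  assumes p: "sublinear p"
  shows "\<exists>m. sublinear m \<and> m \<le> p \<and> (\<forall>q. sublinear q \<and> q \<le> m \<longrightarrow> q = m)"
proof -
  define A where "A = {q. sublinear q \<and> q \<le> p}"
  define P where "P = (\<lambda>q q' :: (real \<Rightarrow> complex) \<Rightarrow> real. q' \<le> q)"
  have po: "partial_order_on A (relation_of P A)"
    by (rule partial_order_on_relation_ofI) (auto simp: P_def)
  have "\<exists>m\<in>A. \<forall>q\<in>A. P m q \<longrightarrow> q = m"
  proof (rule predicate_Zorn[OF po])
    fix C assume C: "C \<in> Chains (relation_of P A)"
    then have CA: "C \<subseteq> A" by (auto simp: Chains_def relation_of_def)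
    have chain: "q \<le> q' \<or> q' \<le> q" if "q \<in> C" "q' \<in> C" for q q'
      using C that by (auto simp: Chains_def relation_of_def P_def)
    show "\<exists>u\<in>A. \<forall>q\<in>C. P q u"
    proof (cases "C = {}")
      case True then show ?thesis using p by (auto simp: A_def)
    next
      case False
      define u where "u = (\<lambda>x. if x \<in> S then Inf ((\<lambda>q. q x) ` C) else 0)"
      have lower: "- p (- x) \<le> q x" if "q \<in> C" "x \<in> S" for q x
        using sublinear_minus[of q x] that CA unfolding A_def le_fun_def by (smt (verit) mem_Collect_eq subsetD)
      then have bdd: "bdd_below ((\<lambda>q. q x) ` C)" if "x \<in> S" for x
        using that by (intro bdd_belowI2[of _ "- p (- x)"]) auto
      have "sublinear u" unfolding u_def
      proof (rule sublinear_Inf)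
        fix x y u v assume xy: "x \<in> S" "y \<in> S" "u \<in> (\<lambda>q. q x) ` C" "v \<in> (\<lambda>q. q y) ` C"
        then obtain q q' where q: "q \<in> C" "q' \<in> C" "u = q x" "v = q' y" by auto
        define s where "s = (if q \<le> q' then q else q')"
        have s: "s \<in> C" "s \<le> q" "s \<le> q'" using chain[OF q(1,2)] q by (auto simp: s_def)
        then have "s (x + y) \<le> s x + s y" using CA xy by (auto simp: A_def intro!: sublinear_add)
        also have "\<dots> \<le> u + v" using s q by (auto simp: le_fun_def intro!: add_mono)
        finally show "\<exists>w\<in>(\<lambda>q. q (x + y)) ` C. w \<le> u + v" using s by blast
      next
        fix x u and r :: real assume xr: "x \<in> S" "r > 0" "u \<in> (\<lambda>q. q x) ` C"
        then obtain q where q: "q \<in> C" "u = q x" by auto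
        then have "q (cscale (of_real r) x) = r * u" using sublinear_scale[of q x r] xr CA by (auto simp: A_def)
        then show "\<exists>w\<in>(\<lambda>q. q (cscale (of_real r) x)) ` C. w \<le> r * u"
          by (intro bexI[OF _ imageI[OF q(1)]]) simp
      qed (use False bdd in auto)
      moreover have le: "u \<le> q" if "q \<in> C" for q
      proof (rule le_funI)
        fix x show "u x \<le> q x"
        proof (cases "x \<in> S")
          case True
          then show ?thesis unfolding u_def using that bdd[OF True] by (auto intro!: cInf_lower)
        next
          case False
          then show ?thesis using that CA sublinear_outside[of q x] by (auto simp: u_def A_def)
        qed
      qed
      moreover obtain q where "q \<in> C" using False by blast
      moreover have "q \<le> p" using CA \<open>q \<in> C\<close> by (auto simp: A_def)
      ultimately have "u \<in> A" unfolding A_def using order_trans[of u q p] by blast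
      then show ?thesis using le by (auto simp: P_def)
    qed
  qed
  then obtain m where "m \<in> A" "\<And>q. q \<in> A \<Longrightarrow> q \<le> m \<Longrightarrow> q = m" unfolding P_def by blast
  then show ?thesis unfolding A_def by (intro exI[of _ m]) (auto intro: order_trans)
qed

text \<open>The infimum over t \<ge> 0 of m (y + t x) - t m x is again sublinear in y and at most m,
  hence equal to m by minimality, and t = 1 gives the missing inequality.\<close>

lemma minimal_sublinear_additive:
  assumes m: "sublinear m" and min: "\<And>q. sublinear q \<Longrightarrow> q \<le> m \<Longrightarrow> q = m" and x: "x \<in> S" and y: "y \<in> S"
  shows "m (y + x) = m y + m x"
proof -
  define A where "A = (\<lambda>y. (\<lambda>t. m (y + cscale (of_real t) x) - t * m x) ` {0..})"
  define q where "q = (\<lambda>y. if y \<in> S then Inf (A y) else 0)"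
  have bdd: "bdd_below (A y)" if "y \<in> S" for y
    unfolding A_def
  proof (rule bdd_belowI2[of _ "- m (- y)"])
    fix t :: real assume "t \<in> {0..}"
    then have "t * m x = m (cscale (of_real t) x)" using sublinear_scale_nonneg[OF m x] by simp
    also have "\<dots> = m ((y + cscale (of_real t) x) + - y)" by simp
    also have "\<dots> \<le> m (y + cscale (of_real t) x) + m (- y)"
      by (intro sublinear_add[OF m] add scale minus that x)
    finally show "- m (- y) \<le> m (y + cscale (of_real t) x) - t * m x" by simp
  qed
  have "sublinear q" unfolding q_def
  proof (rule sublinear_Inf)
    fix z y u v assume zy: "z \<in> S" "y \<in> S" "u \<in> A z" "v \<in> A y"
    then obtain s t where st: "s \<ge> 0" "t \<ge> 0" "u = m (z + cscale (of_real s) x) - s * m x" "v = m (y + cscale (of_real t) x) - t * m x"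
      by (auto simp: A_def)
    have "z + y + cscale (of_real (s + t)) x = (z + cscale (of_real s) x) + (y + cscale (of_real t) x)"
      by (simp add: cscale_add algebra_simps)
    then have "m (z + y + cscale (of_real (s + t)) x) - (s + t) * m x \<le> u + v"
      using sublinear_add[OF m, of "z + cscale (of_real s) x" "y + cscale (of_real t) x"] zy x st
      by (simp add: add scale algebra_simps)
    then show "\<exists>w\<in>A (z + y). w \<le> u + v" using st unfolding A_def by (intro bexI[OF _ imageI[of "s + t"]]) auto
  next
    fix y u and r :: real assume yr: "y \<in> S" "r > 0" "u \<in> A y"
    then obtain t where t: "t \<ge> 0" "u = m (y + cscale (of_real t) x) - t * m x" by (auto simp: A_def)
    have "cscale (of_real r) y + cscale (of_real (r * t)) x = cscale (of_real r) (y + cscale (of_real t) x)"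
      by (simp add: cscale_add)
    then have "m (cscale (of_real r) y + cscale (of_real (r * t)) x) = r * m (y + cscale (of_real t) x)"
      using sublinear_scale[OF m add[OF yr(1) scale[OF x]] yr(2)] by (simp only:)
    then have "m (cscale (of_real r) y + cscale (of_real (r * t)) x) - (r * t) * m x \<le> r * u"
      unfolding t(2) by (simp only: right_diff_distrib mult.assoc order_refl)
    then show "\<exists>w\<in>A (cscale (of_real r) y). w \<le> r * u"
      using t yr unfolding A_def by (intro bexI[OF _ imageI[of "r * t"]]) auto
  qed (use bdd in \<open>auto simp: A_def\<close>)
  moreover have "q \<le> m"
  proof (rule le_funI)
    fix y show "q y \<le> m y"
    proof (cases "y \<in> S")
      case True
      have "m y \<in> A y" unfolding A_def by (intro image_eqI[of _ _ 0]) auto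
      then show ?thesis using True bdd[OF True] by (auto simp: q_def intro: cInf_lower)
    qed (simp add: q_def sublinear_outside[OF m])
  qed
  ultimately have "q = m" by (rule min)
  have "m (y + x) - m x \<in> A y" unfolding A_def by (intro image_eqI[of _ _ 1]) auto
  then have "q y \<le> m (y + x) - m x" using y bdd[OF y] by (auto simp: q_def intro: cInf_lower)
  then show ?thesis using \<open>q = m\<close> sublinear_add[OF m y x] by simp
qed

lemma Hahn_Banach_real:
  assumes p: "sublinear p"
  shows "\<exists>m. (\<forall>x\<in>S. \<forall>y\<in>S. m (x + y) = m x + m y) \<and> (\<forall>x\<in>S. \<forall>r. m (cscale (of_real r) x) = r * m x) \<and> (\<forall>x\<in>S. m x \<le> p x)"
proof -
  obtain m where m: "sublinear m" "m \<le> p" "\<And>q. sublinear q \<Longrightarrow> q \<le> m \<Longrightarrow> q = m"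
    using minimal_sublinear_exists[OF p] by blast
  have add': "m (x + y) = m x + m y" if "x \<in> S" "y \<in> S" for x y
    by (rule minimal_sublinear_additive[OF m(1,3)]) (use that in auto)
  have "m (cscale (of_real r) x) = r * m x" if "x \<in> S" for x r
  proof (cases "r \<ge> 0")
    case False
    have "m (cscale (of_real r) x) + m (cscale (of_real (- r)) x) = m (cscale (of_real r) x + cscale (of_real (- r)) x)"
      by (rule add'[symmetric]) (intro scale that)+
    also have "\<dots> = 0" using sublinear_0[OF m(1)] by simp
    finally show ?thesis using sublinear_scale_nonneg[OF m(1) that, of "- r"] False by simp
  qed (use sublinear_scale_nonneg m that in blast)
  then show ?thesis using m(2) add' by (intro exI[of _ m]) (auto simp: le_fun_def)
qed

text \<open>One sublinear functional encodes all requirements: \<open>q\<close> is the infimum of p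
  (x + g + t f) - t e over g in \<open>L\<close> and t \<ge> 0. For a linear m \<le> q, the choice g
  = 0, t = 0 gives m \<le> p; the choice g = - x for x in \<open>L\<close> gives m \<le> 0 and so m
  = 0 on \<open>L\<close>; and t = 1 at x = - f gives m f \<ge> e. The complex functional is rebuilt
  from its real part m in the usual way.\<close>

lemma separating_functional:
  assumes p: "sublinear p" and p0: "\<And>x. x \<in> S \<Longrightarrow> p x \<ge> 0"
    and L: "L \<subseteq> S" "complex_function_space L"
    and f: "f \<in> S" and sep: "\<And>g. g \<in> L \<Longrightarrow> p (f + g) \<ge> e" and e: "e > 0"
  shows "\<exists>\<xi>. (\<forall>x\<in>S. \<forall>y\<in>S. \<forall>c. \<xi> (cscale c x + y) = c * \<xi> x + \<xi> y) \<and> (\<forall>g\<in>L. \<xi> g = 0) \<and> \<xi> f \<noteq> 0 \<and>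
    (\<forall>x\<in>S. norm (\<xi> x) \<le> max (p x) (p (- x)) + max (p (cscale \<i> x)) (p (- cscale \<i> x)))"
proof -
  interpret L: complex_function_space L by fact
  define A where "A = (\<lambda>x. (\<lambda>(g, t). p (x + (g + cscale (of_real t) f)) - t * e) ` (L \<times> {0..}))"
  define q where "q = (\<lambda>x. if x \<in> S then Inf (A x) else 0)"
  have inS: "g + cscale c f \<in> S" if "g \<in> L" for g c using that L f by (auto intro: add scale)
  have bdd: "bdd_below (A x)" if x: "x \<in> S" for x
  proof -
    have "- p (- x) \<le> p (x + (g + cscale (of_real t) f)) - t * e" if "g \<in> L" "t \<ge> 0" for g t
    proof -
      have "t * e \<le> p (g + cscale (of_real t) f)"
      proof (cases "t = 0")
        case True then show ?thesis using p0 L that by auto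
      next
        case False
        then have t: "t > 0" using that by simp
        have "cscale (of_real t) (f + cscale (of_real (1 / t)) g) = g + cscale (of_real t) f"
          using t by (simp add: cscale_add add.commute)
        moreover have "f + cscale (of_real (1 / t)) g \<in> S" using f L that by (auto intro!: add scale)
        ultimately have "p (g + cscale (of_real t) f) = t * p (f + cscale (of_real (1 / t)) g)"
          using sublinear_scale[OF p _ t] by metis
        moreover have "t * e \<le> t * p (f + cscale (of_real (1 / t)) g)"
          using t sep[OF L.scale[OF that(1)]] by (intro mult_left_mono) auto
        ultimately show ?thesis by simp
      qed
      also have "p (g + cscale (of_real t) f) = p ((x + (g + cscale (of_real t) f)) + - x)" by simp
      also have "\<dots> \<le> p (x + (g + cscale (of_real t) f)) + p (- x)"
        by (intro sublinear_add[OF p] add minus x inS that)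
      finally show ?thesis by simp
    qed
    then show ?thesis unfolding A_def by (intro bdd_belowI2[of _ "- p (- x)"]) auto
  qed
  have memA: "p (x + (g + cscale (of_real t) f)) - t * e \<in> A x" if "g \<in> L" "t \<ge> 0" for x g t
    unfolding A_def using that by (intro image_eqI[of _ _ "(g, t)"]) auto
  have q: "sublinear q" unfolding q_def
  proof (rule sublinear_Inf)
    fix x y u v assume xy: "x \<in> S" "y \<in> S" "u \<in> A x" "v \<in> A y"
    then obtain g s h t where gs: "g \<in> L" "s \<ge> 0" "u = p (x + (g + cscale (of_real s) f)) - s * e"
      "h \<in> L" "t \<ge> 0" "v = p (y + (h + cscale (of_real t) f)) - t * e"
      by (auto simp: A_def)
    have "x + y + (g + h + cscale (of_real (s + t)) f) = (x + (g + cscale (of_real s) f)) + (y + (h + cscale (of_real t) f))"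
      by (simp add: cscale_add algebra_simps)
    then have "p (x + y + (g + h + cscale (of_real (s + t)) f)) \<le> p (x + (g + cscale (of_real s) f)) + p (y + (h + cscale (of_real t) f))"
      using sublinear_add[OF p add[OF xy(1) inS[OF gs(1)]] add[OF xy(2) inS[OF gs(4)]]] by (simp only:)
    then have "p (x + y + (g + h + cscale (of_real (s + t)) f)) - (s + t) * e \<le> u + v"
      using gs by (simp add: algebra_simps)
    then show "\<exists>w\<in>A (x + y). w \<le> u + v" using memA[of "g + h" "s + t" "x + y"] gs L.add by auto
  next
    fix x u and r :: real assume xr: "x \<in> S" "r > 0" "u \<in> A x"
    then obtain g t where t: "g \<in> L" "t \<ge> 0" "u = p (x + (g + cscale (of_real t) f)) - t * e" by (auto simp: A_def)
    have "cscale (of_real r) x + (cscale (of_real r) g + cscale (of_real (r * t)) f) = cscale (of_real r) (x + (g + cscale (of_real t) f))"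
      by (simp add: cscale_add)
    then have "p (cscale (of_real r) x + (cscale (of_real r) g + cscale (of_real (r * t)) f)) = r * p (x + (g + cscale (of_real t) f))"
      using sublinear_scale[OF p add[OF xr(1) inS[OF t(1)]] xr(2)] by (simp only:)
    then have "p (cscale (of_real r) x + (cscale (of_real r) g + cscale (of_real (r * t)) f)) - (r * t) * e \<le> r * u"
      unfolding t(3) by (simp only: right_diff_distrib mult.assoc order_refl)
    then show "\<exists>w\<in>A (cscale (of_real r) x). w \<le> r * u"
      using memA[OF L.scale[OF t(1)], of "r * t"] t xr by (meson mult_nonneg_nonneg less_imp_le)
  qed (use bdd L.nonempty in \<open>auto simp: A_def\<close>)
  have q_le: "q x \<le> p (x + (g + cscale (of_real t) f)) - t * e" if "x \<in> S" "g \<in> L" "t \<ge> 0" for x g t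
    unfolding q_def using that by (auto intro!: cInf_lower memA bdd)
  have p_0: "p 0 = 0" by (rule sublinear_0[OF p])
  obtain m where m: "\<And>x y. x \<in> S \<Longrightarrow> y \<in> S \<Longrightarrow> m (x + y) = m x + m y"
    "\<And>x r. x \<in> S \<Longrightarrow> m (cscale (of_real r) x) = r * m x" "\<And>x. x \<in> S \<Longrightarrow> m x \<le> q x"
    using Hahn_Banach_real[OF q] by blast
  have m_minus: "m (- x) = - m x" if "x \<in> S" for x using m(2)[OF that, of "- 1"] by simp
  have m_abs: "\<bar>m x\<bar> \<le> max (p x) (p (- x))" if "x \<in> S" for x
    using q_le[OF that L.nonempty order_refl] q_le[OF minus[OF that] L.nonempty order_refl] m(3)[OF that] m(3)[OF minus[OF that]] m_minus[OF that]
    by simp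
  have mL: "m g = 0" if "g \<in> L" for g
  proof -
    have "m g \<le> 0" if "g \<in> L" for g
      using q_le[of g "- g" 0] L.minus[OF that] m(3)[of g] that L p_0 by auto
    from this[OF that] this[OF L.minus[OF that]] show ?thesis using m_minus[of g] that L by auto
  qed
  have mf: "m f \<ge> e"
    using q_le[OF minus[OF f] L.nonempty, of 1] m(3)[OF minus[OF f]] m_minus[OF f] p_0 by simp
  define \<xi> where "\<xi> = (\<lambda>x. Complex (m x) (- m (cscale \<i> x)))"
  have m_cscale: "m (cscale c x) = Re c * m x + Im c * m (cscale \<i> x)" if "x \<in> S" for c x
  proof -
    have "cscale c x = cscale (of_real (Re c)) x + cscale (of_real (Im c)) (cscale \<i> x)"
      unfolding cscale_simps cscale_add(2)[symmetric] by (metis complex_eq mult.commute)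
    then show ?thesis using m(1)[OF scale[OF that] scale[OF scale[OF that]]] m(2)[OF that] m(2)[OF scale[OF that]] by metis
  qed
  show ?thesis
  proof (intro exI[of _ \<xi>] conjI ballI allI)
    fix x y c assume xy: "x \<in> S" "y \<in> S"
    have 1: "m (cscale c x + y) = Re c * m x + Im c * m (cscale \<i> x) + m y"
      unfolding m(1)[OF scale[OF xy(1)] xy(2)] m_cscale[OF xy(1), of c] ..
    have "cscale \<i> (cscale c x + y) = cscale (\<i> * c) x + cscale \<i> y" by (simp add: cscale_add)
    then have "m (cscale \<i> (cscale c x + y)) = m (cscale (\<i> * c) x) + m (cscale \<i> y)"
      using m(1)[OF scale[OF xy(1)] scale[OF xy(2)]] by (simp only:)
    then have "m (cscale \<i> (cscale c x + y)) = - Im c * m x + Re c * m (cscale \<i> x) + m (cscale \<i> y)"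
      unfolding m_cscale[OF xy(1), of "\<i> * c"] by simp
    then show "\<xi> (cscale c x + y) = c * \<xi> x + \<xi> y"
      unfolding \<xi>_def 1 by (simp add: complex_eq_iff algebra_simps)
  next
    fix g assume "g \<in> L" then show "\<xi> g = 0" using mL L.scale by (simp add: \<xi>_def zero_complex.ctr)
  next
    show "\<xi> f \<noteq> 0" using mf e by (simp add: \<xi>_def complex_eq_iff)
  next
    fix x assume "x \<in> S"
    have "norm (\<xi> x) \<le> \<bar>m x\<bar> + \<bar>m (cscale \<i> x)\<bar>" using cmod_le[of "\<xi> x"] by (simp add: \<xi>_def)
    also have "\<dots> \<le> max (p x) (p (- x)) + max (p (cscale \<i> x)) (p (- cscale \<i> x))"
      by (intro add_mono m_abs scale \<open>x \<in> S\<close>)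
    finally show "norm (\<xi> x) \<le> max (p x) (p (- x)) + max (p (cscale \<i> x)) (p (- cscale \<i> x))" .
  qed
qed

end

section \<open>Smooth functions on an interval\<close>

context
  fixes a b :: ereal
begin

private abbreviation (input) "E \<equiv> einterval a b"
private abbreviation (input) "S \<equiv> smooth_functions a b"
private abbreviation (input) "D \<equiv> deriv_op a b"
private abbreviation (input) ex where "ex \<mu> \<equiv> exp_monomial a b 0 \<mu>"

lemma einterval_between: "x \<in> einterval a b \<Longrightarrow> y \<in> einterval a b \<Longrightarrow> x \<le> t \<Longrightarrow> t \<le> y \<Longrightarrow> t \<in> einterval a b"
  by (auto simp: einterval_def) (meson ereal_less_eq(3) less_le_trans le_less_trans)+

lemma convex_einterval: "convex (einterval a b)"
  unfolding is_interval_convex_1[symmetric] is_interval_1 by (meson einterval_between)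

lemma deriv_op_eq: "t \<in> E \<Longrightarrow> (f has_vector_derivative f') (at t) \<Longrightarrow> D f t = f'"
  by (simp add: deriv_op_def vector_derivative_at)

lemma deriv_op_outside: "t \<notin> E \<Longrightarrow> D f t = 0"
  by (simp add: deriv_op_def)

lemma deriv_op_works: "t \<in> E \<Longrightarrow> f differentiable at t \<Longrightarrow> (f has_vector_derivative D f t) (at t)"
  by (simp add: deriv_op_def vector_derivative_works)

text \<open>A finite order makes the closure properties provable by induction, since the derivative
  has one order less.\<close>

definition times_differentiable :: "nat \<Rightarrow> (real \<Rightarrow> complex) \<Rightarrow> bool" where
  "times_differentiable n f \<longleftrightarrow> (\<forall>k\<le>n. \<forall>t\<in>E. (D ^^ k) f differentiable at t)"

lemma times_differentiable_0: "times_differentiable 0 f \<longleftrightarrow> (\<forall>t\<in>E. f differentiable at t)"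
  by (simp add: times_differentiable_def)

lemma times_differentiable_Suc:
  "times_differentiable (Suc n) f \<longleftrightarrow> (\<forall>t\<in>E. f differentiable at t) \<and> times_differentiable n (D f)"
proof -
  have "(\<forall>k\<le>Suc n. P k) \<longleftrightarrow> P 0 \<and> (\<forall>k\<le>n. P (Suc k))" for P
    by (metis le0 not0_implies_Suc Suc_le_mono)
  from this[of "\<lambda>k. \<forall>t\<in>E. (D ^^ k) f differentiable at t"] show ?thesis
    by (simp add: times_differentiable_def funpow_swap1)
qed

lemma times_differentiable_imp_diff: "times_differentiable n f \<Longrightarrow> t \<in> E \<Longrightarrow> f differentiable at t"
  by (force simp: times_differentiable_def)

lemma times_differentiable_Suc_imp: "times_differentiable (Suc n) f \<Longrightarrow> times_differentiable n f"
  by (simp add: times_differentiable_def)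

lemma smooth_iff: "f \<in> S \<longleftrightarrow> (\<forall>t. t \<notin> E \<longrightarrow> f t = 0) \<and> (\<forall>n. times_differentiable n f)"
  by (auto simp: smooth_functions_def times_differentiable_def)

lemma smooth_outside: "f \<in> S \<Longrightarrow> t \<notin> E \<Longrightarrow> f t = 0"
  by (simp add: smooth_iff)

lemma smooth_deriv: "f \<in> S \<Longrightarrow> t \<in> E \<Longrightarrow> (f has_vector_derivative D f t) (at t)"
  by (auto simp: smooth_iff intro: deriv_op_works times_differentiable_imp_diff)

lemma smooth_deriv_op: "f \<in> S \<Longrightarrow> D f \<in> S"
  using times_differentiable_Suc by (auto simp: smooth_iff deriv_op_outside)

lemma smooth_deriv_op_pow: "f \<in> S \<Longrightarrow> (D ^^ k) f \<in> S"
  by (induction k) (auto intro: smooth_deriv_op)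

lemma smooth_continuous: "f \<in> S \<Longrightarrow> A \<subseteq> E \<Longrightarrow> continuous_on A f"
  using smooth_deriv by (intro continuous_at_imp_continuous_on) (auto intro: has_vector_derivative_continuous)

lemma deriv_op_lincomb:
  assumes "\<And>t. t \<in> E \<Longrightarrow> f differentiable at t" "\<And>t. t \<in> E \<Longrightarrow> g differentiable at t"
  shows "D (\<lambda>t. c * f t + g t) = (\<lambda>t. c * D f t + D g t)"
proof
  fix t show "D (\<lambda>t. c * f t + g t) t = c * D f t + D g t"
  proof (cases "t \<in> E")
    case True
    then show ?thesis
      by (intro deriv_op_eq has_vector_derivative_add has_vector_derivative_mult_right deriv_op_works assms)
  qed (simp add: deriv_op_outside)
qed

lemma differentiable_lincomb:
  fixes f g :: "real \<Rightarrow> complex"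
  assumes "f differentiable at t" "g differentiable at t"
  shows "(\<lambda>t. c * f t + g t) differentiable at t"
  using assms by (intro differentiable_add differentiable_mult) auto

lemma times_differentiable_lincomb:
  "times_differentiable n f \<Longrightarrow> times_differentiable n g \<Longrightarrow> times_differentiable n (\<lambda>t. c * f t + g t)"
proof (induction n arbitrary: f g)
  case 0 then show ?case by (auto simp: times_differentiable_0 intro: differentiable_lincomb)
next
  case (Suc n)
  then show ?case
    by (auto simp: times_differentiable_Suc deriv_op_lincomb intro: differentiable_lincomb)
qed

lemma smooth_lincomb: "f \<in> S \<Longrightarrow> g \<in> S \<Longrightarrow> (\<lambda>t. c * f t + g t) \<in> S"
  by (auto simp: smooth_iff times_differentiable_lincomb)

lemma smooth_zero: "(\<lambda>_. 0) \<in> S"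
proof -
  have "times_differentiable n (\<lambda>_. 0)" for n
  proof (induction n)
    case (Suc n)
    moreover have "D (\<lambda>_. 0) = (\<lambda>_. 0)" by (auto simp: deriv_op_def)
    ultimately show ?case by (simp add: times_differentiable_Suc)
  qed (simp add: times_differentiable_0)
  then show ?thesis by (simp add: smooth_iff)
qed

lemma smooth_scale: "f \<in> S \<Longrightarrow> (\<lambda>t. c * f t) \<in> S"
  using smooth_lincomb[OF _ smooth_zero] by simp

lemma smooth_add: "f \<in> S \<Longrightarrow> g \<in> S \<Longrightarrow> (\<lambda>t. f t + g t) \<in> S"
  using smooth_lincomb[of f g 1] by simp

lemma smooth_deriv_op_lincomb:
  "f \<in> S \<Longrightarrow> g \<in> S \<Longrightarrow> D (\<lambda>t. c * f t + g t) = (\<lambda>t. c * D f t + D g t)"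
  by (rule deriv_op_lincomb) (auto simp: smooth_iff intro: times_differentiable_imp_diff)

lemma deriv_op_pow_lincomb:
  "f \<in> S \<Longrightarrow> g \<in> S \<Longrightarrow> (D ^^ k) (\<lambda>t. c * f t + g t) = (\<lambda>t. c * (D ^^ k) f t + (D ^^ k) g t)"
  by (induction k) (auto simp: smooth_deriv_op_lincomb smooth_deriv_op_pow)

lemma times_differentiable_mult:
  "times_differentiable n f \<Longrightarrow> times_differentiable n g \<Longrightarrow> times_differentiable n (\<lambda>t. f t * g t)"
proof (induction n arbitrary: f g)
  case 0 then show ?case by (auto simp: times_differentiable_0 intro: differentiable_mult)
next
  case (Suc n)
  have df: "\<And>t. t \<in> E \<Longrightarrow> f differentiable at t" "\<And>t. t \<in> E \<Longrightarrow> g differentiable at t"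
    using Suc.prems by (auto intro: times_differentiable_imp_diff)
  have "D (\<lambda>t. f t * g t) = (\<lambda>t. 1 * (f t * D g t) + D f t * g t)"
  proof
    fix t show "D (\<lambda>t. f t * g t) t = 1 * (f t * D g t) + D f t * g t"
    proof (cases "t \<in> E")
      case True
      from has_vector_derivative_mult[OF deriv_op_works[OF True df(1)[OF True]] deriv_op_works[OF True df(2)[OF True]]]
      show ?thesis by (subst deriv_op_eq[OF True]) auto
    qed (simp add: deriv_op_outside)
  qed
  moreover have "times_differentiable n (\<lambda>t. 1 * (f t * D g t) + D f t * g t)"
    using Suc.prems by (intro times_differentiable_lincomb Suc.IH)
      (auto simp: times_differentiable_Suc intro: times_differentiable_Suc_imp[unfolded times_differentiable_Suc])
  ultimately show ?case using df by (auto simp: times_differentiable_Suc intro: differentiable_mult)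
qed

lemma smooth_mult: "f \<in> S \<Longrightarrow> g \<in> S \<Longrightarrow> (\<lambda>t. f t * g t) \<in> S"
  by (auto simp: smooth_iff times_differentiable_mult)

lemma smooth_of_derivatives:
  assumes "\<And>k t. t \<in> E \<Longrightarrow> (h k has_vector_derivative h (Suc k) t) (at t)"
  shows "(\<lambda>t. if t \<in> E then h 0 t else 0) \<in> S"
    and "(D ^^ k) (\<lambda>t. if t \<in> E then h 0 t else 0) = (\<lambda>t. if t \<in> E then h k t else 0)"
proof -
  have d: "((\<lambda>t. if t \<in> E then h k t else 0) has_vector_derivative h (Suc k) t) (at t)" if "t \<in> E" for k t
    by (rule has_vector_derivative_transform_within_open[OF assms[OF that] open_einterval that]) simp
  have eq: "(D ^^ k) (\<lambda>t. if t \<in> E then h 0 t else 0) = (\<lambda>t. if t \<in> E then h k t else 0)" for k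
  proof (induction k)
    case (Suc k)
    have "(D ^^ Suc k) (\<lambda>t. if t \<in> E then h 0 t else 0) = D (\<lambda>t. if t \<in> E then h k t else 0)" by (simp add: Suc)
    also have "\<dots> = (\<lambda>t. if t \<in> E then h (Suc k) t else 0)"
      by (auto simp: fun_eq_iff deriv_op_outside intro: deriv_op_eq d)
    finally show ?case .
  qed simp
  then show "(D ^^ k) (\<lambda>t. if t \<in> E then h 0 t else 0) = (\<lambda>t. if t \<in> E then h k t else 0)" .
  have "(\<lambda>t. if t \<in> E then h k t else 0) differentiable at t" if "t \<in> E" for k t
    using d[OF that] by (metis differentiableI_vector)
  then have "(D ^^ k) (\<lambda>t. if t \<in> E then h 0 t else 0) differentiable at t" if "t \<in> E" for k t
    using that unfolding eq by blast
  then show "(\<lambda>t. if t \<in> E then h 0 t else 0) \<in> S"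
    by (simp add: smooth_functions_def)
qed

text \<open>Bootstrapping: the equation expresses the derivative through f and a smooth function, so
  each order of differentiability yields the next.\<close>

lemma smooth_of_deriv_op:
  assumes "\<And>t. t \<notin> E \<Longrightarrow> f t = 0" "\<And>t. t \<in> E \<Longrightarrow> f differentiable at t" "D f = (\<lambda>t. c * f t + g t)" "g \<in> S"
  shows "f \<in> S"
proof -
  have "times_differentiable n f" for n
  proof (induction n)
    case 0 then show ?case using assms by (simp add: times_differentiable_0)
  next
    case (Suc n)
    then show ?case using assms by (auto simp: times_differentiable_Suc smooth_iff intro: times_differentiable_lincomb)
  qed
  then show ?thesis using assms(1) by (simp add: smooth_iff)
qed

lemma exp_monomial_0: "exp_monomial a b 0 \<mu> = (\<lambda>t. if t \<in> E then exp (\<mu> * of_real t) else 0)"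
  by (auto simp: exp_monomial_def fun_eq_iff)

lemma smooth_exp: "ex \<mu> \<in> S" and deriv_op_pow_exp: "(D ^^ k) (ex \<mu>) = (\<lambda>t. \<mu> ^ k * ex \<mu> t)"
proof -
  have d: "((\<lambda>t. \<mu> ^ k * exp (\<mu> * of_real t)) has_vector_derivative \<mu> ^ Suc k * exp (\<mu> * of_real t)) (at t)" for k t
  proof -
    have "((\<lambda>t. \<mu> * complex_of_real t) has_vector_derivative \<mu>) (at t)"
      by (auto intro!: derivative_eq_intros)
    from field_vector_diff_chain_at[OF this DERIV_exp]
    show ?thesis by (auto simp: o_def intro!: derivative_eq_intros)
  qed
  note * = smooth_of_derivatives[of "\<lambda>k t. \<mu> ^ k * exp (\<mu> * of_real t)", OF d]
  show "ex \<mu> \<in> S" using *(1) by (simp add: exp_monomial_0 cong: if_cong)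
  show "(D ^^ k) (ex \<mu>) = (\<lambda>t. \<mu> ^ k * ex \<mu> t)" using *(2)[of k] by (simp add: exp_monomial_0 fun_eq_iff cong: if_cong)
qed

lemma deriv_op_exp: "D (ex \<mu>) = (\<lambda>t. \<mu> * ex \<mu> t)"
  using deriv_op_pow_exp[of 1 \<mu>] by simp

section \<open>The initial value problem y' = l y + f\<close>

lemma primitive_exists:
  assumes "c \<in> E" "f \<in> S"
  shows "\<exists>y\<in>S. y c = 0 \<and> D y = (\<lambda>t. l * y t + f t)"
proof -
  have ab: "a < b" using assms(1) by (auto simp: einterval_def intro: less_trans)
  have "\<exists>F. \<forall>x :: real. a < x \<longrightarrow> x < b \<longrightarrow> (F has_vector_derivative (exp (- l * of_real x) * f x)) (at x)"
  proof (rule einterval_antiderivative[OF ab])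
    fix x :: real assume "a < x" "x < b"
    then have "x \<in> E" by (simp add: einterval_def)
    then have "isCont f x" using smooth_deriv[OF assms(2)] has_vector_derivative_continuous by blast
    then show "isCont (\<lambda>x. exp (- l * of_real x) * f x) x" by (intro continuous_intros)
  qed
  then obtain F where F: "\<And>x. x \<in> E \<Longrightarrow> (F has_vector_derivative (exp (- l * of_real x) * f x)) (at x)"
    by (auto simp: einterval_def)
  define y where "y = (\<lambda>t. if t \<in> E then exp (l * of_real t) * (F t - F c) else 0)"
  have d: "(y has_vector_derivative l * y t + f t) (at t)" if t: "t \<in> E" for t
  proof -
    have "((\<lambda>t. l * complex_of_real t) has_vector_derivative l) (at t)"
      by (auto intro!: derivative_eq_intros)
    from field_vector_diff_chain_at[OF this DERIV_exp]
    have e: "((\<lambda>t. exp (l * of_real t)) has_vector_derivative l * exp (l * of_real t)) (at t)" by (simp add: o_def)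
    have "((\<lambda>t. F t - F c) has_vector_derivative exp (- l * of_real t) * f t) (at t)"
      using F[OF t] by (auto intro!: derivative_eq_intros)
    from has_vector_derivative_mult[OF e this]
    have "((\<lambda>t. exp (l * of_real t) * (F t - F c)) has_vector_derivative l * y t + f t) (at t)"
      using t by (simp add: y_def algebra_simps flip: exp_add)
    then show ?thesis
      by (rule has_vector_derivative_transform_within_open[OF _ open_einterval t]) (simp add: y_def)
  qed
  have Dy: "D y = (\<lambda>t. l * y t + f t)"
  proof
    fix t show "D y t = l * y t + f t"
      using d deriv_op_eq smooth_outside[OF assms(2)] by (cases "t \<in> E") (auto simp: deriv_op_outside y_def)
  qed
  have "y \<in> S"
    by (rule smooth_of_deriv_op[OF _ _ Dy assms(2)]) (use d in \<open>auto simp: y_def intro: differentiableI_vector\<close>)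
  then show ?thesis using Dy by (intro bexI[of _ y]) (auto simp: y_def)
qed

lemma eigenfunction_unique:
  assumes "y \<in> S" "D y = (\<lambda>t. l * y t)" "c \<in> E"
  shows "y = (\<lambda>t. y c * exp (- l * of_real c) * ex l t)"
proof -
  define z where "z = (\<lambda>t. exp (- l * of_real t) * y t)"
  have "(z has_vector_derivative 0) (at t)" if t: "t \<in> E" for t
  proof -
    have "((\<lambda>t. - l * complex_of_real t) has_vector_derivative - l) (at t)"
      by (auto intro!: derivative_eq_intros)
    from field_vector_diff_chain_at[OF this DERIV_exp]
    have e: "((\<lambda>t. exp (- l * of_real t)) has_vector_derivative - l * exp (- l * of_real t)) (at t)" by (simp add: o_def)
    from has_vector_derivative_mult[OF e smooth_deriv[OF assms(1) t]] show ?thesis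
      by (simp add: z_def assms(2) algebra_simps)
  qed
  then have "(z has_derivative (\<lambda>_. 0)) (at t)" if "t \<in> E" for t
    using that by (simp add: has_vector_derivative_def)
  then have "z t = z c" if "t \<in> E" for t
    by (rule has_derivative_zero_unique_connected[OF open_einterval convex_connected[OF convex_einterval]])
       (use that assms(3) in auto)
  then have zc: "exp (l * of_real t) * z t = exp (l * of_real t) * z c" if "t \<in> E" for t using that by simp
  have yz: "exp (l * of_real t) * z t = y t" for t
  proof -
    have "exp (l * of_real t) * exp (- l * of_real t) = 1" by (simp flip: exp_add)
    then show ?thesis unfolding z_def by (metis mult.assoc mult_1)
  qed
  show ?thesis
  proof
    fix t show "y t = y c * exp (- l * of_real c) * ex l t"
    proof (cases "t \<in> E")
      case True
      then have "y t = exp (l * of_real t) * (exp (- l * of_real c) * y c)"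
        using zc yz[of t] by (simp only: z_def)
      then show ?thesis using True by (simp add: exp_monomial_0)
    qed (simp add: smooth_outside[OF assms(1)] exp_monomial_0)
  qed
qed

definition solve :: "real \<Rightarrow> complex \<Rightarrow> (real \<Rightarrow> complex) \<Rightarrow> real \<Rightarrow> complex" where
  "solve c l f = (SOME y. y \<in> S \<and> y c = 0 \<and> D y = (\<lambda>t. l * y t + f t))"

lemma solve:
  assumes "c \<in> E" "f \<in> S"
  shows "solve c l f \<in> S" "solve c l f c = 0" "D (solve c l f) = (\<lambda>t. l * solve c l f t + f t)"
  using someI_ex[of "\<lambda>y. y \<in> S \<and> y c = 0 \<and> D y = (\<lambda>t. l * y t + f t)"] primitive_exists[OF assms, of l]
  unfolding solve_def by blast+

lemma solve_general:
  assumes "c \<in> E" "f \<in> S" "y \<in> S" "D y = (\<lambda>t. l * y t + f t)"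
  shows "y = (\<lambda>t. (y c * exp (- l * of_real c)) * ex l t + solve c l f t)"
proof -
  define z where "z = (\<lambda>t. y t - solve c l f t)"
  note s = solve[OF assms(1,2), of l]
  have z: "z = (\<lambda>t. (- 1) * solve c l f t + y t)" by (simp add: z_def)
  have "z \<in> S" unfolding z by (intro smooth_lincomb s assms)
  moreover have "D z = (\<lambda>t. l * z t)"
    unfolding z smooth_deriv_op_lincomb[OF s(1) assms(3)] s(3) assms(4) by (auto simp: algebra_simps)
  ultimately have zeq: "z = (\<lambda>t. z c * exp (- l * of_real c) * ex l t)"
    by (rule eigenfunction_unique[OF _ _ assms(1)])
  have zc: "z c = y c" by (simp add: z_def s(2))
  show ?thesis
  proof
    fix t
    have "y t - solve c l f t = y c * exp (- l * of_real c) * ex l t"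
      using fun_cong[OF zeq, of t] unfolding zc by (simp only: z_def)
    then show "y t = (y c * exp (- l * of_real c)) * ex l t + solve c l f t" by (simp only: diff_eq_eq)
  qed
qed

lemma solve_unique:
  assumes "c \<in> E" "f \<in> S" "y \<in> S" "y c = 0" "D y = (\<lambda>t. l * y t + f t)"
  shows "y = solve c l f"
  using solve_general[OF assms(1-3,5)] assms(4) by simp

lemma solve_lincomb:
  assumes "c \<in> E" "f \<in> S" "g \<in> S"
  shows "solve c l (\<lambda>t. k * f t + g t) = (\<lambda>t. k * solve c l f t + solve c l g t)"
proof (rule sym, rule solve_unique[OF assms(1) smooth_lincomb[OF assms(2,3)]])
  note f = solve[OF assms(1,2), of l] and g = solve[OF assms(1,3), of l]
  show "(\<lambda>t. k * solve c l f t + solve c l g t) \<in> S" by (intro smooth_lincomb f g)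
  show "D (\<lambda>t. k * solve c l f t + solve c l g t) = (\<lambda>t. l * (k * solve c l f t + solve c l g t) + (k * f t + g t))"
    unfolding smooth_deriv_op_lincomb[OF f(1) g(1)] f(3) g(3) by (auto simp: algebra_simps)
  show "k * solve c l f c + solve c l g c = 0" using f g by simp
qed

text \<open>Hilbert's identity for the solution operators, obtained from uniqueness for the initial
  value problem with parameter \<open>l\<close>. It is the source of all holomorphy in
  \<open>l\<close> below.\<close>

lemma solve_resolvent:
  assumes "c \<in> E" "f \<in> S"
  shows "solve c l f t - solve c \<mu> f t = (l - \<mu>) * solve c l (solve c \<mu> f) t"
proof -
  note l = solve[OF assms, of l] and m = solve[OF assms, of \<mu>]
  note lm = solve[OF assms(1) m(1), of l]
  let ?y = "\<lambda>t. (l - \<mu>) * solve c l (solve c \<mu> f) t + solve c \<mu> f t"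
  have "?y = solve c l f"
  proof (rule solve_unique[OF assms])
    show "?y \<in> S" by (intro smooth_lincomb lm m)
    show "?y c = 0" using lm m by simp
    show "D ?y = (\<lambda>t. l * ?y t + f t)"
      unfolding smooth_deriv_op_lincomb[OF lm(1) m(1)] lm(3) m(3) by (auto simp: algebra_simps)
  qed
  then show ?thesis by (metis add_diff_cancel_right')
qed

text \<open>Variation of constants through the mean value inequality: the derivative of exp (l (t -
  s)) y s in s is exp (l (t - s)) f s. The constant \<open>K\<close> leaves the sign of Re l to the
  caller; for a suitable base point it is 1.\<close>

lemma solve_bound:
  assumes c: "c \<in> E" and f: "f \<in> S" and t: "t \<in> E"
    and "\<And>s. s \<in> closed_segment c t \<Longrightarrow> norm (f s) \<le> B"
    and "\<And>s. s \<in> closed_segment c t \<Longrightarrow> exp (Re l * (t - s)) \<le> K"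
  shows "norm (solve c l f t) \<le> K * B * \<bar>t - c\<bar>"
proof -
  note y = solve[OF c f, of l]
  define z where "z = (\<lambda>s. exp (l * of_real (t - s)) * solve c l f s)"
  have seg: "closed_segment c t \<subseteq> E" using convex_einterval c t by (simp add: closed_segment_subset)
  have d: "(z has_vector_derivative exp (l * of_real (t - s)) * f s) (at s)" if s: "s \<in> E" for s
  proof -
    have "((\<lambda>s. l * complex_of_real (t - s)) has_vector_derivative - l) (at s)"
      by (auto intro!: derivative_eq_intros)
    from field_vector_diff_chain_at[OF this DERIV_exp]
    have e: "((\<lambda>s. exp (l * of_real (t - s))) has_vector_derivative - l * exp (l * of_real (t - s))) (at s)" by (simp add: o_def)
    from has_vector_derivative_mult[OF e smooth_deriv[OF y(1) s]] show ?thesis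
      by (simp add: z_def y(3) algebra_simps)
  qed
  have "norm (z t - z c) \<le> (K * B) * norm (t - c)"
  proof (rule differentiable_bound[OF convex_closed_segment[of c t]])
    fix s assume s: "s \<in> closed_segment c t"
    show "(z has_derivative (\<lambda>h. h *\<^sub>R (exp (l * of_real (t - s)) * f s))) (at s within closed_segment c t)"
      using d[of s] s seg unfolding has_vector_derivative_def by (auto intro: has_derivative_at_withinI)
    have "norm (exp (l * of_real (t - s)) * f s) = exp (Re l * (t - s)) * norm (f s)" by (simp add: norm_mult)
    also have "\<dots> \<le> K * B"
      using order_trans[OF exp_ge_zero assms(5)[OF s]] assms(4,5)[OF s] by (intro mult_mono) auto
    finally have le: "norm (exp (l * of_real (t - s)) * f s) \<le> K * B" .
    show "onorm (\<lambda>h. h *\<^sub>R (exp (l * of_real (t - s)) * f s)) \<le> K * B"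
    proof (rule onorm_bound)
      show "0 \<le> K * B" using le norm_ge_zero order_trans by blast
      show "norm (h *\<^sub>R (exp (l * of_real (t - s)) * f s)) \<le> K * B * norm h" for h
        using mult_right_mono[OF le, of "norm h"] by (simp add: mult.commute)
    qed
  qed auto
  then show ?thesis using y(2) by (simp add: z_def)
qed

lemma deriv_op_pow_solve_bound:
  assumes c: "c \<in> E" and f: "f \<in> S" and "norm (solve c l f t) \<le> B0" "\<And>j. j < k \<Longrightarrow> norm ((D ^^ j) f t) \<le> B" "B \<ge> 0"
  shows "norm ((D ^^ k) (solve c l f) t) \<le> (1 + norm l) ^ k * (B0 + of_nat k * B)"
  using assms(4)
proof (induction k)
  case 0 then show ?case using assms by simp
next
  case (Suc k)
  note y = solve[OF c f, of l]
  have "(D ^^ Suc k) (solve c l f) t = l * (D ^^ k) (solve c l f) t + (D ^^ k) f t"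
    unfolding funpow_Suc_right o_def y(3) by (simp add: deriv_op_pow_lincomb y f)
  then have "norm ((D ^^ Suc k) (solve c l f) t) \<le> norm l * norm ((D ^^ k) (solve c l f) t) + norm ((D ^^ k) f t)"
    by (metis norm_mult norm_triangle_ineq)
  also have "\<dots> \<le> norm l * ((1 + norm l) ^ k * (B0 + of_nat k * B)) + B"
    using Suc by (intro add_mono mult_left_mono) auto
  also have "\<dots> \<le> (1 + norm l) ^ Suc k * (B0 + of_nat (Suc k) * B)"
  proof -
    have "B0 \<ge> 0" using assms(3) norm_ge_zero order_trans by blast
    have p: "1 \<le> (1 + norm l) ^ k" "1 \<le> (1 + norm l) ^ Suc k" by (rule one_le_power, simp)+
    have "norm l * ((1 + norm l) ^ k * (B0 + of_nat k * B)) \<le> (1 + norm l) * ((1 + norm l) ^ k * (B0 + of_nat k * B))"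
      using \<open>B0 \<ge> 0\<close> \<open>B \<ge> 0\<close> by (intro mult_right_mono mult_nonneg_nonneg) auto
    moreover have "1 * B \<le> (1 + norm l) ^ Suc k * B" using p \<open>B \<ge> 0\<close> by (intro mult_right_mono) auto
    ultimately show ?thesis by (simp add: algebra_simps)
  qed
  finally show ?case .
qed

section \<open>Continuous functionals and their transforms\<close>

lemma deriv_op_pow_zero: "(D ^^ k) (\<lambda>_. 0) = (\<lambda>_. 0)"
proof (induction k)
  case (Suc k)
  have "D (\<lambda>_. 0) = (\<lambda>_. 0)" by (auto simp: deriv_op_def)
  then show ?case by (simp add: Suc)
qed simp

lemma deriv_op_pow_scale:
  assumes "f \<in> S" shows "(D ^^ k) (\<lambda>t. c * f t) = (\<lambda>t. c * (D ^^ k) f t)"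
  using deriv_op_pow_lincomb[OF assms smooth_zero, where k = k and c = c] by (simp add: deriv_op_pow_zero)

lemma deriv_op_scale:
  assumes "f \<in> S" shows "D (\<lambda>t. c * f t) = (\<lambda>t. c * D f t)"
  using deriv_op_pow_scale[OF assms, where k = 1 and c = c] by simp

lemma deriv_op_pow_bounded:
  assumes "f \<in> S" "\<alpha> \<in> E" "\<beta> \<in> E"
  shows "\<exists>B. \<forall>k\<le>n. \<forall>t\<in>{\<alpha>..\<beta>}. norm ((D ^^ k) f t) \<le> B"
proof -
  have sub: "{\<alpha>..\<beta>} \<subseteq> E" using einterval_between[OF assms(2,3)] by auto
  have "\<exists>B. \<forall>t\<in>{\<alpha>..\<beta>}. norm ((D ^^ k) f t) \<le> B" for k
  proof -
    have "continuous_on {\<alpha>..\<beta>} ((D ^^ k) f)"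
      by (rule smooth_continuous[OF smooth_deriv_op_pow[OF assms(1)] sub])
    then have "bounded ((D ^^ k) f ` {\<alpha>..\<beta>})" by (intro compact_imp_bounded compact_continuous_image) auto
    then show ?thesis unfolding bounded_iff by blast
  qed
  then obtain B where B: "\<And>k t. t \<in> {\<alpha>..\<beta>} \<Longrightarrow> norm ((D ^^ k) f t) \<le> B k" by metis
  have "norm ((D ^^ k) f t) \<le> (\<Sum>j\<le>n. \<bar>B j\<bar>)" if "k \<le> n" "t \<in> {\<alpha>..\<beta>}" for k t
    using B[OF that(2), of k] member_le_sum[of k "{..n}" "\<lambda>j. \<bar>B j\<bar>"] that(1) by simp
  then show ?thesis by blast
qed

section \<open>Continuous functionals and their seminorm data\<close>

text \<open>Subbasic balls involve one order, one compact set and an arbitrary centre. Enlarging the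
  interval and taking all orders up to \<open>n\<close> makes the condition stable under
  intersection, and for a ball with another centre the margin left at the maximum over
  \<open>K\<close> serves as radius.\<close>

lemma smooth_topology_nbhd:
  assumes "a < b" and "openin (smooth_topology a b) U" "f \<in> U" "f \<in> S"
  shows "\<exists>\<alpha> \<beta> n e. \<alpha> \<in> E \<and> \<beta> \<in> E \<and> \<alpha> \<le> \<beta> \<and> e > 0 \<and>
    (\<forall>g\<in>S. (\<forall>k\<le>n. \<forall>t\<in>{\<alpha>..\<beta>}. norm ((D ^^ k) g t - (D ^^ k) f t) < e) \<longrightarrow> g \<in> U)"
proof -
  obtain c where c: "c \<in> E" using einterval_nonempty[OF \<open>a < b\<close>] by blast
  show ?thesis
    using assms(2)[unfolded smooth_topology_def openin_topology_generated_by_iff] assms(3)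
  proof induction
    case Empty then show ?case by simp
  next
    case (Int U V)
    then obtain \<alpha>1 \<beta>1 n1 e1 \<alpha>2 \<beta>2 n2 e2 where
      1: "\<alpha>1 \<in> E" "\<beta>1 \<in> E" "\<alpha>1 \<le> \<beta>1" "e1 > 0" "\<And>g. g \<in> S \<Longrightarrow> (\<forall>k\<le>n1. \<forall>t\<in>{\<alpha>1..\<beta>1}. norm ((D ^^ k) g t - (D ^^ k) f t) < e1) \<Longrightarrow> g \<in> U" and
      2: "\<alpha>2 \<in> E" "\<beta>2 \<in> E" "\<alpha>2 \<le> \<beta>2" "e2 > 0" "\<And>g. g \<in> S \<Longrightarrow> (\<forall>k\<le>n2. \<forall>t\<in>{\<alpha>2..\<beta>2}. norm ((D ^^ k) g t - (D ^^ k) f t) < e2) \<Longrightarrow> g \<in> V"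
      by blast
    show ?case
    proof (rule exI[of _ "min \<alpha>1 \<alpha>2"], rule exI[of _ "max \<beta>1 \<beta>2"], rule exI[of _ "max n1 n2"], rule exI[of _ "min e1 e2"],
        intro conjI ballI impI)
      fix g assume g: "g \<in> S" "\<forall>k\<le>max n1 n2. \<forall>t\<in>{min \<alpha>1 \<alpha>2..max \<beta>1 \<beta>2}. norm ((D ^^ k) g t - (D ^^ k) f t) < min e1 e2"
      have *: "norm ((D ^^ k) g t - (D ^^ k) f t) < min e1 e2"
        if "k \<le> max n1 n2" "t \<in> {min \<alpha>1 \<alpha>2..max \<beta>1 \<beta>2}" for k t
        using g(2) that by blast
      show "g \<in> U \<inter> V"
        by (intro IntI 1(5) 2(5) g(1) allI impI ballI) (auto intro!: less_le_trans[OF *])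
    qed (use 1 2 in \<open>auto simp: min_def max_def\<close>)
  next
    case (UN K)
    then obtain U where "U \<in> K" "f \<in> U" by blast
    from UN.IH[OF this] show ?case using \<open>U \<in> K\<close> by (meson UnionI)
  next
    case (Basis U)
    then obtain f0 K k e where U: "U = {g \<in> S. \<forall>t\<in>K. norm ((D ^^ k) g t - (D ^^ k) f0 t) < e}"
      and K: "f0 \<in> S" "compact K" "K \<subseteq> E" "e > 0" by blast
    show ?case
    \<comment> \<open>The subbase admits an empty compact set, which has no end points; an arbitrary
      point \<open>c\<close> stands in for them.\<close>
    proof (cases "K = {}")
      case True
      then show ?thesis using U c
        by (rule_tac exI[of _ c], rule_tac exI[of _ c], rule_tac exI[of _ 0], rule_tac exI[of _ 1]) auto
    next
      case False
      have cont: "continuous_on K (\<lambda>t. norm ((D ^^ k) f t - (D ^^ k) f0 t))"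
        using K assms(4) by (intro continuous_intros smooth_continuous[OF smooth_deriv_op_pow]) auto
      obtain t0 where t0: "t0 \<in> K" "\<And>t. t \<in> K \<Longrightarrow> norm ((D ^^ k) f t - (D ^^ k) f0 t) \<le> norm ((D ^^ k) f t0 - (D ^^ k) f0 t0)"
        using continuous_attains_sup[OF K(2) False cont] by blast
      define e' where "e' = e - norm ((D ^^ k) f t0 - (D ^^ k) f0 t0)"
      have "e' > 0" using Basis(2) t0(1) by (simp add: U e'_def)
      have bdd: "bounded K" "closed K" using K(2) by (auto simp: compact_eq_bounded_closed)
      then have InfSup: "Inf K \<in> K" "Sup K \<in> K"
        using False by (auto intro!: closed_contains_Inf closed_contains_Sup bounded_imp_bdd_below bounded_imp_bdd_above)
      have sub: "Inf K \<le> t" "t \<le> Sup K" if "t \<in> K" for t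
        using that bdd by (auto intro!: cInf_lower cSup_upper bounded_imp_bdd_below bounded_imp_bdd_above)
      show ?thesis
      proof (rule exI[of _ "Inf K"], rule exI[of _ "Sup K"], rule exI[of _ k], rule exI[of _ e'], intro conjI ballI impI)
        fix g assume g: "g \<in> S" "\<forall>j\<le>k. \<forall>t\<in>{Inf K..Sup K}. norm ((D ^^ j) g t - (D ^^ j) f t) < e'"
        have "norm ((D ^^ k) g t - (D ^^ k) f0 t) < e" if t: "t \<in> K" for t
        proof -
          have "norm ((D ^^ k) g t - (D ^^ k) f t) < e'" using g(2) sub[OF t] by auto
          moreover have "norm ((D ^^ k) g t - (D ^^ k) f0 t) \<le> norm ((D ^^ k) g t - (D ^^ k) f t) + norm ((D ^^ k) f t - (D ^^ k) f0 t)"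
            using norm_triangle_ineq[of "(D ^^ k) g t - (D ^^ k) f t" "(D ^^ k) f t - (D ^^ k) f0 t"] by simp
          ultimately show ?thesis using t0(2)[OF t] by (simp add: e'_def)
        qed
        then show "g \<in> U" using g(1) by (simp add: U)
      qed (use InfSup K sub \<open>e' > 0\<close> in auto)
    qed
  qed
qed

lemma topspace_smooth_topology: "topspace (smooth_topology a b) = S"
proof -
  have "f \<in> \<Union>{{g \<in> S. \<forall>t\<in>K. norm ((D ^^ k) g t - (D ^^ k) f t) < e} | f K k e. f \<in> S \<and> compact K \<and> K \<subseteq> E \<and> e > 0}"
    if "f \<in> S" for f
    using that by (intro UnionI[of "{g \<in> S. \<forall>t\<in>{}. norm ((D ^^ 0) g t - (D ^^ 0) f t) < 1}"] CollectI exI[of _ f] exI[of _ "{}"] exI[of _ 0] exI[of _ 1]) auto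
  then show ?thesis unfolding smooth_topology_def topology_generated_by_topspace by blast
qed

text \<open>Continuity together with its data: a distribution supported in [\<alpha>, \<beta>] of
  order at most n. The order becomes the degree of the polynomial bounds on the transforms, and the
  interval governs their exponential growth.\<close>

definition functional :: "real \<Rightarrow> real \<Rightarrow> nat \<Rightarrow> real \<Rightarrow> ((real \<Rightarrow> complex) \<Rightarrow> complex) \<Rightarrow> bool" where
  "functional \<alpha> \<beta> n C u \<longleftrightarrow> \<alpha> \<in> E \<and> \<beta> \<in> E \<and> \<alpha> \<le> \<beta> \<and> C \<ge> 0 \<and>
     (\<forall>f\<in>S. \<forall>g\<in>S. \<forall>c. u (\<lambda>t. c * f t + g t) = c * u f + u g) \<and>
     (\<forall>f\<in>S. \<forall>B. (\<forall>k\<le>n. \<forall>t\<in>{\<alpha>..\<beta>}. norm ((D ^^ k) f t) \<le> B) \<longrightarrow> norm (u f) \<le> C * B)"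

definition annihilator :: "(real \<Rightarrow> complex) set \<Rightarrow> ((real \<Rightarrow> complex) \<Rightarrow> complex) set" where
  "annihilator L = {u. (\<exists>\<alpha> \<beta> n C. functional \<alpha> \<beta> n C u) \<and> (\<forall>g\<in>L. u g = 0)}"

lemma functional_interval: "functional \<alpha> \<beta> n C u \<Longrightarrow> t \<in> {\<alpha>..\<beta>} \<Longrightarrow> t \<in> E"
  by (auto simp: functional_def intro: einterval_between)

lemma functional_lincomb:
  "functional \<alpha> \<beta> n C u \<Longrightarrow> f \<in> S \<Longrightarrow> g \<in> S \<Longrightarrow> u (\<lambda>t. c * f t + g t) = c * u f + u g"
  by (simp add: functional_def)

lemma functional_zero: "functional \<alpha> \<beta> n C u \<Longrightarrow> u (\<lambda>_. 0) = 0"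
  using functional_lincomb[of \<alpha> \<beta> n C u "\<lambda>_. 0" "\<lambda>_. 0" 1] smooth_zero by simp

lemma functional_scale:
  "functional \<alpha> \<beta> n C u \<Longrightarrow> f \<in> S \<Longrightarrow> u (\<lambda>t. c * f t) = c * u f"
  using functional_lincomb[of \<alpha> \<beta> n C u f "\<lambda>_. 0" c] smooth_zero functional_zero by simp

lemma functional_diff:
  "functional \<alpha> \<beta> n C u \<Longrightarrow> f \<in> S \<Longrightarrow> g \<in> S \<Longrightarrow> u (\<lambda>t. f t - g t) = u f - u g"
  using functional_lincomb[of \<alpha> \<beta> n C u g f "- 1"] by simp

lemma functional_bound:
  assumes "functional \<alpha> \<beta> n C u" "f \<in> S" "\<And>k t. k \<le> n \<Longrightarrow> t \<in> {\<alpha>..\<beta>} \<Longrightarrow> norm ((D ^^ k) f t) \<le> B"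
  shows "norm (u f) \<le> C * B"
  using assms unfolding functional_def by blast

lemma functional_enlarge:
  assumes "functional \<alpha> \<beta> n C u" "\<alpha>' \<in> E" "\<beta>' \<in> E" "\<alpha>' \<le> \<alpha>" "\<beta> \<le> \<beta>'"
  shows "functional \<alpha>' \<beta>' n C u"
  using assms unfolding functional_def by auto

lemma subspace_closed:
  assumes "cfun.subspace L"
  shows "(\<lambda>_. 0) \<in> L" "f \<in> L \<Longrightarrow> g \<in> L \<Longrightarrow> (\<lambda>t. c * f t + g t) \<in> L"
proof -
  show "(\<lambda>_. 0) \<in> L" using cfun.subspace_0[OF assms] by (simp add: zero_fun_def)
  show "(\<lambda>t. c * f t + g t) \<in> L" if "f \<in> L" "g \<in> L"
    using cfun.subspace_add[OF assms cfun.subspace_scale[OF assms that(1), of c] that(2)] by (simp add: plus_fun_def)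
qed

text \<open>Hahn-Banach for the seminorm \<open>p\<close> of a neighbourhood of f that misses
  \<open>L\<close>. Written as an infimum of admissible bounds, \<open>p\<close> is sublinear
  without a discussion of attained suprema. Interval and order of the neighbourhood become those of
  the functional, and its real and imaginary parts account for the constant 2.\<close>

lemma annihilator_separates:
  assumes "a < b" and L: "cfun.subspace L" "closedin (smooth_topology a b) L" and f: "f \<in> S" "f \<notin> L"
  shows "\<exists>u\<in>annihilator L. u f \<noteq> 0"
proof -
  have LS: "L \<subseteq> S" using closedin_subset[OF L(2)] by (simp add: topspace_smooth_topology)
  have "openin (smooth_topology a b) (S - L)"
    using L(2) by (simp add: closedin_def topspace_smooth_topology)
  from smooth_topology_nbhd[OF \<open>a < b\<close> this _ f(1)] f
  obtain \<alpha> \<beta> n e where ab: "\<alpha> \<in> E" "\<beta> \<in> E" "\<alpha> \<le> \<beta>" "e > 0" and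
    sep: "\<And>g. g \<in> S \<Longrightarrow> (\<forall>k\<le>n. \<forall>t\<in>{\<alpha>..\<beta>}. norm ((D ^^ k) g t - (D ^^ k) f t) < e) \<Longrightarrow> g \<notin> L"
    by blast
  interpret S: complex_function_space S
    by unfold_locales (auto simp: plus_fun_def cscale_def zero_fun_def intro: smooth_add smooth_scale smooth_zero)
  have Lspace: "complex_function_space L"
    using cfun.subspace_add[OF L(1)] cfun.subspace_scale[OF L(1)] cfun.subspace_0[OF L(1)]
    by unfold_locales (auto simp: cscale_def)
  define P where "P = (\<lambda>x. {B. \<forall>k\<le>n. \<forall>t\<in>{\<alpha>..\<beta>}. norm ((D ^^ k) x t) \<le> B})"
  have P_nonneg: "B \<ge> 0" if "B \<in> P x" for B x
  proof -
    have "norm ((D ^^ 0) x \<alpha>) \<le> B" using that ab(3) unfolding P_def by force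
    then show ?thesis using norm_ge_zero order_trans by blast
  qed
  have P_ne: "P x \<noteq> {}" if "x \<in> S" for x
    using deriv_op_pow_bounded[OF that ab(1,2)] by (auto simp: P_def)
  have P_bdd: "bdd_below (P x)" for x using P_nonneg by (intro bdd_belowI) blast
  have pow_add: "(D ^^ k) (x + y) t = (D ^^ k) x t + (D ^^ k) y t" if "x \<in> S" "y \<in> S" for k x y t
    using deriv_op_pow_lincomb[OF that, where k = k and c = 1] by (simp add: plus_fun_def)
  have pow_scale: "(D ^^ k) (cscale c x) t = c * (D ^^ k) x t" if "x \<in> S" for k x c t
    using deriv_op_pow_scale[OF that] by (simp add: cscale_def)
  define p where "p = (\<lambda>x. if x \<in> S then Inf (P x) else 0)"
  have p: "S.sublinear p" unfolding p_def
  proof (rule S.sublinear_Inf)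
    fix x y u v assume "x \<in> S" "y \<in> S" "u \<in> P x" "v \<in> P y"
    then have "u + v \<in> P (x + y)" unfolding P_def by (auto simp: pow_add intro: norm_triangle_mono)
    then show "\<exists>w\<in>P (x + y). w \<le> u + v" by blast
  next
    fix x u and r :: real assume "x \<in> S" "r > 0" "u \<in> P x"
    then have "r * u \<in> P (cscale (of_real r) x)" unfolding P_def by (auto simp: pow_scale norm_mult)
    then show "\<exists>w\<in>P (cscale (of_real r) x). w \<le> r * u" by blast
  qed (use P_ne P_bdd in auto)
  have p_nonneg: "p x \<ge> 0" if "x \<in> S" for x
    using that P_ne[OF that] P_nonneg by (auto simp: p_def intro!: cInf_greatest)
  have p_le: "p x \<le> B" if "x \<in> S" "B \<in> P x" for x B
    using that P_bdd by (auto simp: p_def intro!: cInf_lower)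
  have p_sep: "p (f + g) \<ge> e" if g: "g \<in> L" for g
  proof -
    have "f + g \<in> S" using f g LS by (auto intro: S.add)
    have "- g \<in> L" using complex_function_space.minus[OF Lspace g] .
    have "\<not> (\<forall>k\<le>n. \<forall>t\<in>{\<alpha>..\<beta>}. norm ((D ^^ k) (- g) t - (D ^^ k) f t) < e)"
      using sep[of "- g"] \<open>- g \<in> L\<close> LS by blast
    then obtain k t where kt: "k \<le> n" "t \<in> {\<alpha>..\<beta>}" "norm ((D ^^ k) (- g) t - (D ^^ k) f t) \<ge> e" by (auto simp: not_less)
    have gS: "g \<in> S" using g LS by blast
    have "(D ^^ k) (- g) t = - (D ^^ k) g t" using pow_scale[OF gS, where k = k and c = "- 1" and t = t] by simp
    moreover have "norm ((D ^^ k) (f + g) t) = norm (- (D ^^ k) g t - (D ^^ k) f t)"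
      unfolding pow_add[OF f(1) gS] by (subst norm_minus_cancel[symmetric]) simp
    ultimately have "norm ((D ^^ k) (f + g) t) \<ge> e" using kt(3) by simp
    then have "e \<le> B" if "B \<in> P (f + g)" for B using that kt unfolding P_def by fastforce
    then show ?thesis using \<open>f + g \<in> S\<close> P_ne[of "f + g"] by (auto simp: p_def intro!: cInf_greatest)
  qed
  obtain u where u: "\<And>x y c. x \<in> S \<Longrightarrow> y \<in> S \<Longrightarrow> u (cscale c x + y) = c * u x + u y" "\<And>g. g \<in> L \<Longrightarrow> u g = 0" "u f \<noteq> 0"
    "\<And>x. x \<in> S \<Longrightarrow> norm (u x) \<le> max (p x) (p (- x)) + max (p (cscale \<i> x)) (p (- cscale \<i> x))"
    using S.separating_functional[OF p p_nonneg LS Lspace f(1) p_sep ab(4)] by blast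
  have "functional \<alpha> \<beta> n 2 u" unfolding functional_def
  proof (intro conjI ballI allI impI)
    fix x y c assume "x \<in> S" "y \<in> S"
    then show "u (\<lambda>t. c * x t + y t) = c * u x + u y" using u(1)[of x y c] by (simp add: cscale_def plus_fun_def)
  next
    fix x B assume x: "x \<in> S" and B: "\<forall>k\<le>n. \<forall>t\<in>{\<alpha>..\<beta>}. norm ((D ^^ k) x t) \<le> B"
    have "p (cscale c x) \<le> B" if "norm c = 1" for c
      by (rule p_le) (use x B that in \<open>auto simp: P_def pow_scale norm_mult intro: S.scale\<close>)
    from this[of 1] this[of "- 1"] this[of \<i>] this[of "- \<i>"] show "norm (u x) \<le> 2 * B" using u(4)[OF x] by auto
  qed (use ab in auto)
  then have "u \<in> annihilator L" using u(2) unfolding annihilator_def by blast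
  then show ?thesis using u(3) by blast
qed

section \<open>Transforms of functionals\<close>

text \<open>The Fourier-Laplace transform of \<open>u\<close>.\<close>

definition hat :: "((real \<Rightarrow> complex) \<Rightarrow> complex) \<Rightarrow> complex \<Rightarrow> complex" where
  "hat u l = u (ex l)"

text \<open>The solution that vanishes at \<open>c\<close> exists for every \<open>l\<close> and
  depends on it holomorphically, unlike the resolvent on an invariant subspace, from which it
  differs by a multiple of the exponential.\<close>

definition resp :: "((real \<Rightarrow> complex) \<Rightarrow> complex) \<Rightarrow> real \<Rightarrow> (real \<Rightarrow> complex) \<Rightarrow> complex \<Rightarrow> complex" where
  "resp u c f l = u (solve c l f)"

lemma hat_bound:
  assumes u: "functional \<alpha> \<beta> n C u" and K: "\<And>t. t \<in> {\<alpha>..\<beta>} \<Longrightarrow> exp (Re l * t) \<le> K"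
  shows "norm (hat u l) \<le> C * (1 + norm l) ^ n * K"
proof -
  have "norm (u (ex l)) \<le> C * ((1 + norm l) ^ n * K)"
  proof (rule functional_bound[OF u smooth_exp])
    fix k t assume kt: "k \<le> n" "t \<in> {\<alpha>..\<beta>}"
    have "norm ((D ^^ k) (ex l) t) = norm l ^ k * exp (Re l * t)"
      unfolding deriv_op_pow_exp using functional_interval[OF u kt(2)] by (simp add: exp_monomial_0 norm_mult norm_power)
    also have "\<dots> \<le> (1 + norm l) ^ n * K"
    proof (rule mult_mono)
      have "norm l ^ k \<le> (1 + norm l) ^ k" by (rule power_mono) auto
      also have "\<dots> \<le> (1 + norm l) ^ n" using kt by (intro power_increasing) auto
      finally show "norm l ^ k \<le> (1 + norm l) ^ n" .
    qed (use K[OF kt(2)] in auto)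
    finally show "norm ((D ^^ k) (ex l) t) \<le> (1 + norm l) ^ n * K" .
  qed
  then show ?thesis by (simp add: hat_def mult.assoc)
qed

lemma resp_bound:
  assumes u: "functional \<alpha> \<beta> n C u" and f: "f \<in> S" and c: "c \<in> {\<alpha>..\<beta>}"
    and K: "\<And>t s. t \<in> {\<alpha>..\<beta>} \<Longrightarrow> s \<in> closed_segment c t \<Longrightarrow> exp (Re l * (t - s)) \<le> K"
    and B: "\<forall>k\<le>n. \<forall>t\<in>{\<alpha>..\<beta>}. norm ((D ^^ k) f t) \<le> B"
  shows "norm (resp u c f l) \<le> C * (1 + norm l) ^ n * (K * B * (\<beta> - \<alpha>) + of_nat n * B)"
proof -
  have cE: "c \<in> E" using functional_interval[OF u c] .
  have "norm ((D ^^ 0) f c) \<le> B" using B c by blast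
  then have "B \<ge> 0" using norm_ge_zero order_trans by blast
  have "exp (Re l * (c - c)) \<le> K" by (rule K) (use c in auto)
  then have "K \<ge> 0" by simp
  have "norm (u (solve c l f)) \<le> C * ((1 + norm l) ^ n * (K * B * (\<beta> - \<alpha>) + of_nat n * B))"
  proof (rule functional_bound[OF u solve(1)[OF cE f]])
    fix k t assume kt: "k \<le> n" "t \<in> {\<alpha>..\<beta>}"
    have seg: "s \<in> {\<alpha>..\<beta>}" if "s \<in> closed_segment c t" for s
      using that c kt by (auto simp: closed_segment_eq_real_ivl split: if_splits)
    have "norm (solve c l f t) \<le> K * B * \<bar>t - c\<bar>"
      by (rule solve_bound[OF cE f functional_interval[OF u kt(2)]]) (use B seg K[OF kt(2)] in \<open>auto dest: spec[of _ 0]\<close>)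
    also have "\<dots> \<le> K * B * (\<beta> - \<alpha>)"
      using c kt \<open>B \<ge> 0\<close> \<open>K \<ge> 0\<close> by (intro mult_left_mono) auto
    finally have "norm ((D ^^ k) (solve c l f) t) \<le> (1 + norm l) ^ k * (K * B * (\<beta> - \<alpha>) + of_nat k * B)"
      by (rule deriv_op_pow_solve_bound[OF cE f]) (use B kt \<open>B \<ge> 0\<close> in auto)
    also have "\<dots> \<le> (1 + norm l) ^ n * (K * B * (\<beta> - \<alpha>) + of_nat n * B)"
      using kt c \<open>B \<ge> 0\<close> \<open>K \<ge> 0\<close> by (intro mult_mono power_increasing add_left_mono mult_right_mono) auto
    finally show "norm ((D ^^ k) (solve c l f) t) \<le> (1 + norm l) ^ n * (K * B * (\<beta> - \<alpha>) + of_nat n * B)" .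
  qed
  then show ?thesis by (simp add: resp_def mult.assoc)
qed

lemma resp_locally_bounded:
  assumes u: "functional \<alpha> \<beta> n C u" and f: "f \<in> S" and c: "c \<in> {\<alpha>..\<beta>}"
  shows "\<exists>M. \<forall>l. norm (l - m) < 1 \<longrightarrow> norm (resp u c f l) \<le> M"
proof -
  have ab: "\<alpha> \<in> E" "\<beta> \<in> E" "C \<ge> 0" "\<alpha> \<le> \<beta>" using u by (auto simp: functional_def)
  obtain B where B: "\<forall>k\<le>n. \<forall>t\<in>{\<alpha>..\<beta>}. norm ((D ^^ k) f t) \<le> B" using deriv_op_pow_bounded[OF f ab(1,2)] by blast
  have "norm ((D ^^ 0) f c) \<le> B" using B c by blast
  then have "B \<ge> 0" using norm_ge_zero order_trans by blast
  define r where "r = norm m + 1"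
  have "norm (resp u c f l) \<le> C * (1 + r) ^ n * (exp (r * (\<beta> - \<alpha>)) * B * (\<beta> - \<alpha>) + of_nat n * B)" if "norm (l - m) < 1" for l
  proof -
    have l: "norm l \<le> r" using that norm_triangle_ineq2[of l m] by (simp add: r_def)
    have "norm (resp u c f l) \<le> C * (1 + norm l) ^ n * (exp (r * (\<beta> - \<alpha>)) * B * (\<beta> - \<alpha>) + of_nat n * B)"
    proof (rule resp_bound[OF u f c _ B])
      fix t s assume ts: "t \<in> {\<alpha>..\<beta>}" "s \<in> closed_segment c t"
      then have "\<bar>t - s\<bar> \<le> \<beta> - \<alpha>" using c by (auto simp: closed_segment_eq_real_ivl split: if_splits)
      then have "\<bar>Re l\<bar> * \<bar>t - s\<bar> \<le> r * (\<beta> - \<alpha>)"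
        using l abs_Re_le_cmod[of l] by (intro mult_mono) auto
      then have "Re l * (t - s) \<le> r * (\<beta> - \<alpha>)" by (metis abs_ge_self abs_mult order_trans)
      then show "exp (Re l * (t - s)) \<le> exp (r * (\<beta> - \<alpha>))" by simp
    qed
    also have "\<dots> \<le> C * (1 + r) ^ n * (exp (r * (\<beta> - \<alpha>)) * B * (\<beta> - \<alpha>) + of_nat n * B)"
      using l ab \<open>B \<ge> 0\<close> by (intro mult_right_mono mult_left_mono power_mono) auto
    finally show ?thesis .
  qed
  then show ?thesis by blast
qed

text \<open>Two applications of \<open>solve_resolvent\<close> isolate a first-order term; the
  remainder is again a response and hence locally bounded.\<close>

lemma resp_has_derivative:
  assumes u: "functional \<alpha> \<beta> n C u" and f: "f \<in> S" and c: "c \<in> {\<alpha>..\<beta>}"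
  shows "(resp u c f has_field_derivative resp u c (solve c m f) m) (at m)"
proof -
  have cE: "c \<in> einterval a b" using functional_interval[OF u c] .
  have res: "resp u c g l - resp u c g m = (l - m) * resp u c (solve c m g) l" if g: "g \<in> S" for g l
  proof -
    have "resp u c g l - resp u c g m = u (\<lambda>t. solve c l g t - solve c m g t)"
      unfolding resp_def by (rule functional_diff[OF u, symmetric]) (intro solve cE g)+
    also have "\<dots> = u (\<lambda>t. (l - m) * solve c l (solve c m g) t)" using solve_resolvent[OF cE g] by simp
    also have "\<dots> = (l - m) * resp u c (solve c m g) l"
      unfolding resp_def by (rule functional_scale[OF u]) (intro solve cE g)+
    finally show ?thesis .
  qed
  have s1: "solve c m f \<in> S" and s2: "solve c m (solve c m f) \<in> S" by (intro solve cE f)+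
  obtain B where B: "\<And>l. norm (l - m) < 1 \<Longrightarrow> norm (resp u c (solve c m (solve c m f)) l) \<le> B"
    using resp_locally_bounded[OF u s2 c] by blast
  show ?thesis
  proof (rule has_field_derivative_quadratic[OF _ B])
    fix l
    have "resp u c (solve c m f) l = resp u c (solve c m f) m + (l - m) * resp u c (solve c m (solve c m f)) l"
      using res[OF s1, of l] by (metis add.commute diff_add_cancel)
    then show "resp u c f l - resp u c f m = (l - m) * (resp u c (solve c m f) m + (l - m) * resp u c (solve c m (solve c m f)) l)"
      using res[OF f, of l] by (simp only:)
  qed
qed

lemma resp_holomorphic:
  "functional \<alpha> \<beta> n C u \<Longrightarrow> f \<in> S \<Longrightarrow> c \<in> {\<alpha>..\<beta>} \<Longrightarrow> resp u c f holomorphic_on UNIV"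
  unfolding holomorphic_on_open[OF open_UNIV] using resp_has_derivative by blast

lemma exp_monomial_1:
  shows "exp_monomial a b 1 m \<in> S"
    and "deriv_op a b (exp_monomial a b 1 m) = (\<lambda>t. m * exp_monomial a b 1 m t + exp_monomial a b 0 m t)"
proof -
  have d: "(exp_monomial a b 1 m has_vector_derivative m * exp_monomial a b 1 m t + exp_monomial a b 0 m t) (at t)"
    if t: "t \<in> einterval a b" for t
  proof -
    have "((\<lambda>t. m * complex_of_real t) has_vector_derivative m) (at t)"
      by (auto intro!: derivative_eq_intros)
    from field_vector_diff_chain_at[OF this DERIV_exp]
    have e: "((\<lambda>t. exp (m * of_real t)) has_vector_derivative m * exp (m * of_real t)) (at t)" by (simp add: o_def)
    have "(complex_of_real has_vector_derivative 1) (at t)" by (auto intro!: derivative_eq_intros)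
    from has_vector_derivative_mult[OF this e]
    have "((\<lambda>t. of_real t * exp (m * of_real t)) has_vector_derivative m * exp_monomial a b 1 m t + exp_monomial a b 0 m t) (at t)"
      using t by (simp add: exp_monomial_def algebra_simps)
    then show ?thesis
      by (rule has_vector_derivative_transform_within_open[OF _ open_einterval t]) (simp add: exp_monomial_def)
  qed
  show D: "deriv_op a b (exp_monomial a b 1 m) = (\<lambda>t. m * exp_monomial a b 1 m t + exp_monomial a b 0 m t)"
  proof
    fix t show "deriv_op a b (exp_monomial a b 1 m) t = m * exp_monomial a b 1 m t + exp_monomial a b 0 m t"
      using d deriv_op_eq by (cases "t \<in> einterval a b") (auto simp: deriv_op_outside exp_monomial_def)
  qed
  show "exp_monomial a b 1 m \<in> S"
    by (rule smooth_of_deriv_op[OF _ _ D smooth_exp]) (use d in \<open>auto simp: exp_monomial_def intro: differentiableI_vector\<close>)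
qed

text \<open>Normalised to 1 at \<open>c\<close>, two exponentials differ by a solution that vanishes
  at \<open>c\<close>, so the resolvent argument applies to them as well. The derivative at
  \<open>m\<close> comes from the solution with right-hand side \<open>h m\<close>, which is (t - c)
  exp (m (t - c)); undoing the normalisation leaves t exp (m t).\<close>

lemma hat_has_derivative:
  assumes u: "functional \<alpha> \<beta> n C u"
  shows "(hat u has_field_derivative u (exp_monomial a b 1 m)) (at m)"
proof -
  define c where "c = \<alpha>"
  have c: "c \<in> {\<alpha>..\<beta>}" using u by (auto simp: functional_def c_def)
  have cE: "c \<in> einterval a b" using functional_interval[OF u c] .
  define h where "h = (\<lambda>l t. exp (- l * of_real c) * exp_monomial a b 0 l t)"
  have h: "h l \<in> S" "deriv_op a b (h l) = (\<lambda>t. l * h l t)" "h l c = 1" for l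
  proof -
    show "h l \<in> S" unfolding h_def by (intro smooth_scale smooth_exp)
    show "deriv_op a b (h l) = (\<lambda>t. l * h l t)"
      unfolding h_def deriv_op_scale[OF smooth_exp] deriv_op_exp by (simp add: fun_eq_iff)
    show "h l c = 1" using cE by (simp add: h_def exp_monomial_0 flip: exp_add)
  qed
  have hdiff: "(\<lambda>t. h l t - h m t) = (\<lambda>t. (l - m) * solve c l (h m) t)" for l
  proof -
    have "(\<lambda>t. (- 1) * h m t + h l t) = solve c l (\<lambda>t. (l - m) * h m t)"
    proof (rule solve_unique[OF cE])
      show "deriv_op a b (\<lambda>t. (- 1) * h m t + h l t) = (\<lambda>t. l * ((- 1) * h m t + h l t) + (l - m) * h m t)"
        unfolding smooth_deriv_op_lincomb[OF h(1) h(1)] h(2) by (auto simp: algebra_simps)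
      show "(\<lambda>t. (- 1) * h m t + h l t) \<in> S" "(\<lambda>t. (l - m) * h m t) \<in> S"
        by (intro smooth_lincomb smooth_scale h)+
    qed (simp add: h)
    also have "\<dots> = (\<lambda>t. (l - m) * solve c l (h m) t)"
    proof -
      have "solve c l (\<lambda>_. 0) = (\<lambda>_. 0)"
        by (rule solve_unique[OF cE smooth_zero smooth_zero, symmetric]) (auto simp: deriv_op_def)
      then show ?thesis using solve_lincomb[OF cE h(1) smooth_zero, of l "l - m"] by simp
    qed
    finally show ?thesis by simp
  qed
  have hm: "solve c m (h m) \<in> S" by (intro solve cE h)
  obtain B where B: "\<And>l. norm (l - m) < 1 \<Longrightarrow> norm (resp u c (solve c m (h m)) l) \<le> B"
    using resp_locally_bounded[OF u hm c] by blast
  have "((\<lambda>l. u (h l)) has_field_derivative resp u c (h m) m) (at m)"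
  proof (rule has_field_derivative_quadratic[OF _ B])
    fix l
    have "u (h l) - u (h m) = u (\<lambda>t. h l t - h m t)" by (rule functional_diff[OF u, symmetric]) (rule h)+
    also have "\<dots> = (l - m) * resp u c (h m) l"
      unfolding hdiff resp_def by (rule functional_scale[OF u]) (intro solve cE h)
    also have "resp u c (h m) l = resp u c (h m) m + (l - m) * resp u c (solve c m (h m)) l"
    proof -
      have "resp u c (h m) l - resp u c (h m) m = u (\<lambda>t. solve c l (h m) t - solve c m (h m) t)"
        unfolding resp_def by (rule functional_diff[OF u, symmetric]) (intro solve cE h)+
      also have "\<dots> = u (\<lambda>t. (l - m) * solve c l (solve c m (h m)) t)" using solve_resolvent[OF cE h(1)] by simp
      also have "\<dots> = (l - m) * resp u c (solve c m (h m)) l"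
        unfolding resp_def by (rule functional_scale[OF u]) (intro solve cE h)+
      finally show ?thesis by (simp add: algebra_simps)
    qed
    finally show "u (h l) - u (h m) = (l - m) * (resp u c (h m) m + (l - m) * resp u c (solve c m (h m)) l)" .
  qed
  moreover have "((\<lambda>l. exp (l * of_real c)) has_field_derivative of_real c * exp (m * of_real c)) (at m)"
    by (auto intro!: derivative_eq_intros)
  ultimately have "((\<lambda>l. u (h l) * exp (l * of_real c)) has_field_derivative
      resp u c (h m) m * exp (m * of_real c) + of_real c * exp (m * of_real c) * u (h m)) (at m)"
    by (rule DERIV_mult[THEN DERIV_cong]) simp
  moreover have "u (h l) * exp (l * of_real c) = hat u l" for l
    unfolding h_def hat_def functional_scale[OF u smooth_exp] by (simp flip: exp_add)
  moreover have "resp u c (h m) m * exp (m * of_real c) + of_real c * exp (m * of_real c) * u (h m) = u (exp_monomial a b 1 m)"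
  proof -
    let ?y = "\<lambda>t. (- of_real c) * h m t + exp (- m * of_real c) * exp_monomial a b 1 m t"
    have ys: "(\<lambda>t. exp (- m * of_real c) * exp_monomial a b 1 m t) \<in> S" by (intro smooth_scale exp_monomial_1)
    have Dys: "deriv_op a b (\<lambda>t. exp (- m * of_real c) * exp_monomial a b 1 m t) = (\<lambda>t. exp (- m * of_real c) * (m * exp_monomial a b 1 m t + exp_monomial a b 0 m t))"
      unfolding deriv_op_scale[OF exp_monomial_1(1)] exp_monomial_1(2) ..
    have "?y = solve c m (h m)"
    proof (rule solve_unique[OF cE h(1)])
      show "?y \<in> S" by (intro smooth_lincomb h ys)
      show "?y c = 0" using cE h(3)[of m] by (simp add: exp_monomial_def flip: exp_add)
      show "deriv_op a b ?y = (\<lambda>t. m * ?y t + h m t)"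
        unfolding smooth_deriv_op_lincomb[OF h(1) ys] h(2) Dys by (auto simp: h_def algebra_simps)
    qed
    then have "resp u c (h m) m = (- of_real c) * u (h m) + exp (- m * of_real c) * u (exp_monomial a b 1 m)"
      unfolding resp_def using functional_lincomb[OF u h(1) ys] functional_scale[OF u exp_monomial_1(1)] by metis
    then have "resp u c (h m) m * exp (m * of_real c) + of_real c * exp (m * of_real c) * u (h m)
        = (exp (- m * of_real c) * exp (m * of_real c)) * u (exp_monomial a b 1 m)"
    proof -
      have "X * K + d * K * Y = (e * K) * Z" if "X = (- d) * Y + e * Z" for X Y Z d e K :: complex
        unfolding that by (simp add: algebra_simps)
      then show ?thesis using \<open>resp u c (h m) m = _\<close> by blast
    qed
    moreover have "exp (- m * of_real c) * exp (m * of_real c) = 1" by (simp flip: exp_add)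
    ultimately show ?thesis by (simp only: mult_1)
  qed
  ultimately show ?thesis by simp
qed

lemma hat_holomorphic: "functional \<alpha> \<beta> n C u \<Longrightarrow> hat u holomorphic_on UNIV"
  unfolding holomorphic_on_open[OF open_UNIV] using hat_has_derivative by blast

text \<open>Solutions with different initial points differ by a multiple of the exponential. The
  change matters because the two half-planes call for different ends of the interval.\<close>

lemma resp_base_change:
  assumes u: "functional \<alpha> \<beta> n C u" and f: "f \<in> S" and c: "c \<in> einterval a b" "c' \<in> einterval a b"
  shows "resp u c f l = (solve c l f c' * exp (- l * of_real c')) * hat u l + resp u c' f l"
proof -
  have s: "solve c' l f \<in> S" by (intro solve c f)
  show ?thesis unfolding resp_def hat_def
    by (subst solve_general[OF c(2) f solve(1)[OF c(1) f] solve(3)[OF c(1) f]], rule functional_lincomb[OF u smooth_exp s])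
qed

section \<open>Cutoff functions and one-sided bounds\<close>

lemma smooth_flat:
  assumes "r = 1 \<or> r = - 1"
  shows "(\<lambda>t. if t \<in> E then of_real (flat 1 (r * t - p)) else 0) \<in> S"
proof -
  define P where "P = (\<lambda>k. ((\<lambda>P. [:0, 0, 1:] * (P - pderiv P)) ^^ k) (1 :: real poly))"
  have "((\<lambda>t. complex_of_real (r ^ k * flat (P k) (r * t - p))) has_vector_derivative
      complex_of_real (r ^ Suc k * flat (P (Suc k)) (r * t - p))) (at t)" for k t
  proof -
    have P: "P (Suc k) = [:0, 0, 1:] * (P k - pderiv (P k))" by (simp add: P_def)
    have "((\<lambda>t. r * t - p) has_real_derivative r) (at t)" by (auto intro!: derivative_eq_intros)
    from DERIV_cmult[OF DERIV_chain2[OF flat_deriv[of "P k"] this], of "r ^ k"]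
    have "((\<lambda>t. r ^ k * flat (P k) (r * t - p)) has_real_derivative r ^ Suc k * flat (P (Suc k)) (r * t - p)) (at t)"
      unfolding P by (simp add: mult_ac)
    then show ?thesis
      by (intro has_vector_derivative_of_real) (simp add: has_real_derivative_iff_has_vector_derivative)
  qed
  from smooth_of_derivatives(1)[of "\<lambda>k t. complex_of_real (r ^ k * flat (P k) (r * t - p))", OF this]
  show ?thesis by (simp add: P_def cong: if_cong)
qed

text \<open>The product of two flat functions is a bump on [p, q]; its primitive \<open>F\<close>,
  divided by the total mass \<open>F q\<close>, is a smooth step, and the cutoff is 1 minus this
  step.\<close>

lemma cutoff_exists:
  assumes "p \<in> E" "q \<in> E" "p < q"
  shows "\<exists>\<eta>\<in>S. (\<forall>t\<in>E. t \<le> p \<longrightarrow> \<eta> t = 1) \<and> (\<forall>t\<in>E. t \<ge> q \<longrightarrow> \<eta> t = 0)"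
proof -
  define \<beta> where "\<beta> = (\<lambda>t. (if t \<in> E then complex_of_real (flat 1 (1 * t - p)) else 0) * (if t \<in> E then complex_of_real (flat 1 (- 1 * t - (- q))) else 0))"
  have \<beta>: "\<beta> \<in> S" unfolding \<beta>_def by (intro smooth_mult smooth_flat) auto
  define F where "F = solve p 0 \<beta>"
  have F: "F \<in> S" "F p = 0" "D F = \<beta>" using solve[OF assms(1) \<beta>, of 0] by (auto simp: F_def)
  have out: "\<beta> t = 0" if "t \<le> p \<or> q \<le> t" for t using that by (auto simp: \<beta>_def flat_def)
  have const: "F x = F y" if "x \<in> E" "y \<in> E" "x \<le> y" "y \<le> p \<or> q \<le> x" for x y
  proof -
    have "(F has_derivative (\<lambda>_. 0)) (at t within {x..y})" if t: "t \<in> {x..y}" for t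
    proof -
      have "t \<in> E" using einterval_between[OF \<open>x \<in> E\<close> \<open>y \<in> E\<close>] t by auto
      moreover have "\<beta> t = 0" using t \<open>y \<le> p \<or> q \<le> x\<close> by (intro out) auto
      ultimately have "(F has_vector_derivative 0) (at t)" using smooth_deriv[OF F(1)] F(3) by metis
      then show ?thesis by (simp add: has_vector_derivative_def has_derivative_at_withinI)
    qed
    then have "\<exists>c. \<forall>t\<in>{x..y}. F t = c" by (intro has_derivative_zero_constant) auto
    then show ?thesis using \<open>x \<le> y\<close> by auto
  qed
  have "Re (F q) > 0"
  proof -
    have d: "((\<lambda>t. Re (F t)) has_real_derivative Re (\<beta> t)) (at t)" if "p \<le> t" "t \<le> q" for t
      using bounded_linear.has_vector_derivative[OF bounded_linear_Re smooth_deriv[OF F(1)]]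
        einterval_between[OF assms(1,2) that] F(3)
      by (simp add: has_real_derivative_iff_has_vector_derivative)
    obtain z where z: "p < z" "z < q" "Re (F q) - Re (F p) = (q - p) * Re (\<beta> z)"
      using MVT2[OF assms(3) d] by blast
    have "z \<in> E" using einterval_between[OF assms(1,2)] z by auto
    then have "Re (\<beta> z) > 0" using z by (simp add: \<beta>_def flat_def)
    then show ?thesis using z F(2) assms(3) by simp
  qed
  then have Fq: "F q \<noteq> 0" by auto
  define \<eta> where "\<eta> = (\<lambda>t. (- 1 / F q) * F t + exp_monomial a b 0 0 t)"
  have "\<eta> \<in> S" unfolding \<eta>_def by (intro smooth_lincomb F smooth_exp)
  moreover have "\<eta> t = 1" if "t \<in> E" "t \<le> p" for t
    using const[OF that(1) assms(1) that(2)] F(2) that by (simp add: \<eta>_def exp_monomial_0)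
  moreover have "\<eta> t = 0" if "t \<in> E" "t \<ge> q" for t
    using const[OF assms(2) that] Fq that by (simp add: \<eta>_def exp_monomial_0)
  ultimately show ?thesis by blast
qed

lemma cutoff_exists_signed:
  assumes "s = 1 \<or> s = - 1" "p \<in> E" "q \<in> E" "s * p < s * q"
  shows "\<exists>\<eta>\<in>S. (\<forall>t\<in>E. s * t \<le> s * p \<longrightarrow> \<eta> t = 1) \<and> (\<forall>t\<in>E. s * t \<ge> s * q \<longrightarrow> \<eta> t = 0)"
  using assms(1)
proof
  assume "s = 1" then show ?thesis using cutoff_exists[of p q] assms by simp
next
  assume s: "s = - 1"
  obtain \<eta> where \<eta>: "\<eta> \<in> S" "\<And>t. t \<in> E \<Longrightarrow> t \<le> q \<Longrightarrow> \<eta> t = 1" "\<And>t. t \<in> E \<Longrightarrow> t \<ge> p \<Longrightarrow> \<eta> t = 0"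
    using cutoff_exists[of q p] assms s by auto
  have "(\<lambda>t. (- 1) * \<eta> t + exp_monomial a b 0 0 t) \<in> S" by (intro smooth_lincomb \<eta> smooth_exp)
  then show ?thesis using \<eta> s by (intro bexI[of _ "\<lambda>t. (- 1) * \<eta> t + exp_monomial a b 0 0 t"]) (auto simp: exp_monomial_0)
qed

text \<open>Integration starts at the end from which the exponential decays: the left end for Re l
  \<le> 0 and the right end for Re l \<ge> 0. Then the kernel exp (Re l (t - x)) is at most 1. The
  sign \<open>s\<close> selects half-plane and end together.\<close>

lemma resp_bound_sided:
  assumes u: "functional \<alpha> \<beta> n C u" and f: "f \<in> S" and s: "s = 1 \<or> s = - 1"
  shows "\<exists>K\<ge>0. \<forall>l. s * Re l \<le> 0 \<longrightarrow> norm (resp u (if s = 1 then \<alpha> else \<beta>) f l) \<le> K * (1 + norm l) ^ n"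
proof -
  have ab: "\<alpha> \<in> E" "\<beta> \<in> E" "C \<ge> 0" "\<alpha> \<le> \<beta>" using u by (auto simp: functional_def)
  obtain B where B: "\<forall>k\<le>n. \<forall>t\<in>{\<alpha>..\<beta>}. norm ((D ^^ k) f t) \<le> B" using deriv_op_pow_bounded[OF f ab(1,2)] by blast
  have "norm ((D ^^ 0) f \<alpha>) \<le> B" using B ab(4) by (metis atLeastAtMost_iff le0 order_refl)
  then have "B \<ge> 0" using norm_ge_zero order_trans by blast
  define e where "e = (if s = 1 then \<alpha> else \<beta>)"
  have e: "e \<in> {\<alpha>..\<beta>}" using ab by (simp add: e_def)
  have "norm (resp u e f l) \<le> (C * (1 * B * (\<beta> - \<alpha>) + of_nat n * B)) * (1 + norm l) ^ n" if l: "s * Re l \<le> 0" for l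
  proof -
    have "norm (resp u e f l) \<le> C * (1 + norm l) ^ n * (1 * B * (\<beta> - \<alpha>) + of_nat n * B)"
    proof (rule resp_bound[OF u f e _ B])
      fix t x assume "t \<in> {\<alpha>..\<beta>}" "x \<in> closed_segment e t"
      then have "Re l * (t - x) \<le> 0"
        using s l by (auto simp: e_def closed_segment_eq_real_ivl mult_le_0_iff split: if_splits)
      then show "exp (Re l * (t - x)) \<le> 1" by simp
    qed
    then show ?thesis by (simp add: mult_ac)
  qed
  moreover have "C * (1 * B * (\<beta> - \<alpha>) + of_nat n * B) \<ge> 0" using ab \<open>B \<ge> 0\<close> by simp
  ultimately show ?thesis unfolding e_def by blast
qed

text \<open>In the manner of the Paley-Wiener theorem, the bound places the support of \<open>u\<close> to the right of
  \<open>c\<close> if \<open>s = 1\<close> and to the left of \<open>c\<close> if \<open>s = - 1\<close>.\<close>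

definition exp_bounded :: "real \<Rightarrow> ((real \<Rightarrow> complex) \<Rightarrow> complex) \<Rightarrow> real \<Rightarrow> bool" where
  "exp_bounded s u c \<longleftrightarrow> (\<exists>K m. \<forall>l. s * Re l \<le> 0 \<longrightarrow> norm (hat u l) \<le> K * (1 + norm l) ^ m * exp (c * Re l))"

section \<open>From exponential bounds to supports\<close>

text \<open>The derivative l y + f of the solution y satisfies the equation with right-hand side f',
  but has the value f c at c; the exponential term corrects this.\<close>

lemma solve_deriv_op:
  assumes "c \<in> E" "f \<in> S"
  shows "solve c l (D f) = (\<lambda>t. (- f c * exp (- l * of_real c)) * exp_monomial a b 0 l t + (l * solve c l f t + f t))"
proof (rule sym, rule solve_unique[OF assms(1) smooth_deriv_op[OF assms(2)]])
  note y = solve[OF assms, of l]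
  have 1: "(\<lambda>t. l * solve c l f t + f t) \<in> S" by (intro smooth_lincomb y assms)
  show "(\<lambda>t. (- f c * exp (- l * of_real c)) * exp_monomial a b 0 l t + (l * solve c l f t + f t)) \<in> S"
    by (intro smooth_lincomb smooth_exp 1)
  show "(- f c * exp (- l * of_real c)) * exp_monomial a b 0 l c + (l * solve c l f c + f c) = 0"
    using y(2) assms(1) by (simp add: exp_monomial_0 mult.assoc flip: exp_add)
  show "D (\<lambda>t. (- f c * exp (- l * of_real c)) * exp_monomial a b 0 l t + (l * solve c l f t + f t)) =
    (\<lambda>t. l * ((- f c * exp (- l * of_real c)) * exp_monomial a b 0 l t + (l * solve c l f t + f t)) + D f t)"
    unfolding smooth_deriv_op_lincomb[OF smooth_exp 1] smooth_deriv_op_lincomb[OF y(1) assms(2)] deriv_op_exp y(3)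
    by (auto simp: algebra_simps)
qed

lemma resp_deriv_op:
  assumes u: "functional \<alpha> \<beta> n C u" and c: "c \<in> E" and f: "f \<in> S"
  shows "resp u c (D f) l = (- f c * exp (- l * of_real c)) * hat u l + (l * resp u c f l + u f)"
proof -
  note y = solve[OF c f, of l]
  show ?thesis unfolding resp_def hat_def solve_deriv_op[OF c f]
    by (simp only: functional_lincomb[OF u smooth_exp smooth_lincomb[OF y(1) f]] functional_lincomb[OF u y(1) f])
qed

lemma resp_holomorphic':
  assumes u: "functional \<alpha> \<beta> n C u" and c: "c \<in> E" and f: "f \<in> S"
  shows "resp u c f holomorphic_on UNIV"
proof -
  have "functional (min \<alpha> c) (max \<beta> c) n C u"
    by (rule functional_enlarge[OF u]) (use u c in \<open>auto simp: functional_def min_def max_def\<close>)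
  then show ?thesis by (rule resp_holomorphic[OF _ f]) auto
qed

text \<open>In place of an inversion formula, the responses to all derivatives of g are bounded by
  polynomials of one degree \<open>p\<close>, and \<open>shifted_sequence_trivial\<close> yields u g
  = 0. The ends \<open>e1\<close> and \<open>e2\<close> of the interval lie before and beyond
  \<open>c\<close>. For s Re l \<ge> 0 the base point \<open>e2\<close> is favourable. In the other
  half-plane \<open>e1\<close> is, and the base change to \<open>c\<close> costs exp (- c Re l),
  which the assumed bound on \<open>hat u\<close> compensates.\<close>

lemma exp_bounded_annihilates:
  assumes u: "functional \<alpha> \<beta> n C u" and s: "s = 1 \<or> s = - 1" and bdd: "exp_bounded s u c" and c: "c \<in> E"
    and g: "g \<in> S" "\<And>t. t \<in> E \<Longrightarrow> s * t \<ge> s * c \<Longrightarrow> g t = 0"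
  shows "u g = 0"
proof -
  define \<alpha>' \<beta>' where "\<alpha>' = min \<alpha> c" and "\<beta>' = max \<beta> c"
  have u': "functional \<alpha>' \<beta>' n C u" unfolding \<alpha>'_def \<beta>'_def
    by (rule functional_enlarge[OF u]) (use u c in \<open>auto simp: functional_def min_def max_def\<close>)
  define e1 e2 where "e1 = (if s = 1 then \<alpha>' else \<beta>')" and "e2 = (if s = 1 then \<beta>' else \<alpha>')"
  have e2': "e2 = (if - s = 1 then \<alpha>' else \<beta>')" using s by (auto simp: e2_def)
  have e: "e1 \<in> E" "e2 \<in> E" "s * e2 \<ge> s * c" "s * e1 \<le> s * c"
    using u' s by (auto simp: e1_def e2_def functional_def \<alpha>'_def \<beta>'_def)
  obtain K m where K: "\<And>l. s * Re l \<le> 0 \<Longrightarrow> norm (hat u l) \<le> K * (1 + norm l) ^ m * exp (c * Re l)"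
    using bdd unfolding exp_bounded_def by blast
  define p where "p = max n m"
  have ge1: "(1 + norm l) ^ n \<le> (1 + norm l) ^ p" "(1 + norm l) ^ m \<le> (1 + norm l) ^ p" for l :: complex
    by (auto intro!: power_increasing simp: p_def)
  have main: "\<exists>C. \<forall>l. norm (resp u e2 h l) \<le> C * (1 + norm l) ^ p"
    if h: "h \<in> S" "\<And>t. t \<in> E \<Longrightarrow> s * t \<ge> s * c \<Longrightarrow> h t = 0" for h
  proof -
    obtain K1 where K1: "K1 \<ge> 0" "\<And>l. s * Re l \<le> 0 \<Longrightarrow> norm (resp u e1 h l) \<le> K1 * (1 + norm l) ^ n"
      using resp_bound_sided[OF u' h(1) s] unfolding e1_def by blast
    obtain K2 where K2: "K2 \<ge> 0" "\<And>l. - s * Re l \<le> 0 \<Longrightarrow> norm (resp u e2 h l) \<le> K2 * (1 + norm l) ^ n"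
      using resp_bound_sided[OF u' h(1), of "- s"] s unfolding e2' by force
    have ab: "\<alpha>' \<in> E" "\<beta>' \<in> E" using u' by (auto simp: functional_def)
    obtain B where "\<forall>k\<le>0. \<forall>t\<in>{\<alpha>'..\<beta>'}. norm ((D ^^ k) h t) \<le> B" using deriv_op_pow_bounded[OF h(1) ab] by blast
    then have B: "\<And>t. t \<in> {\<alpha>'..\<beta>'} \<Longrightarrow> norm (h t) \<le> B" by simp
    have seg: "x \<in> {\<alpha>'..\<beta>'}" if "x \<in> closed_segment e1 c" for x
      using that s by (auto simp: e1_def \<alpha>'_def \<beta>'_def closed_segment_eq_real_ivl split: if_splits)
    have "B \<ge> 0" using order_trans[OF norm_ge_zero B[of c]] by (simp add: \<alpha>'_def \<beta>'_def)
    \<comment> \<open>The right-hand side vanishes between \<open>c\<close> and \<open>e2\<close>,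
      so the solution that starts with 0 at \<open>e2\<close> is still 0 at
      \<open>c\<close>.\<close>
    have e2c: "solve e2 l h = solve c l h" for l
    proof (rule solve_unique[OF c h(1) solve(1)[OF e(2) h(1)] _ solve(3)[OF e(2) h(1)]])
      have "norm (solve e2 l h c) \<le> exp (\<bar>Re l\<bar> * \<bar>c - e2\<bar>) * 0 * \<bar>c - e2\<bar>"
      proof (rule solve_bound[OF e(2) h(1) c])
        fix x assume x: "x \<in> closed_segment e2 c"
        then have "x \<in> E" using closed_segment_subset[OF e(2) c convex_einterval] by blast
        moreover have "s * x \<ge> s * c" using x e(3) s by (auto simp: closed_segment_eq_real_ivl split: if_splits)
        ultimately show "norm (h x) \<le> 0" using h(2) by simp
        have "\<bar>c - x\<bar> \<le> \<bar>c - e2\<bar>" using x by (auto simp: closed_segment_eq_real_ivl split: if_splits)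
        then have "\<bar>Re l\<bar> * \<bar>c - x\<bar> \<le> \<bar>Re l\<bar> * \<bar>c - e2\<bar>" by (intro mult_left_mono) auto
        then have "Re l * (c - x) \<le> \<bar>Re l\<bar> * \<bar>c - e2\<bar>" by (metis abs_ge_self abs_mult order_trans)
        then show "exp (Re l * (c - x)) \<le> exp (\<bar>Re l\<bar> * \<bar>c - e2\<bar>)" by simp
      qed
      then show "solve e2 l h c = 0" by simp
    qed
    have "norm (resp u e2 h l) \<le> (K1 + K2 + B * \<bar>c - e1\<bar> * \<bar>K\<bar>) * (1 + norm l) ^ p" for l
    proof (cases "s * Re l \<le> 0")
      case True
      have "resp u e1 h l = (solve e1 l h c * exp (- l * of_real c)) * hat u l + resp u e2 h l"
        using resp_base_change[OF u h(1) e(1) c, of l] e2c by (simp add: resp_def)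
      then have "norm (resp u e2 h l) \<le> norm (resp u e1 h l) + norm (solve e1 l h c * exp (- l * of_real c) * hat u l)"
        by (metis add_diff_cancel_left' norm_triangle_ineq4)
      also have "norm (resp u e1 h l) \<le> K1 * (1 + norm l) ^ p"
        using K1(2)[OF True] mult_left_mono[OF ge1(1)[of l] K1(1)] by linarith
      also have "norm (solve e1 l h c * exp (- l * of_real c) * hat u l) \<le> B * \<bar>c - e1\<bar> * exp (- c * Re l) * (\<bar>K\<bar> * (1 + norm l) ^ p * exp (c * Re l))"
        unfolding norm_mult
      proof (intro mult_mono)
        have "norm (solve e1 l h c) \<le> 1 * B * \<bar>c - e1\<bar>"
        proof (rule solve_bound[OF e(1) h(1) c])
          fix x assume x: "x \<in> closed_segment e1 c"
          show "norm (h x) \<le> B" by (rule B[OF seg[OF x]])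
          have "Re l * (c - x) \<le> 0"
            using x True s e(4) by (auto simp: closed_segment_eq_real_ivl mult_le_0_iff split: if_splits)
          then show "exp (Re l * (c - x)) \<le> 1" by simp
        qed
        then show "norm (solve e1 l h c) \<le> B * \<bar>c - e1\<bar>" by simp
        show "norm (exp (- l * of_real c)) \<le> exp (- c * Re l)" by (simp add: mult.commute)
        have "norm (hat u l) \<le> K * (1 + norm l) ^ m * exp (c * Re l)" by (rule K[OF True])
        also have "\<dots> \<le> \<bar>K\<bar> * (1 + norm l) ^ p * exp (c * Re l)"
          using ge1(2)[of l] by (intro mult_right_mono mult_mono) auto
        finally show "norm (hat u l) \<le> \<bar>K\<bar> * (1 + norm l) ^ p * exp (c * Re l)" .
      qed (use \<open>B \<ge> 0\<close> in auto)
      also have "\<dots> = B * \<bar>c - e1\<bar> * \<bar>K\<bar> * (1 + norm l) ^ p * (exp (- c * Re l) * exp (c * Re l))" by (simp only: mult_ac)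
      also have "exp (- c * Re l) * exp (c * Re l) = 1" by (simp flip: exp_add)
      finally have "norm (resp u e2 h l) \<le> K1 * (1 + norm l) ^ p + B * \<bar>c - e1\<bar> * \<bar>K\<bar> * (1 + norm l) ^ p" by simp
      also have "\<dots> \<le> (K1 + K2 + B * \<bar>c - e1\<bar> * \<bar>K\<bar>) * (1 + norm l) ^ p"
        using K2(1) by (simp add: algebra_simps)
      finally show ?thesis .
    next
      case False
      then have "norm (resp u e2 h l) \<le> K2 * (1 + norm l) ^ n" by (intro K2) auto
      also have "\<dots> \<le> (K1 + K2 + B * \<bar>c - e1\<bar> * \<bar>K\<bar>) * (1 + norm l) ^ p"
        using K1 K2 \<open>B \<ge> 0\<close> ge1(1) by (intro mult_mono) auto
      finally show ?thesis .
    qed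
    then show ?thesis by blast
  qed
  have Dg: "(D ^^ k) g \<in> S \<and> (\<forall>t\<in>E. s * t \<ge> s * c \<longrightarrow> (D ^^ k) g t = 0)" for k
  proof (induction k)
    case 0 then show ?case using g by simp
  next
    case (Suc k)
    have "(D ^^ Suc k) g t = 0" if t: "t \<in> E" "s * t \<ge> s * c" for t
    proof -
      have diff: "((D ^^ k) g has_vector_derivative (D ^^ Suc k) g t) (at t)"
        using smooth_deriv[OF _ t(1), of "(D ^^ k) g"] Suc by simp
      \<comment> \<open>At t = c the function is known to vanish on one side only, so its derivative
        is identified within a one-sided set, which has to accumulate at t.\<close>
      have sub: "at (t + 0) within {x. x \<in> E \<and> s * x \<ge> s * t} \<noteq> bot"
      proof -
        obtain d where d: "d > 0" "ball t d \<subseteq> E" using t(1) open_einterval openE by blast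
        have "t islimpt {x. x \<in> E \<and> s * x \<ge> s * t}"
          unfolding islimpt_approachable
        proof (intro allI impI)
          fix r :: real assume "r > 0"
          define x where "x = t + s * (min r d / 2)"
          have "x \<in> E" using d s \<open>r > 0\<close> by (intro subsetD[OF d(2)]) (auto simp: x_def dist_real_def min_def)
          moreover have "s * x \<ge> s * t" "x \<noteq> t" "dist x t < r"
            using s d \<open>r > 0\<close> by (auto simp: x_def dist_real_def min_def algebra_simps)
          ultimately show "\<exists>x\<in>{x. x \<in> E \<and> s * x \<ge> s * t}. x \<noteq> t \<and> dist x t < r" by blast
        qed
        then show ?thesis by (simp add: trivial_limit_within)
      qed
      have "((D ^^ k) g has_vector_derivative (D ^^ Suc k) g t) (at t within {x. x \<in> E \<and> s * x \<ge> s * t})"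
        using diff by (rule has_vector_derivative_at_within)
      moreover have "((D ^^ k) g has_vector_derivative 0) (at t within {x. x \<in> E \<and> s * x \<ge> s * t})"
        by (rule has_vector_derivative_transform[of t _ "(D ^^ k) g" "\<lambda>_. 0"]) (use Suc t in auto)
      ultimately show ?thesis using sub by (intro vector_derivative_unique_within) auto
    qed
    moreover have "(D ^^ Suc k) g \<in> S" using Suc smooth_deriv_op by simp
    ultimately show ?case by blast
  qed
  obtain C' where C': "\<And>l. norm (resp u e2 ((D ^^ (p + 2)) g) l) \<le> C' * (1 + norm l) ^ p"
    using main[of "(D ^^ (p + 2)) g"] Dg[of "p + 2"] by blast
  have "u ((D ^^ 0) g) = 0"
  proof (rule shifted_sequence_trivial[where M = "\<lambda>k. resp u e2 ((D ^^ k) g)" and d = "\<lambda>k. u ((D ^^ k) g)"])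
    show "resp u e2 ((D ^^ k) g) holomorphic_on UNIV" for k
      using resp_holomorphic'[OF u e(2)] Dg by blast
    \<comment> \<open>The term with \<open>hat u\<close> in \<open>resp_deriv_op\<close> drops out,
      since all derivatives of g vanish at \<open>e2\<close>.\<close>
    show "resp u e2 ((D ^^ Suc k) g) l = l * resp u e2 ((D ^^ k) g) l + u ((D ^^ k) g)" for k l
      using resp_deriv_op[OF u e(2), of "(D ^^ k) g" l] Dg[of k] e by simp
    show "norm (resp u e2 ((D ^^ (p + 2)) g) l) \<le> C' * (1 + norm l) ^ p" for l by (rule C')
  qed
  then show ?thesis by simp
qed

section \<open>Resolvent transforms\<close>

private abbreviation (input) "ann \<equiv> annihilator"
private abbreviation (input) "h \<equiv> hat"
private abbreviation (input) "rs \<equiv> resp"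

lemma annihilator_functional: "u \<in> ann L \<Longrightarrow> \<exists>\<alpha> \<beta> n C. functional \<alpha> \<beta> n C u"
  by (simp add: annihilator_def)

lemma annihilator_vanishes: "u \<in> ann L \<Longrightarrow> g \<in> L \<Longrightarrow> u g = 0"
  by (simp add: annihilator_def)

lemma annihilator_hat_holomorphic: "u \<in> ann L \<Longrightarrow> h u holomorphic_on UNIV"
  using annihilator_functional hat_holomorphic by blast

lemma annihilator_resp_holomorphic: "u \<in> ann L \<Longrightarrow> c \<in> E \<Longrightarrow> f \<in> S \<Longrightarrow> rs u c f holomorphic_on UNIV"
  using annihilator_functional resp_holomorphic' by blast

lemma invariant_subset: "D_invariant_subspace a b L \<Longrightarrow> L \<subseteq> S"
  using closedin_subset[of "smooth_topology a b" L] by (simp add: D_invariant_subspace_def topspace_smooth_topology)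

lemma discrete_eventually:
  fixes A :: "complex set"
  assumes "discrete A" shows "\<forall>\<^sub>F z in at l. z \<notin> A \<or> l \<notin> A"
proof (cases "l \<in> A")
  case True
  then obtain T where T: "open T" "T \<inter> A = {l}" using assms by (auto simp: discrete_def isolated_in_def)
  then have "\<forall>\<^sub>F z in at l. z \<in> T - {l}" by (intro eventually_at_in_open) auto
  then show ?thesis by eventually_elim (use T in blast)
qed simp

lemma resolvent_exists:
  assumes "l \<notin> D_spectrum a b L" "f \<in> L"
  shows "\<exists>r\<in>L. D r = (\<lambda>t. l * r t + f t)"
proof -
  have "f \<in> (\<lambda>f t. D f t - l * f t) ` L"
    using assms by (auto simp: D_spectrum_def bij_betw_def)
  then obtain r where r: "r \<in> L" "f = (\<lambda>t. D r t - l * r t)" by blast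
  then show ?thesis by (intro bexI[of _ r]) auto
qed

lemma exp_notin:
  assumes "a < b" "D_invariant_subspace a b L" "l \<notin> D_spectrum a b L"
  shows "exp_monomial a b 0 l \<notin> L"
proof
  assume "exp_monomial a b 0 l \<in> L"
  moreover have "(\<lambda>_. 0) \<in> L" using assms(2) subspace_closed(1) by (simp add: D_invariant_subspace_def)
  moreover have "inj_on (\<lambda>f t. D f t - l * f t) L" using assms(3) by (simp add: D_spectrum_def bij_betw_def)
  moreover have "(\<lambda>t. D (exp_monomial a b 0 l) t - l * exp_monomial a b 0 l t) = (\<lambda>t. D (\<lambda>_. 0) t - l * 0)"
  proof -
    have "D (\<lambda>_. 0) = (\<lambda>_. 0)" by (auto simp: deriv_op_def)
    then show ?thesis by (simp add: deriv_op_exp)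
  qed
  ultimately have "exp_monomial a b 0 l = (\<lambda>_. 0)" by (rule_tac inj_onD[of "\<lambda>f t. D f t - l * f t" L])
  moreover obtain c where "c \<in> E" using einterval_nonempty[OF assms(1)] by blast
  ultimately have "exp_monomial a b 0 l c = 0" "c \<in> E" by auto
  then show False by (simp add: exp_monomial_0)
qed

text \<open>Off the spectrum the resolvent of f in \<open>L\<close> is the solution from
  \<open>c\<close> plus k times the exponential. Every annihilator kills this sum, so its response
  is - k times its transform, with the same k for all annihilators. Continuity extends the identity
  to the discrete spectrum.\<close>

lemma cross_identity:
  assumes L: "D_invariant_subspace a b L" "discrete (D_spectrum a b L)" and f: "f \<in> L"
    and u: "u \<in> ann L" and v: "v \<in> ann L" and c: "c \<in> E"
  shows "h u l * rs v c f l = h v l * rs u c f l"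
proof -
  have fS: "f \<in> S" using f invariant_subset[OF L(1)] by blast
  define \<Delta> where "\<Delta> = (\<lambda>l. h u l * rs v c f l - h v l * rs u c f l)"
  have holo: "\<Delta> holomorphic_on UNIV" unfolding \<Delta>_def
    by (intro holomorphic_intros annihilator_hat_holomorphic[OF u] annihilator_hat_holomorphic[OF v]
      annihilator_resp_holomorphic[OF u c fS] annihilator_resp_holomorphic[OF v c fS])
  have out: "\<Delta> l = 0" if l: "l \<notin> D_spectrum a b L" for l
  proof -
    obtain r where r: "r \<in> L" "D r = (\<lambda>t. l * r t + f t)" using resolvent_exists[OF l f] by blast
    have rS: "r \<in> S" using r invariant_subset[OF L(1)] by blast
    define k where "k = r c * exp (- l * of_real c)"
    have req: "r = (\<lambda>t. k * exp_monomial a b 0 l t + solve c l f t)"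
      using solve_general[OF c fS rS r(2)] by (simp add: k_def)
    have "k * h w l + rs w c f l = 0" if w: "w \<in> ann L" for w
    proof -
      obtain \<alpha> \<beta> n C where "functional \<alpha> \<beta> n C w" using annihilator_functional[OF w] by blast
      from functional_lincomb[OF this smooth_exp solve(1)[OF c fS], of k l l]
      have "w r = k * h w l + rs w c f l" unfolding hat_def resp_def by (subst req)
      then show ?thesis using annihilator_vanishes[OF w r(1)] by simp
    qed
    from this[OF u] this[OF v] have "rs u c f l = - k * h u l" "rs v c f l = - k * h v l"
      by (auto simp: eq_neg_iff_add_eq_0 add.commute)
    then show ?thesis by (simp add: \<Delta>_def)
  qed
  have "\<Delta> l = 0"
  proof (cases "l \<in> D_spectrum a b L")
    case True
    have "\<forall>\<^sub>F z in at l. \<Delta> z = 0"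
      using discrete_eventually[OF L(2), of l] by eventually_elim (use True out in auto)
    then have "(\<Delta> \<longlongrightarrow> 0) (at l)" by (rule tendsto_eventually)
    moreover have "(\<Delta> \<longlongrightarrow> \<Delta> l) (at l)" using entire_isCont[OF holo, of l] by (simp add: isCont_def)
    ultimately show ?thesis using tendsto_unique[of "at l" \<Delta>] by simp
  qed (rule out)
  then show ?thesis by (simp add: \<Delta>_def)
qed

lemma hat_nonzero_exists:
  assumes ab: "a < b" and L: "D_invariant_subspace a b L" and l: "l \<notin> D_spectrum a b L"
  shows "\<exists>u\<in>ann L. h u l \<noteq> 0"
  unfolding hat_def
  by (rule annihilator_separates[OF ab]) (use L exp_notin[OF ab L l] in \<open>auto simp: D_invariant_subspace_def smooth_exp\<close>)

lemma annihilator_nontrivial: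
  assumes ab: "a < b" and L: "D_invariant_subspace a b L" "discrete (D_spectrum a b L)"
  shows "\<exists>u\<in>ann L. \<exists>l. h u l \<noteq> 0"
proof -
  have "\<exists>l. l \<notin> D_spectrum a b L"
  proof (rule ccontr)
    assume "\<not> ?thesis"
    then have "\<forall>\<^sub>F z in at (0::complex). False" using discrete_eventually[OF L(2), of 0] by simp
    then show False by simp
  qed
  then show ?thesis using hat_nonzero_exists[OF ab L(1)] by blast
qed

lemma divide_simple_zero:
  fixes P :: "complex \<Rightarrow> complex"
  assumes P: "P holomorphic_on UNIV" "P m = 0"
  obtains P1 where "P1 holomorphic_on UNIV" "\<And>l. P l = (l - m) * P1 l" "P1 m = deriv P m"
proof
  show "(\<lambda>l. if l = m then deriv P m else (P l - P m) / (l - m)) holomorphic_on UNIV"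
    by (rule pole_lemma_open[OF P(1) open_UNIV])
qed (use P in auto)

text \<open>Here simplicity is used: as t exp (m t) is not in \<open>L\<close>, some annihilator has
  a transform with nonzero derivative at m. Its zero there has order one, and any transform
  vanishing on the spectrum contains the same factor l - m.\<close>

lemma local_divisor:
  assumes ab: "a < b" and L: "D_invariant_subspace a b L" "discrete_simple_spectrum a b L"
    and w: "h w holomorphic_on UNIV" "\<And>m. m \<in> D_spectrum a b L \<Longrightarrow> h w m = 0"
  shows "\<exists>u\<in>ann L. \<exists>d p w1. p holomorphic_on UNIV \<and> w1 holomorphic_on UNIV \<and> p m \<noteq> 0 \<and>
    (\<forall>l. h u l = d l * p l \<and> h w l = d l * w1 l)"
proof (cases "m \<in> D_spectrum a b L")
  case False
  then obtain u where "u \<in> ann L" "h u m \<noteq> 0" using hat_nonzero_exists[OF ab L(1)] by blast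
  then show ?thesis using annihilator_hat_holomorphic w(1)
    by (intro bexI[of _ u] exI[of _ "\<lambda>_. 1"] exI[of _ "h u"] exI[of _ "h w"]) auto
next
  case True
  then have "exp_monomial a b 1 m \<notin> L" "exp_monomial a b 0 m \<in> L" using L(2) by (auto simp: discrete_simple_spectrum_def)
  then obtain u where u: "u \<in> ann L" "u (exp_monomial a b 1 m) \<noteq> 0"
    using annihilator_separates[OF ab, of L "exp_monomial a b 1 m"] exp_monomial_1(1) L(1) by (auto simp: D_invariant_subspace_def)
  have "h u m = 0" using annihilator_vanishes[OF u(1)] \<open>exp_monomial a b 0 m \<in> L\<close> by (simp add: hat_def)
  then obtain p where p: "p holomorphic_on UNIV" "\<And>l. h u l = (l - m) * p l" "p m = deriv (h u) m"
    using divide_simple_zero[OF annihilator_hat_holomorphic[OF u(1)]] by metis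
  have "p m = u (exp_monomial a b 1 m)"
    using p(3) annihilator_functional[OF u(1)] hat_has_derivative DERIV_imp_deriv by metis
  moreover obtain w1 where w1: "w1 holomorphic_on UNIV" "\<And>l. h w l = (l - m) * w1 l"
    using divide_simple_zero[OF w(1) w(2)[OF True]] by metis
  ultimately show ?thesis using u p w1
    by (intro bexI[of _ u] exI[of _ "\<lambda>l. l - m"] exI[of _ p] exI[of _ w1]) auto
qed

text \<open>\<open>M l\<close> is the value of \<open>w\<close> at the solution \<open>r \<in> L\<close> of \<open>r' = l r + f\<close>. The free constant of the
  solution is eliminated by means of \<open>u r = 0\<close>. At the points of the spectrum, where there is no
  resolvent, holomorphy determines the value.\<close>

definition resolvent_transform ::
  "(real \<Rightarrow> complex) set \<Rightarrow> ((real \<Rightarrow> complex) \<Rightarrow> complex) \<Rightarrow> (real \<Rightarrow> complex) \<Rightarrow> (complex \<Rightarrow> complex) \<Rightarrow> bool" where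
  "resolvent_transform L w f M \<longleftrightarrow> M holomorphic_on UNIV \<and>
     (\<forall>u\<in>ann L. \<forall>c\<in>E. \<forall>l. M l * h u l = rs w c f l * h u l - h w l * rs u c f l)"

text \<open>Near m, the annihilator \<open>v\<close> from \<open>local_divisor\<close> makes the
  quotient of the transforms of \<open>w\<close> and \<open>v\<close> equal to w1 / p, hence
  holomorphic, and a local solution is written down with \<open>v\<close> alone. By
  \<open>cross_identity\<close> it serves every other annihilator, and \<open>glue_quotients\<close>
  joins the pieces.\<close>

lemma resolvent_transform_exists:
  assumes ab: "a < b" and L: "D_invariant_subspace a b L" "discrete_simple_spectrum a b L"
    and w: "functional \<alpha> \<beta> n C w" "\<And>m. m \<in> D_spectrum a b L \<Longrightarrow> h w m = 0" and f: "f \<in> L"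
  shows "\<exists>M. resolvent_transform L w f M"
proof -
  obtain c where c: "c \<in> E" using einterval_nonempty[OF ab] by blast
  have fS: "f \<in> S" using f invariant_subset[OF L(1)] by blast
  have disc: "discrete (D_spectrum a b L)" using L(2) by (simp add: discrete_simple_spectrum_def)
  obtain u0 l0 where u0: "u0 \<in> ann L" "h u0 l0 \<noteq> 0" using annihilator_nontrivial[OF ab L(1) disc] by blast
  have w_holo: "h w holomorphic_on UNIV" by (rule hat_holomorphic[OF w(1)])
  have "\<exists>M. M holomorphic_on UNIV \<and> (\<forall>l. \<forall>u\<in>ann L. M l * h u l = rs w c f l * h u l - h w l * rs u c f l)"
  proof (rule glue_quotients[where F = "\<lambda>u l. rs w c f l * h u l - h w l * rs u c f l" and G = h,
      OF _ u0(1) annihilator_hat_holomorphic[OF u0(1)] u0(2)])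
    fix m
    obtain v d p w1 where v: "v \<in> ann L" "p holomorphic_on UNIV" "w1 holomorphic_on UNIV" "p m \<noteq> 0"
      "\<And>l. h v l = d l * p l" "\<And>l. h w l = d l * w1 l"
      using local_divisor[OF ab L w_holo w(2), of m] by blast
    obtain \<epsilon> where \<epsilon>: "\<epsilon> > 0" "\<And>l. l \<in> ball m \<epsilon> \<Longrightarrow> p l \<noteq> 0"
      using continuous_at_avoid[OF entire_isCont[OF v(2)] v(4)] by auto
    define g where "g = (\<lambda>l. rs w c f l - w1 l * rs v c f l / p l)"
    have "g holomorphic_on ball m \<epsilon>" unfolding g_def
      by (intro holomorphic_intros holomorphic_on_subset[OF resp_holomorphic'[OF w(1) c fS]] holomorphic_on_subset[OF v(2)]
         holomorphic_on_subset[OF v(3)] holomorphic_on_subset[OF annihilator_resp_holomorphic[OF v(1) c fS]]) (use \<epsilon> in auto)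
    moreover have "g l * h u l = rs w c f l * h u l - h w l * rs u c f l" if "l \<in> ball m \<epsilon>" "u \<in> ann L" for l u
    proof -
      have "w1 l * rs v c f l / p l * h u l = w1 l * (h u l * rs v c f l) / p l" by simp
      also have "h u l * rs v c f l = d l * p l * rs u c f l"
        using cross_identity[OF L(1) disc f that(2) v(1) c, of l] v(5) by simp
      also have "w1 l * (d l * p l * rs u c f l) / p l = h w l * rs u c f l"
        using \<epsilon>(2)[OF that(1)] v(6) by simp
      finally show ?thesis by (simp add: g_def left_diff_distrib)
    qed
    ultimately show "\<exists>\<epsilon>>0. \<exists>g. g holomorphic_on ball m \<epsilon> \<and> (\<forall>l\<in>ball m \<epsilon>. \<forall>u\<in>ann L. g l * h u l = rs w c f l * h u l - h w l * rs u c f l)"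
      using \<epsilon>(1) by blast
  qed
  then obtain M where M: "M holomorphic_on UNIV" "\<And>l u. u \<in> ann L \<Longrightarrow> M l * h u l = rs w c f l * h u l - h w l * rs u c f l" by blast
  \<comment> \<open>A change of base point alters both responses by the same multiple of the
    respective transform, and the two corrections cancel.\<close>
  have "M l * h u l = rs w c' f l * h u l - h w l * rs u c' f l" if u: "u \<in> ann L" and c': "c' \<in> E" for u c' l
  proof -
    obtain \<alpha>' \<beta>' n' C' where u': "functional \<alpha>' \<beta>' n' C' u" using annihilator_functional[OF u] by blast
    show ?thesis unfolding M(2)[OF u] resp_base_change[OF w(1) fS c c'] resp_base_change[OF u' fS c c']
      by (simp add: algebra_simps)
  qed
  then show ?thesis using M(1) unfolding resolvent_transform_def by blast
qed

text \<open>The initial-value terms of \<open>resp_deriv_op\<close> for \<open>w\<close> and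
  \<open>u\<close> cancel, and u f = 0 because f lies in \<open>L\<close>. This gives the identity
  multiplied by the transform of \<open>u\<close>, which is entire and not identically zero and so
  can be cancelled.\<close>

lemma resolvent_transform_deriv:
  assumes ab: "a < b" and L: "D_invariant_subspace a b L" "discrete (D_spectrum a b L)"
    and w: "functional \<alpha> \<beta> n C w" and f: "f \<in> L"
    and M: "resolvent_transform L w f M" and M': "resolvent_transform L w (D f) M'"
  shows "M' l = l * M l + w f"
proof -
  obtain c where c: "c \<in> E" using einterval_nonempty[OF ab] by blast
  have fS: "f \<in> S" using f invariant_subset[OF L(1)] by blast
  obtain u l0 where u: "u \<in> ann L" "h u l0 \<noteq> 0" using annihilator_nontrivial[OF ab L] by blast
  obtain \<alpha>' \<beta>' n' C' where u': "functional \<alpha>' \<beta>' n' C' u" using annihilator_functional[OF u(1)] by blast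
  have "u f = 0" by (rule annihilator_vanishes[OF u(1) f])
  have "M' l = (\<lambda>l. l * M l + w f) l"
  proof (rule entire_cancel[where M = M' and N = "\<lambda>l. l * M l + w f", OF annihilator_hat_holomorphic[OF u(1)] u(2)])
    show "M' holomorphic_on UNIV" "(\<lambda>l. l * M l + w f) holomorphic_on UNIV"
      using M M' by (auto simp: resolvent_transform_def intro!: holomorphic_intros)
    fix l
    have "M' l * h u l = rs w c (D f) l * h u l - h w l * rs u c (D f) l"
      using M' u(1) c by (simp add: resolvent_transform_def)
    also have "\<dots> = l * (rs w c f l * h u l - h w l * rs u c f l) + w f * h u l"
      unfolding resp_deriv_op[OF w c fS] resp_deriv_op[OF u' c fS] \<open>u f = 0\<close> by (simp add: algebra_simps)
    also have "rs w c f l * h u l - h w l * rs u c f l = M l * h u l"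
      using M u(1) c by (simp add: resolvent_transform_def)
    finally show "M' l * h u l = (l * M l + w f) * h u l" by (simp add: algebra_simps)
  qed
  then show ?thesis by simp
qed

text \<open>As the base point in \<open>resolvent_transform\<close> is free, it is placed in each
  half-plane at the end where \<open>resp_bound_sided\<close> applies. Keeping the transform of
  \<open>u\<close> as a factor on the left avoids division at its zeros.\<close>

lemma resolvent_transform_bound:
  assumes w: "functional \<alpha> \<beta> n C w" and u: "functional \<alpha>' \<beta>' n' C' u" "u \<in> ann L" and f: "f \<in> S"
    and M: "resolvent_transform L w f M"
  shows "\<exists>K. \<forall>l. norm (M l) * norm (h u l) \<le> K * (1 + norm l) ^ max n n' * (norm (h u l) + norm (h w l))"
proof -
  define \<alpha>2 \<beta>2 where "\<alpha>2 = min \<alpha> \<alpha>'" and "\<beta>2 = max \<beta> \<beta>'"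
  have w2: "functional \<alpha>2 \<beta>2 n C w" unfolding \<alpha>2_def \<beta>2_def
    by (rule functional_enlarge[OF w]) (use w u in \<open>auto simp: functional_def min_def max_def\<close>)
  have u2: "functional \<alpha>2 \<beta>2 n' C' u" unfolding \<alpha>2_def \<beta>2_def
    by (rule functional_enlarge[OF u(1)]) (use w u in \<open>auto simp: functional_def min_def max_def\<close>)
  have E: "\<alpha>2 \<in> E" "\<beta>2 \<in> E" using w2 by (auto simp: functional_def)
  have key: "\<exists>K. \<forall>l. s * Re l \<le> 0 \<longrightarrow> norm (M l) * norm (h u l) \<le> K * (1 + norm l) ^ max n n' * (norm (h u l) + norm (h w l))"
    if s: "s = 1 \<or> s = - 1" for s
  proof -
    define e where "e = (if s = 1 then \<alpha>2 else \<beta>2)"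
    have eE: "e \<in> E" using E by (simp add: e_def)
    obtain K1 where K1: "K1 \<ge> 0" "\<And>l. s * Re l \<le> 0 \<Longrightarrow> norm (rs w e f l) \<le> K1 * (1 + norm l) ^ n"
      using resp_bound_sided[OF w2 f s] unfolding e_def by blast
    obtain K2 where K2: "K2 \<ge> 0" "\<And>l. s * Re l \<le> 0 \<Longrightarrow> norm (rs u e f l) \<le> K2 * (1 + norm l) ^ n'"
      using resp_bound_sided[OF u2 f s] unfolding e_def by blast
    have "norm (M l) * norm (h u l) \<le> (K1 + K2) * (1 + norm l) ^ max n n' * (norm (h u l) + norm (h w l))" if l: "s * Re l \<le> 0" for l
    proof -
      define p where "p = (1 + norm l) ^ max n n'"
      have ge: "(1 + norm l) ^ n \<le> p" "(1 + norm l) ^ n' \<le> p" by (auto intro!: power_increasing simp: p_def)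
      have "norm (M l) * norm (h u l) = norm (rs w e f l * h u l - h w l * rs u e f l)"
        using M u(2) eE by (simp add: resolvent_transform_def flip: norm_mult)
      also have "\<dots> \<le> norm (rs w e f l) * norm (h u l) + norm (h w l) * norm (rs u e f l)"
        by (metis norm_mult norm_triangle_ineq4)
      also have "\<dots> \<le> (K1 * p) * norm (h u l) + norm (h w l) * (K2 * p)"
        using K1(2)[OF l] K2(2)[OF l] mult_left_mono[OF ge(1) K1(1)] mult_left_mono[OF ge(2) K2(1)]
        by (intro add_mono mult_right_mono mult_left_mono) auto
      also have "\<dots> \<le> ((K1 + K2) * p) * norm (h u l) + norm (h w l) * ((K1 + K2) * p)"
        using K1(1) K2(1) by (intro add_mono mult_right_mono mult_left_mono) (auto simp: p_def)
      finally show ?thesis by (simp add: p_def algebra_simps)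
    qed
    then show ?thesis by blast
  qed
  obtain K1 where K1: "\<And>l. 1 * Re l \<le> 0 \<Longrightarrow> norm (M l) * norm (h u l) \<le> K1 * (1 + norm l) ^ max n n' * (norm (h u l) + norm (h w l))"
    using key[of 1] by blast
  obtain K2 where K2: "\<And>l. - 1 * Re l \<le> 0 \<Longrightarrow> norm (M l) * norm (h u l) \<le> K2 * (1 + norm l) ^ max n n' * (norm (h u l) + norm (h w l))"
    using key[of "- 1"] by blast
  have "norm (M l) * norm (h u l) \<le> max K1 K2 * (1 + norm l) ^ max n n' * (norm (h u l) + norm (h w l))" for l
  proof -
    have "K1 * (1 + norm l) ^ max n n' * (norm (h u l) + norm (h w l)) \<le> max K1 K2 * (1 + norm l) ^ max n n' * (norm (h u l) + norm (h w l))"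
      "K2 * (1 + norm l) ^ max n n' * (norm (h u l) + norm (h w l)) \<le> max K1 K2 * (1 + norm l) ^ max n n' * (norm (h u l) + norm (h w l))"
      by (intro mult_right_mono; simp)+
    then show ?thesis using K1[of l] K2[of l] by (cases "Re l \<le> 0") auto
  qed
  then show ?thesis by blast
qed

section \<open>Residual intervals and exponential bounds\<close>

lemma deriv_op_pow_local_zero:
  assumes U: "open U" "\<And>t. t \<in> E \<Longrightarrow> t \<in> U \<Longrightarrow> f t = 0" and t: "t \<in> E" "t \<in> U"
  shows "(D ^^ k) f t = 0"
  using t
proof (induction k arbitrary: t)
  case 0 then show ?case using U(2) by simp
next
  case (Suc k)
  have "((D ^^ k) f has_vector_derivative 0) (at t)"
    by (rule has_vector_derivative_transform_within_open[of "\<lambda>_. 0" _ _ "E \<inter> U"])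
       (use Suc U(1) in \<open>auto intro: open_Int\<close>)
  then show ?case using Suc.prems by (simp add: deriv_op_eq)
qed

lemma smooth_deriv_op_mult:
  assumes "f \<in> S" "g \<in> S"
  shows "D (\<lambda>t. f t * g t) = (\<lambda>t. 1 * (f t * D g t) + D f t * g t)"
proof
  fix t show "D (\<lambda>t. f t * g t) t = 1 * (f t * D g t) + D f t * g t"
  proof (cases "t \<in> E")
    case True
    from has_vector_derivative_mult[OF smooth_deriv[OF assms(1) True] smooth_deriv[OF assms(2) True]]
    show ?thesis by (subst deriv_op_eq[OF True]) auto
  qed (simp add: deriv_op_outside)
qed

text \<open>A crude Leibniz rule: each differentiation doubles the number of terms, all of them
  bounded by \<open>A * B\<close>.\<close>

lemma deriv_op_pow_mult_bound:
  assumes "f \<in> S" "g \<in> S" "\<And>j. j \<le> k \<Longrightarrow> norm ((D ^^ j) f t) \<le> A" "\<And>j. j \<le> k \<Longrightarrow> norm ((D ^^ j) g t) \<le> B"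
  shows "norm ((D ^^ k) (\<lambda>t. f t * g t) t) \<le> 2 ^ k * (A * B)"
  using assms
proof (induction k arbitrary: f g)
  case (0 f g)
  have "norm (f t) \<le> A" "norm (g t) \<le> B" using 0(3)[of 0] 0(4)[of 0] by auto
  moreover from this have "A \<ge> 0" using norm_ge_zero order_trans by blast
  ultimately show ?case by (simp add: norm_mult mult_mono)
next
  case (Suc k f g)
  have fg: "D f \<in> S" "D g \<in> S" using Suc.prems smooth_deriv_op by auto
  have "(D ^^ Suc k) (\<lambda>t. f t * g t) t = 1 * (D ^^ k) (\<lambda>t. f t * D g t) t + (D ^^ k) (\<lambda>t. D f t * g t) t"
    unfolding funpow_Suc_right o_def smooth_deriv_op_mult[OF Suc.prems(1,2)]
    using smooth_mult[OF Suc.prems(1) fg(2)] smooth_mult[OF fg(1) Suc.prems(2)] by (subst deriv_op_pow_lincomb) auto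
  then have "norm ((D ^^ Suc k) (\<lambda>t. f t * g t) t) \<le> norm ((D ^^ k) (\<lambda>t. f t * D g t) t) + norm ((D ^^ k) (\<lambda>t. D f t * g t) t)"
    by (simp only: mult_1 norm_triangle_ineq)
  also have "norm ((D ^^ k) (\<lambda>t. f t * D g t) t) \<le> 2 ^ k * (A * B)"
  proof (rule Suc.IH[OF Suc.prems(1) fg(2)])
    fix j assume "j \<le> k"
    then show "norm ((D ^^ j) f t) \<le> A" "norm ((D ^^ j) (D g) t) \<le> B"
      using Suc.prems(3)[of j] Suc.prems(4)[of "Suc j"] by (auto simp: funpow_swap1)
  qed
  also have "norm ((D ^^ k) (\<lambda>t. D f t * g t) t) \<le> 2 ^ k * (A * B)"
  proof (rule Suc.IH[OF fg(1) Suc.prems(2)])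
    fix j assume "j \<le> k"
    then show "norm ((D ^^ j) (D f) t) \<le> A" "norm ((D ^^ j) g t) \<le> B"
      using Suc.prems(3)[of "Suc j"] Suc.prems(4)[of j] by (auto simp: funpow_swap1)
  qed
  finally show ?case by (simp add: mult_ac)
qed

text \<open>Multiplication by \<eta> confines the functional to an interval outside which \<eta> and
  its derivatives vanish: there the Leibniz estimate contains a factor 0.\<close>

lemma functional_cut:
  assumes w: "functional \<alpha> \<beta> n C w" and \<eta>: "\<eta> \<in> S"
    and ab: "\<alpha>' \<in> E" "\<beta>' \<in> E" "\<alpha>' \<le> \<beta>'"
    and out: "\<And>t j. t \<in> {\<alpha>..\<beta>} \<Longrightarrow> t \<notin> {\<alpha>'..\<beta>'} \<Longrightarrow> (D ^^ j) \<eta> t = 0"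
  shows "\<exists>C'. functional \<alpha>' \<beta>' n C' (\<lambda>g. w (\<lambda>t. \<eta> t * g t))"
proof -
  have wab: "\<alpha> \<in> E" "\<beta> \<in> E" "C \<ge> 0" "\<alpha> \<le> \<beta>" using w by (auto simp: functional_def)
  obtain B where B: "\<And>k t. k \<le> n \<Longrightarrow> t \<in> {\<alpha>..\<beta>} \<Longrightarrow> norm ((D ^^ k) \<eta> t) \<le> B"
    using deriv_op_pow_bounded[OF \<eta> wab(1,2)] by blast
  have "norm ((D ^^ 0) \<eta> \<alpha>) \<le> B" by (rule B) (use wab in auto)
  then have "B \<ge> 0" using norm_ge_zero order_trans by blast
  have "functional \<alpha>' \<beta>' n (C * (2 ^ n * B)) (\<lambda>g. w (\<lambda>t. \<eta> t * g t))"
    unfolding functional_def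
  proof (intro conjI ballI allI impI)
    fix f g c assume fg: "f \<in> S" "g \<in> S"
    have "(\<lambda>t. \<eta> t * (c * f t + g t)) = (\<lambda>t. c * (\<eta> t * f t) + \<eta> t * g t)" by (auto simp: algebra_simps)
    then show "w (\<lambda>t. \<eta> t * (c * f t + g t)) = c * w (\<lambda>t. \<eta> t * f t) + w (\<lambda>t. \<eta> t * g t)"
      using functional_lincomb[OF w smooth_mult[OF \<eta> fg(1)] smooth_mult[OF \<eta> fg(2)]] by simp
  next
    fix f B' assume f: "f \<in> S" and B': "\<forall>k\<le>n. \<forall>t\<in>{\<alpha>'..\<beta>'}. norm ((D ^^ k) f t) \<le> B'"
    have "norm ((D ^^ 0) f \<alpha>') \<le> B'" using B' ab(3) by (metis atLeastAtMost_iff le0 order_refl)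
    then have "B' \<ge> 0" using norm_ge_zero order_trans by blast
    have "norm (w (\<lambda>t. \<eta> t * f t)) \<le> C * (2 ^ n * (B * B'))"
    proof (rule functional_bound[OF w smooth_mult[OF \<eta> f]])
      fix k t assume kt: "k \<le> n" "t \<in> {\<alpha>..\<beta>}"
      show "norm ((D ^^ k) (\<lambda>t. \<eta> t * f t) t) \<le> 2 ^ n * (B * B')"
      proof (cases "t \<in> {\<alpha>'..\<beta>'}")
        case True
        have "norm ((D ^^ k) (\<lambda>t. \<eta> t * f t) t) \<le> 2 ^ k * (B * B')"
          by (rule deriv_op_pow_mult_bound[OF \<eta> f]) (use B B' kt True in auto)
        also have "\<dots> \<le> 2 ^ n * (B * B')"
          using kt \<open>B \<ge> 0\<close> \<open>B' \<ge> 0\<close> by (intro mult_right_mono power_increasing) auto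
        finally show ?thesis .
      next
        case False
        have "t \<in> E" using functional_interval[OF w kt(2)] .
        obtain A where A: "\<And>j. j \<le> k \<Longrightarrow> norm ((D ^^ j) f t) \<le> A"
          using deriv_op_pow_bounded[OF f \<open>t \<in> E\<close> \<open>t \<in> E\<close>, of k] by auto
        have "norm ((D ^^ k) (\<lambda>t. \<eta> t * f t) t) \<le> 2 ^ k * (0 * A)"
          by (rule deriv_op_pow_mult_bound[OF \<eta> f _ A]) (use out[OF kt(2) False] in auto)
        then show ?thesis using \<open>B \<ge> 0\<close> \<open>B' \<ge> 0\<close> by (auto intro: order_trans)
      qed
    qed
    then show "norm (w (\<lambda>t. \<eta> t * f t)) \<le> C * (2 ^ n * B) * B'" by (simp add: mult_ac)
  qed (use ab wab \<open>B \<ge> 0\<close> in auto)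
  then show ?thesis by blast
qed

lemma exp_bounded_endpoint:
  assumes u: "functional \<alpha> \<beta> n C u" and s: "s = 1 \<or> s = - 1"
  shows "exp_bounded s u (if s = 1 then \<alpha> else \<beta>)"
proof -
  have "norm (h u l) \<le> C * (1 + norm l) ^ n * exp ((if s = 1 then \<alpha> else \<beta>) * Re l)" if "s * Re l \<le> 0" for l
    by (rule hat_bound[OF u]) (use s that in \<open>auto simp: mult.commute intro: mult_right_mono mult_right_mono_neg\<close>)
  then show ?thesis unfolding exp_bounded_def by blast
qed

lemma exp_bounded_mono:
  assumes "exp_bounded s u c" "s = 1 \<or> s = - 1" "s * c' \<le> s * c"
  shows "exp_bounded s u c'"
proof -
  obtain K m where K: "\<And>l. s * Re l \<le> 0 \<Longrightarrow> norm (h u l) \<le> K * (1 + norm l) ^ m * exp (c * Re l)"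
    using assms(1) unfolding exp_bounded_def by blast
  have "norm (h u l) \<le> \<bar>K\<bar> * (1 + norm l) ^ m * exp (c' * Re l)" if l: "s * Re l \<le> 0" for l
  proof -
    have "c * Re l \<le> c' * Re l" using assms(2,3) l by (auto intro: mult_right_mono mult_right_mono_neg)
    then have "K * (1 + norm l) ^ m * exp (c * Re l) \<le> \<bar>K\<bar> * (1 + norm l) ^ m * exp (c' * Re l)"
      by (intro mult_mono) auto
    then show ?thesis using K[OF l] by linarith
  qed
  then show ?thesis unfolding exp_bounded_def by blast
qed

lemma vanishing_subspace_open:
  assumes "g \<in> S" "open U" "I \<subseteq> U" "I \<subseteq> E" "\<And>t. t \<in> E \<Longrightarrow> t \<in> U \<Longrightarrow> g t = 0"
  shows "g \<in> vanishing_subspace a b I"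
  using assms deriv_op_pow_local_zero[OF assms(2,5)] by (auto simp: vanishing_subspace_def)

lemma signed_between:
  assumes "s = 1 \<or> s = - 1" "x \<in> E" "y \<in> E" "s * x \<le> s * t" "s * t \<le> s * y"
  shows "t \<in> E"
  using assms einterval_between[of x y t] einterval_between[of y x t] by auto

lemma open_signed: "open {t :: real. s * t < c}" "open {t :: real. s * t > c}"
  by (intro open_Collect_less continuous_intros)+

text \<open>A cutoff removes the part of \<open>w\<close> that lies before \<open>I\<close>: the
  functions concerned vanish near \<open>I\<close>, so \<open>w\<close> kills them and its transform
  is unchanged. If the end \<open>e\<close> of the interval of \<open>w\<close> is already less than
  \<epsilon> before some point of \<open>I\<close>, it serves as c itself.\<close>

lemma support_bound:
  assumes w: "functional \<alpha> \<beta> n C w" and van: "\<And>g. g \<in> vanishing_subspace a b I \<Longrightarrow> w g = 0"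
    and I: "I \<noteq> {}" "I \<subseteq> E" and s: "s = 1 \<or> s = - 1" and \<epsilon>: "\<epsilon> > 0"
  shows "\<exists>c. exp_bounded s w c \<and> (\<exists>i\<in>I. s * i < s * c + \<epsilon>)"
proof -
  define e where "e = (if s = 1 then \<alpha> else \<beta>)"
  have eE: "e \<in> E" using w by (auto simp: e_def functional_def)
  have ss: "s * (s * x) = x" for x using s by auto
  show ?thesis
  proof (cases "\<exists>i\<in>I. s * i < s * e + \<epsilon>")
    case True then show ?thesis using exp_bounded_endpoint[OF w s] unfolding e_def by blast
  next
    case False
    then have ge: "s * e + \<epsilon> \<le> s * i" if "i \<in> I" for i using that by force
    define m where "m = Inf ((\<lambda>i. s * i) ` I)"
    have "bdd_below ((\<lambda>i. s * i) ` I)" using ge by (intro bdd_belowI2) auto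
    then have m_le: "m \<le> s * i" if "i \<in> I" for i using that by (auto simp: m_def intro: cInf_lower)
    have m_ge: "s * e + \<epsilon> \<le> m" unfolding m_def using I(1) ge by (intro cInf_greatest) auto
    obtain i1 where i1: "i1 \<in> I" "s * i1 < m + \<epsilon> / 2"
      using cInf_lessD[of "(\<lambda>i. s * i) ` I" "m + \<epsilon> / 2"] I(1) \<epsilon> by (auto simp: m_def)
    \<comment> \<open>\<open>q\<close> stops \<epsilon>/4 short of \<open>I\<close>, so that \<eta>
      vanishes on an open neighbourhood of \<open>I\<close>; a one-point \<open>I\<close> with its
      conditions on all derivatives demands this. \<open>p\<close> lies \<epsilon>/2 short of the
      infimum and \<open>i1\<close> less than \<epsilon>/2 beyond it, which adds up to
      \<epsilon>.\<close>
    define p q where "p = s * (m - \<epsilon> / 2)" and "q = s * (m - \<epsilon> / 4)"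
    have pq: "s * p = m - \<epsilon> / 2" "s * q = m - \<epsilon> / 4" by (auto simp: p_def q_def ss)
    have "i1 \<in> E" using i1 I by blast
    have pE: "p \<in> E" by (rule signed_between[OF s eE \<open>i1 \<in> E\<close>]) (use pq m_ge m_le[OF i1(1)] \<epsilon> in auto)
    have qE: "q \<in> E" by (rule signed_between[OF s eE \<open>i1 \<in> E\<close>]) (use pq m_ge m_le[OF i1(1)] \<epsilon> in auto)
    obtain \<eta> where \<eta>: "\<eta> \<in> S" "\<And>t. t \<in> E \<Longrightarrow> s * t \<le> s * p \<Longrightarrow> \<eta> t = 1" "\<And>t. t \<in> E \<Longrightarrow> s * t \<ge> s * q \<Longrightarrow> \<eta> t = 0"
      using cutoff_exists_signed[OF s pE qE] pq \<epsilon> by auto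
    define \<zeta> where "\<zeta> = (\<lambda>t. (- 1) * \<eta> t + exp_monomial a b 0 0 t)"
    have \<zeta>: "\<zeta> \<in> S" unfolding \<zeta>_def by (intro smooth_lincomb \<eta> smooth_exp)
    have \<zeta>0: "\<zeta> t = 0" if "t \<in> E" "s * t < s * p" for t using \<eta>(2) that by (simp add: \<zeta>_def exp_monomial_0)
    have D\<zeta>: "(D ^^ j) \<zeta> t = 0" if "t \<in> E" "s * t < s * p" for j t
      by (rule deriv_op_pow_local_zero[OF open_signed(1)[of s "s * p"]]) (use \<zeta>0 that in auto)
    define \<alpha>' \<beta>' where "\<alpha>' = (if s = 1 then p else min \<alpha> p)" and "\<beta>' = (if s = 1 then max \<beta> p else p)"
    have ab: "\<alpha>' \<in> E" "\<beta>' \<in> E" "\<alpha>' \<le> \<beta>'"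
      using w pE by (auto simp: \<alpha>'_def \<beta>'_def functional_def min_def max_def)
    obtain C' where cut: "functional \<alpha>' \<beta>' n C' (\<lambda>g. w (\<lambda>t. \<zeta> t * g t))"
    proof (rule exE[OF functional_cut[OF w \<zeta> ab]])
      fix t j assume t: "t \<in> {\<alpha>..\<beta>}" "t \<notin> {\<alpha>'..\<beta>'}"
      then have "s * t < s * p" using s by (auto simp: \<alpha>'_def \<beta>'_def split: if_splits)
      then show "(D ^^ j) \<zeta> t = 0" using D\<zeta> functional_interval[OF w t(1)] by blast
    qed
    have "h (\<lambda>g. w (\<lambda>t. \<zeta> t * g t)) l = h w l" for l
    proof -
      let ?e = "exp_monomial a b 0 l"
      have "w (\<lambda>t. \<eta> t * ?e t) = 0"
      proof (rule van, rule vanishing_subspace_open[OF smooth_mult[OF \<eta>(1) smooth_exp] open_signed(2)[where c = "s * q" and s = s]])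
        show "I \<subseteq> {t. s * q < s * t}"
        proof
          fix i assume "i \<in> I"
          then show "i \<in> {t. s * q < s * t}" using m_le[of i] pq \<epsilon> by simp
        qed
      qed (use I \<eta>(3) in auto)
      moreover have "(\<lambda>t. (- 1) * (\<zeta> t * ?e t) + ?e t) = (\<lambda>t. \<eta> t * ?e t)"
        by (auto simp: \<zeta>_def exp_monomial_0 fun_eq_iff algebra_simps)
      ultimately have "(- 1) * w (\<lambda>t. \<zeta> t * ?e t) + w ?e = 0"
        using functional_lincomb[OF w smooth_mult[OF \<zeta> smooth_exp] smooth_exp, of "- 1" l l] by simp
      then show ?thesis by (simp add: hat_def)
    qed
    then have "exp_bounded s (\<lambda>g. w (\<lambda>t. \<zeta> t * g t)) = exp_bounded s w"
      by (auto simp: exp_bounded_def fun_eq_iff)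
    moreover have "(if s = 1 then \<alpha>' else \<beta>') = p" by (simp add: \<alpha>'_def \<beta>'_def)
    ultimately have "exp_bounded s w p" using exp_bounded_endpoint[OF cut s] by simp
    moreover have "s * i1 < s * p + \<epsilon>" using i1(2) pq(1) by linarith
    ultimately show ?thesis using i1(1) by (intro exI[of _ p] conjI bexI[of _ i1])
  qed
qed

text \<open>Otherwise every function vanishing beyond \<open>c1\<close> would be annihilated, and \<open>I\<close> could be shortened
  at its end or, if it is a single point, removed.\<close>

lemma residual_interval_sharp:
  assumes ab: "a < b" and L: "cfun.subspace L" "closedin (smooth_topology a b) L"
    and I: "is_residual_interval a b L I" and u0: "u0 \<in> ann L" "g0 \<in> S" "u0 g0 \<noteq> 0"
    and s: "s = 1 \<or> s = - 1" and i1: "i1 \<in> I" "s * i1 < s * c1"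
  shows "\<exists>u\<in>ann L. \<not> exp_bounded s u c1"
proof (rule ccontr)
  assume "\<not> ?thesis"
  then have all: "\<And>u. u \<in> ann L \<Longrightarrow> exp_bounded s u c1" by blast
  have ss: "s * (s * x) = x" for x using s by auto
  have IE: "I \<subseteq> E" "is_interval I" "closedin (top_of_set E) I" and VL: "vanishing_subspace a b I \<subseteq> L"
    and minI: "\<And>J. relatively_closed_subinterval a b J \<Longrightarrow> vanishing_subspace a b J \<subseteq> L \<Longrightarrow> J \<subseteq> I \<Longrightarrow> J = I"
    using I closedin_subset[of "top_of_set E" I] unfolding is_residual_interval_def relatively_closed_subinterval_def
    by simp_all
  have kill: "u g = 0" if u: "u \<in> ann L" and c: "c \<in> E" "s * c \<le> s * c1" and g: "g \<in> S" "\<And>t. t \<in> E \<Longrightarrow> s * t \<ge> s * c \<Longrightarrow> g t = 0" for u c g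
  proof -
    obtain \<alpha> \<beta> n C where "functional \<alpha> \<beta> n C u" using annihilator_functional[OF u] by blast
    then show ?thesis
      by (rule exp_bounded_annihilates[OF _ s exp_bounded_mono[OF all[OF u] s c(2)] c(1) g])
  qed
  show False
  proof (cases "\<exists>j1\<in>I. \<exists>j2\<in>I. s * j1 < s * j2 \<and> s * j1 < s * c1")
    case True
    then obtain j1 j2 where j: "j1 \<in> I" "j2 \<in> I" "s * j1 < s * j2" "s * j1 < s * c1" by blast
    \<comment> \<open>\<open>c2\<close> lies strictly between \<open>j1\<close> and
      \<open>j2\<close>, hence in \<open>I\<close>, and not beyond \<open>c1\<close>. The shortened
      interval \<open>J\<close> keeps \<open>c2\<close> and \<open>j2\<close> but loses
      \<open>j1\<close>; as neither interval is a single point, both vanishing subspaces are given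
      by values alone.\<close>
    define c2 where "c2 = s * ((s * j1 + min (s * c1) (s * j2)) / 2)"
    have sc2: "s * c2 = (s * j1 + min (s * c1) (s * j2)) / 2" by (simp add: c2_def ss)
    have "x < (x + min y z) / 2 \<and> (x + min y z) / 2 < z \<and> (x + min y z) / 2 \<le> y" if "x < z" "x < y" for x y z :: real
      using that by (simp add: min_def)
    then have c2: "s * j1 < s * c2" "s * c2 < s * j2" "s * c2 \<le> s * c1"
      unfolding sc2 using j(3,4) by blast+
    have between: "t \<in> I" if "i \<in> I" "j \<in> I" "s * i \<le> s * t" "s * t \<le> s * j" for i j t
      using s mem_is_interval_1_I[OF IE(2), of i j t] mem_is_interval_1_I[OF IE(2), of j i t] that by (elim disjE) simp_all
    have "c2 \<in> I" by (rule between[OF j(1,2)]) (use c2 in auto)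
    then have c2E: "c2 \<in> E" "j2 \<in> E" using IE j by auto
    define J where "J = I \<inter> {t. s * c2 \<le> s * t}"
    have "relatively_closed_subinterval a b J"
      unfolding relatively_closed_subinterval_def
    proof (intro conjI)
      show "J \<noteq> {}" using \<open>c2 \<in> I\<close> by (auto simp: J_def)
      show "is_interval J" unfolding is_interval_1 J_def
      proof (intro allI impI ballI)
        fix x y t assume xy: "x \<in> I \<inter> {t. s * c2 \<le> s * t}" "y \<in> I \<inter> {t. s * c2 \<le> s * t}" and t: "x \<le> t \<and> t \<le> y"
        then have "t \<in> I" using mem_is_interval_1_I[OF IE(2), of x y t] by simp
        moreover have "s * c2 \<le> s * t" using xy t s by auto
        ultimately show "t \<in> I \<inter> {t. s * c2 \<le> s * t}" by simp
      qed
      have "closed {t. s * c2 \<le> s * t}" by (intro closed_Collect_le continuous_intros)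
      then show "closedin (top_of_set E) J" unfolding J_def
        using IE(3) by (auto simp: closedin_closed Int_assoc)
    qed
    moreover have "vanishing_subspace a b J \<subseteq> L"
    proof
      fix g assume g: "g \<in> vanishing_subspace a b J"
      have "c2 \<in> J" "j2 \<in> J" "c2 \<noteq> j2" using \<open>c2 \<in> I\<close> j c2 by (auto simp: J_def)
      then have nsJ: "\<nexists>c. J = {c}" by auto
      have nsI: "\<nexists>c. I = {c}" using j by auto
      have gS: "g \<in> S" and gJ: "\<And>t. t \<in> J \<Longrightarrow> g t = 0" using g nsJ by (auto simp: vanishing_subspace_def)
      \<comment> \<open>The transition of \<eta> from \<open>c2\<close> to \<open>j2\<close> takes
        place where g vanishes. So \<eta> g vanishes everywhere beyond \<open>c2\<close> and is
        killed by every annihilator, while (1 - \<eta>) g vanishes on \<open>I\<close> and lies in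
        \<open>L\<close>.\<close>
      obtain \<eta> where \<eta>: "\<eta> \<in> S" "\<And>t. t \<in> E \<Longrightarrow> s * t \<le> s * c2 \<Longrightarrow> \<eta> t = 1" "\<And>t. t \<in> E \<Longrightarrow> s * t \<ge> s * j2 \<Longrightarrow> \<eta> t = 0"
        using cutoff_exists_signed[OF s c2E c2(2)] by blast
      have \<eta>g: "(\<lambda>t. \<eta> t * g t) \<in> S" by (intro smooth_mult \<eta> gS)
      have g2: "(\<lambda>t. (- 1) * (\<eta> t * g t) + g t) \<in> S" by (intro smooth_lincomb \<eta>g gS)
      have "(- 1) * (\<eta> t * g t) + g t = 0" if "t \<in> I" for t
        using that \<eta>(2)[of t] gJ[of t] IE by (cases "s * t \<le> s * c2") (auto simp: J_def)
      then have g2V: "(\<lambda>t. (- 1) * (\<eta> t * g t) + g t) \<in> vanishing_subspace a b I"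
        using g2 nsI by (simp add: vanishing_subspace_def)
      have "u g = 0" if u: "u \<in> ann L" for u
      proof -
        obtain \<alpha> \<beta> n C where uf: "functional \<alpha> \<beta> n C u" using annihilator_functional[OF u] by blast
        have "u (\<lambda>t. \<eta> t * g t) = 0"
        proof (rule kill[OF u c2E(1) c2(3) \<eta>g])
          fix t assume t: "t \<in> E" "s * t \<ge> s * c2"
          show "\<eta> t * g t = 0"
          proof (cases "s * t \<ge> s * j2")
            case True then show ?thesis using \<eta>(3) t by simp
          next
            case False
            then have "t \<in> I" using between[OF \<open>c2 \<in> I\<close> j(2), of t] t by simp
            then show ?thesis using gJ t by (simp add: J_def)
          qed
        qed
        moreover have "u (\<lambda>t. (- 1) * (\<eta> t * g t) + g t) = 0" using annihilator_vanishes[OF u] g2V VL by blast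
        ultimately show ?thesis using functional_lincomb[OF uf \<eta>g gS, of "- 1"] by simp
      qed
      then show "g \<in> L" using annihilator_separates[OF ab L gS] by blast
    qed
    ultimately have "J = I" by (rule minI) (simp add: J_def)
    then have "j1 \<in> J" using j(1) by simp
    then show False using c2(1) by (simp add: J_def)
  next
    case False
    \<comment> \<open>Now \<open>I\<close> is {i1}. The same splitting, made shortly beyond
      \<open>i1\<close>, applies to an arbitrary smooth function: \<eta> g0 vanishes beyond
      \<open>c2\<close>, and (1 - \<eta>) g0 vanishes near \<open>i1\<close>, so that
      \<open>u0\<close> kills both parts of g0.\<close>
    have single: "j = i1" if "j \<in> I" for j
    proof (rule ccontr)
      assume "j \<noteq> i1"
      then have "s * j < s * i1 \<or> s * i1 < s * j" using s by auto
      then show False using False i1 that by (auto dest: less_trans)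
    qed
    have "i1 \<in> E" using i1 IE by blast
    then obtain d where d: "d > 0" "ball i1 d \<subseteq> E" using open_einterval openE by blast
    define \<delta> where "\<delta> = min (d / 2) (s * c1 - s * i1)"
    have min: "\<delta> > 0" "\<delta> \<le> d / 2" "\<delta> \<le> s * c1 - s * i1"
      using d i1 unfolding \<delta>_def by (simp_all only: min_less_iff_conj min.cobounded1 min.cobounded2) simp_all
    define c2 where "c2 = s * (s * i1 + \<delta>)"
    define p where "p = s * (s * i1 + \<delta> / 2)"
    have sc: "s * c2 = s * i1 + \<delta>" "s * p = s * i1 + \<delta> / 2"
      by (simp_all add: c2_def p_def ss)
    have c2: "s * i1 < s * p" "s * p < s * c2" "s * c2 \<le> s * c1" using sc min by auto
    have "c2 = i1 + s * \<delta>" using ss[of i1] by (simp add: c2_def distrib_left)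
    then have "dist i1 c2 < d" using s min d by (auto simp: dist_real_def)
    then have c2E: "c2 \<in> E" using d(2) by auto
    have pE: "p \<in> E" by (rule signed_between[OF s \<open>i1 \<in> E\<close> c2E]) (use c2 in auto)
    obtain \<eta> where \<eta>: "\<eta> \<in> S" "\<And>t. t \<in> E \<Longrightarrow> s * t \<le> s * p \<Longrightarrow> \<eta> t = 1" "\<And>t. t \<in> E \<Longrightarrow> s * t \<ge> s * c2 \<Longrightarrow> \<eta> t = 0"
      using cutoff_exists_signed[OF s pE c2E c2(2)] by blast
    obtain \<alpha> \<beta> n C where uf: "functional \<alpha> \<beta> n C u0" using annihilator_functional[OF u0(1)] by blast
    have \<eta>g: "(\<lambda>t. \<eta> t * g0 t) \<in> S" by (intro smooth_mult \<eta> u0)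
    have "u0 (\<lambda>t. \<eta> t * g0 t) = 0" by (rule kill[OF u0(1) c2E c2(3) \<eta>g]) (simp add: \<eta>(3))
    moreover have "(\<lambda>t. (- 1) * (\<eta> t * g0 t) + g0 t) \<in> vanishing_subspace a b I"
      by (rule vanishing_subspace_open[OF smooth_lincomb[OF \<eta>g u0(2)] open_signed(1)[of s "s * p"]])
         (use single c2 IE \<eta>(2) in auto)
    then have "u0 (\<lambda>t. (- 1) * (\<eta> t * g0 t) + g0 t) = 0" using annihilator_vanishes[OF u0(1)] VL by blast
    ultimately show False using functional_lincomb[OF uf \<eta>g u0(2), of "- 1"] u0(3) by simp
  qed
qed

section \<open>Optimal exponents and type zero\<close>

text \<open>Phragmen-Lindelof for \<open>F\<close>: the transform without its exponential factor,
  multiplied by exp (- \<epsilon> z) and divided by a power of 1 - z. It is bounded on the imaginary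
  axis by the given exponent and on the negative axis by \<open>axis\<close>; the bound in between
  is the improved exponent. Multiplying the variable by \<open>s\<close> brings both cases to the
  left half-plane.\<close>

lemma exp_bounded_improve:
  assumes u: "functional \<alpha> \<beta> n C u" and s: "s = 1 \<or> s = - 1" and bdd: "exp_bounded s u c" and \<epsilon>: "\<epsilon> > 0"
    and axis: "\<And>\<rho>. \<rho> \<ge> r \<Longrightarrow> norm (h u (of_real (- s * \<rho>)) * exp (of_real (c * s * \<rho>))) \<le> exp (- \<epsilon> * \<rho>)"
  shows "exp_bounded s u (c + s * \<epsilon>)"
proof -
  obtain K m where K: "\<And>l. s * Re l \<le> 0 \<Longrightarrow> norm (h u l) \<le> K * (1 + norm l) ^ m * exp (c * Re l)"
    using bdd unfolding exp_bounded_def by blast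
  have ss: "s * s = 1" using s by auto
  have s1: "norm (complex_of_real s * z) = norm z" for z using s by (auto simp: norm_mult)
  \<comment> \<open>The factor exp (\<epsilon> |r|) covers the segment \<rho> < r of the axis, where
    only the original bound is available.\<close>
  define K' where "K' = max 1 (\<bar>K\<bar> * 2 ^ m * exp (\<epsilon> * \<bar>r\<bar>))"
  have K': "K' \<ge> 1" by (simp add: K'_def)
  have K'2: "\<bar>K\<bar> * 2 ^ m * exp (\<epsilon> * \<bar>r\<bar>) \<le> K'" by (simp add: K'_def)
  have "1 \<le> exp (\<epsilon> * \<bar>r\<bar>)" using \<epsilon> by simp
  then have "\<bar>K\<bar> * 2 ^ m * 1 \<le> \<bar>K\<bar> * 2 ^ m * exp (\<epsilon> * \<bar>r\<bar>)" by (intro mult_left_mono) auto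
  then have K'1: "\<bar>K\<bar> * 2 ^ m \<le> K'" using K'2 by linarith
  define B where "B = (\<lambda>z. h u (of_real s * z) * exp (- of_real (c * s) * z))"
  have B: "norm (B z) \<le> \<bar>K\<bar> * 2 ^ m * norm (1 - z) ^ m" if "Re z \<le> 0" for z
  proof -
    have "s * Re (of_real s * z) \<le> 0" using that s by auto
    from K[OF this] have "norm (h u (of_real s * z)) \<le> K * (1 + norm z) ^ m * exp (c * (s * Re z))"
      unfolding s1 by simp
    then have "norm (h u (of_real s * z)) * exp (- (c * s * Re z)) \<le> (K * (1 + norm z) ^ m * exp (c * (s * Re z))) * exp (- (c * s * Re z))"
      by (rule mult_right_mono) simp
    also have "\<dots> = K * (1 + norm z) ^ m" by (simp add: mult.assoc flip: exp_add)
    also have "\<dots> \<le> \<bar>K\<bar> * (2 * norm (1 - z)) ^ m"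
      using one_add_norm_le[OF that] by (intro mult_mono power_mono) auto
    finally show ?thesis by (simp add: B_def norm_mult power_mult_distrib mult.assoc)
  qed
  define F where "F = (\<lambda>z. B z * exp (- of_real \<epsilon> * z) / (of_real K' * (1 - z) ^ m))"
  have nF: "norm (F z) = norm (B z) * exp (- \<epsilon> * Re z) / (K' * norm (1 - z) ^ m)" for z
    using K' by (simp add: F_def norm_mult norm_divide norm_power)
  have nz: "norm (1 - z) ^ m > 0" if "Re z \<le> 0" for z
    using one_add_norm_le[OF that] norm_ge_zero[of z] by (intro zero_less_power) linarith
  have F1: "norm (F z) \<le> exp (- \<epsilon> * Re z)" if "Re z \<le> 0" for z
  proof -
    have "norm (B z) * exp (- \<epsilon> * Re z) \<le> (K' * norm (1 - z) ^ m) * exp (- \<epsilon> * Re z)"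
      using B[OF that] mult_right_mono[OF K'1, of "norm (1 - z) ^ m"] by (intro mult_right_mono) auto
    then show ?thesis unfolding nF using nz[OF that] K' by (simp add: pos_divide_le_eq mult.commute)
  qed
  have "norm (F z) \<le> 1" if z: "Re z \<le> 0" for z
  proof (rule Phragmen_Lindelof_half_plane[OF _ _ _ z, where C = 1 and \<sigma> = \<epsilon>])
    have "(\<lambda>z. h u (of_real s * z)) holomorphic_on {z. Re z < 1}"
      by (rule holomorphic_on_compose_gen[OF _ hat_holomorphic[OF u], unfolded o_def]) (auto intro!: holomorphic_intros)
    then show "F holomorphic_on {z. Re z < 1}" unfolding F_def B_def
      by (intro holomorphic_intros) (use K' in auto)
    show "norm (F z) \<le> 1 * exp (\<epsilon> * norm z)" if "Re z \<le> 0" for z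
    proof -
      have "- Re z \<le> norm z" using abs_Re_le_cmod[of z] by simp
      then have "\<epsilon> * - Re z \<le> \<epsilon> * norm z" using \<epsilon> by (intro mult_left_mono) auto
      then have "exp (- \<epsilon> * Re z) \<le> exp (\<epsilon> * norm z)" by simp
      then show ?thesis using F1[OF that] by (simp only: mult_1_left order_trans)
    qed
    show "norm (F z) \<le> 1" if "Re z \<le> 0" "Re z = 0 \<or> Im z = 0" for z
    proof (cases "Re z = 0")
      case True then show ?thesis using F1[OF that(1)] by simp
    next
      case False
      define \<rho> where "\<rho> = - Re z"
      have z': "z = - of_real \<rho>" "\<rho> \<ge> 0" using that False by (auto simp: \<rho>_def complex_eq_iff)
      have "norm (B z) * exp (\<epsilon> * \<rho>) \<le> K' * norm (1 - z) ^ m"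
      proof (cases "\<rho> \<ge> r")
        case True
        have "norm (B z) \<le> exp (- \<epsilon> * \<rho>)" using axis[OF True] by (simp add: B_def z'(1))
        then have "norm (B z) * exp (\<epsilon> * \<rho>) \<le> exp (- \<epsilon> * \<rho>) * exp (\<epsilon> * \<rho>)" by (intro mult_right_mono) auto
        also have "\<dots> = 1" by (simp flip: exp_add)
        finally have "norm (B z) * exp (\<epsilon> * \<rho>) \<le> 1 * 1" by simp
        also have "1 * 1 \<le> K' * norm (1 - z) ^ m"
        proof (intro mult_mono K' one_le_power)
          show "1 \<le> norm (1 - z)" using complex_Re_le_cmod[of "1 - z"] that by simp
        qed (use K' in auto)
        finally show ?thesis .
      next
        case False
        then have "\<epsilon> * \<rho> \<le> \<epsilon> * \<bar>r\<bar>" using \<epsilon> z' by (intro mult_left_mono) auto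
        then have "norm (B z) * exp (\<epsilon> * \<rho>) \<le> (\<bar>K\<bar> * 2 ^ m * norm (1 - z) ^ m) * exp (\<epsilon> * \<bar>r\<bar>)"
          using B[OF that(1)] by (intro mult_mono) auto
        also have "\<dots> = (\<bar>K\<bar> * 2 ^ m * exp (\<epsilon> * \<bar>r\<bar>)) * norm (1 - z) ^ m" by simp
        also have "\<dots> \<le> K' * norm (1 - z) ^ m" using K'2 by (intro mult_right_mono) auto
        finally show ?thesis .
      qed
      then show ?thesis unfolding nF using nz[OF that(1)] K' by (simp add: \<rho>_def pos_divide_le_eq)
    qed
  qed
  then have "norm (B z) * exp (- \<epsilon> * Re z) / (K' * norm (1 - z) ^ m) \<le> 1" if "Re z \<le> 0" for z
    using that unfolding nF .
  then have Fz: "norm (B z) * exp (- \<epsilon> * Re z) \<le> K' * norm (1 - z) ^ m" if "Re z \<le> 0" for z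
    using nz[OF that] K' that by (fastforce simp: pos_divide_le_eq)
  have "norm (h u l) \<le> K' * (1 + norm l) ^ m * exp ((c + s * \<epsilon>) * Re l)" if l: "s * Re l \<le> 0" for l
  proof -
    define z where "z = of_real s * l"
    have z: "Re z = s * Re l" "of_real s * z = l" "norm z = norm l"
      using ss s1 by (auto simp: z_def simp flip: mult.assoc of_real_mult)
    have "norm (B z) = norm (h u l) * exp (- (c * Re l))"
      using ss by (simp add: B_def z norm_mult mult.assoc)
    then have "norm (h u l) * exp (- (c * Re l)) * exp (- \<epsilon> * (s * Re l)) \<le> K' * norm (1 - z) ^ m"
      using Fz[of z] l z by simp
    also have "\<dots> \<le> K' * (1 + norm l) ^ m"
      using norm_triangle_ineq4[of 1 z] z K' by (intro mult_left_mono power_mono) auto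
    finally have "norm (h u l) * exp (- ((c + s * \<epsilon>) * Re l)) \<le> K' * (1 + norm l) ^ m"
      by (simp add: algebra_simps flip: exp_add)
    then have "norm (h u l) * exp (- ((c + s * \<epsilon>) * Re l)) * exp ((c + s * \<epsilon>) * Re l) \<le> K' * (1 + norm l) ^ m * exp ((c + s * \<epsilon>) * Re l)"
      by (rule mult_right_mono) simp
    then show ?thesis by (simp add: mult.assoc flip: exp_add)
  qed
  then show ?thesis unfolding exp_bounded_def by blast
qed

text \<open>Injectivity of the transform: a vanishing one satisfies every exponential bound in both
  directions. A cutoff splits f into a part that vanishes to the right of \<open>q\<close> and one
  that vanishes to the left of \<alpha>, and \<open>exp_bounded_annihilates\<close> kills
  each.\<close>

lemma hat_zero_imp:
  assumes u: "functional \<alpha> \<beta> n C u" and z: "\<And>l. h u l = 0" and f: "f \<in> S"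
  shows "u f = 0"
proof -
  have bdd: "exp_bounded s u c" for s c
    unfolding exp_bounded_def by (rule exI[of _ 0], rule exI[of _ 0]) (simp add: z)
  have "\<alpha> \<in> E" using u by (simp add: functional_def)
  then obtain d where d: "d > 0" "ball \<alpha> d \<subseteq> E" using open_einterval openE by blast
  define q where "q = \<alpha> + d / 2"
  have q: "q \<in> E" "\<alpha> < q" using d by (auto simp: q_def dist_real_def intro!: subsetD[OF d(2)])
  obtain \<eta> where \<eta>: "\<eta> \<in> S" "\<And>t. t \<in> E \<Longrightarrow> t \<le> \<alpha> \<Longrightarrow> \<eta> t = 1" "\<And>t. t \<in> E \<Longrightarrow> t \<ge> q \<Longrightarrow> \<eta> t = 0"
    using cutoff_exists[OF \<open>\<alpha> \<in> E\<close> q] by blast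
  have \<eta>f: "(\<lambda>t. \<eta> t * f t) \<in> S" by (intro smooth_mult \<eta> f)
  have g: "(\<lambda>t. (- 1) * (\<eta> t * f t) + f t) \<in> S" by (intro smooth_lincomb \<eta>f f)
  have "u (\<lambda>t. \<eta> t * f t) = 0"
    by (rule exp_bounded_annihilates[OF u _ bdd q(1) \<eta>f, of 1]) (use \<eta>(3) in auto)
  moreover have "u (\<lambda>t. (- 1) * (\<eta> t * f t) + f t) = 0"
    by (rule exp_bounded_annihilates[OF u _ bdd \<open>\<alpha> \<in> E\<close> g, of "- 1"]) (use \<eta>(2) in auto)
  ultimately show ?thesis using functional_lincomb[OF u \<eta>f f, of "- 1"] by simp
qed

text \<open>Sharpness of \<open>I\<close> yields an annihilator \<open>u\<close> whose best exponent
  x exceeds an exponent of \<open>w\<close> by at most \<epsilon>/2, in the direction of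
  \<open>s\<close>. Stepping back by \<epsilon>/2 from x gives a c valid for both, while c + s
  \<epsilon> overshoots x by \<epsilon>/2 and fails for \<open>u\<close>.\<close>

lemma annihilator_exponent:
  assumes ab: "a < b" and L: "cfun.subspace L" "closedin (smooth_topology a b) L"
    and I: "is_residual_interval a b L I" and u0: "u0 \<in> ann L" "g0 \<in> S" "u0 g0 \<noteq> 0"
    and w: "functional \<alpha> \<beta> n C w" and van: "\<And>g. g \<in> vanishing_subspace a b I \<Longrightarrow> w g = 0"
    and s: "s = 1 \<or> s = - 1" and \<epsilon>: "\<epsilon> > 0"
  shows "\<exists>c. \<exists>u\<in>ann L. exp_bounded s w c \<and> exp_bounded s u c \<and> \<not> exp_bounded s u (c + s * \<epsilon>)"
proof -
  have ss: "s * (s * x) = x" for x using s by auto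
  have I0: "I \<noteq> {}" "I \<subseteq> E"
    using I closedin_subset[of "top_of_set E" I] unfolding is_residual_interval_def relatively_closed_subinterval_def
    by simp_all
  obtain c0 i where c0: "exp_bounded s w c0" "i \<in> I" "s * i < s * c0 + \<epsilon> / 2"
    using support_bound[OF w van I0 s, of "\<epsilon> / 2"] \<epsilon> by auto
  define c1 where "c1 = s * (s * c0 + \<epsilon> / 2)"
  have c1: "s * c1 = s * c0 + \<epsilon> / 2" by (simp add: c1_def ss)
  then obtain u where u: "u \<in> ann L" "\<not> exp_bounded s u c1"
    using residual_interval_sharp[OF ab L I u0 s c0(2), of c1] c0(3) by auto
  obtain \<alpha>' \<beta>' n' C' where uf: "functional \<alpha>' \<beta>' n' C' u" using annihilator_functional[OF u(1)] by blast
  define T where "T = {x. exp_bounded s u (s * x)}"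
  have ub: "x < s * c1" if "x \<in> T" for x
  proof (rule ccontr)
    assume "\<not> x < s * c1"
    then have "s * c1 \<le> s * (s * x)" by (simp add: ss)
    then show False using exp_bounded_mono[OF _ s] that u(2) by (auto simp: T_def)
  qed
  then have bdd: "bdd_above T" by (intro bdd_aboveI[of _ "s * c1"]) (auto intro: less_imp_le)
  have "s * (if s = 1 then \<alpha>' else \<beta>') \<in> T" using exp_bounded_endpoint[OF uf s] by (simp only: T_def ss mem_Collect_eq)
  then have ne: "T \<noteq> {}" by blast
  define x where "x = Sup T"
  have "x \<le> s * c1" unfolding x_def by (intro cSup_least ne) (auto intro: less_imp_le ub)
  define c where "c = s * (x - \<epsilon> / 2)"
  have sc: "s * c = x - \<epsilon> / 2" by (simp add: c_def ss)
  have "exp_bounded s w c"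
    by (rule exp_bounded_mono[OF c0(1) s]) (use \<open>x \<le> s * c1\<close> c1 sc in linarith)
  moreover have "exp_bounded s u c"
  proof -
    obtain y where y: "y \<in> T" "x - \<epsilon> / 2 < y" using less_cSupD[OF ne, of "x - \<epsilon> / 2"] \<epsilon> by (auto simp: x_def)
    then have "exp_bounded s u (s * y)" by (simp add: T_def)
    then show ?thesis by (rule exp_bounded_mono[OF _ s]) (use y sc in \<open>simp add: ss\<close>)
  qed
  moreover have "\<not> exp_bounded s u (c + s * \<epsilon>)"
  proof
    assume "exp_bounded s u (c + s * \<epsilon>)"
    moreover have "c + s * \<epsilon> = s * (x + \<epsilon> / 2)" by (simp add: c_def algebra_simps)
    ultimately have "x + \<epsilon> / 2 \<in> T" by (simp add: T_def)
    then have "x + \<epsilon> / 2 \<le> x" unfolding x_def by (intro cSup_upper bdd)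
    then show False using \<epsilon> by simp
  qed
  ultimately show ?thesis using u(1) by blast
qed

text \<open>The witness \<open>B\<close> is the transform of the annihilator \<open>u\<close> from
  \<open>annihilator_exponent\<close> without its exponential factor. The exponent common to
  \<open>u\<close> and \<open>w\<close> bounds \<open>B\<close> and, through
  \<open>resolvent_transform_bound\<close>, also its product with \<open>M\<close> by polynomials.
  Were \<open>B\<close> below exp (- \<epsilon> \<rho>) on a whole ray,
  \<open>exp_bounded_improve\<close> would give \<open>u\<close> the exponent that is
  excluded.\<close>

lemma resolvent_transform_dominated:
  assumes ab: "a < b" and L: "D_invariant_subspace a b L" "discrete (D_spectrum a b L)"
    and I: "is_residual_interval a b L I" and f: "f \<in> L"
    and w: "functional \<alpha> \<beta> n C w" and van: "\<And>g. g \<in> vanishing_subspace a b I \<Longrightarrow> w g = 0"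
    and M: "resolvent_transform L w f M" and s: "s = 1 \<or> s = - 1" and \<epsilon>: "\<epsilon> > 0"
  shows "dominated_left (\<lambda>z. M (of_real s * z)) \<epsilon>"
proof -
  have L': "cfun.subspace L" "closedin (smooth_topology a b) L" using L(1) by (auto simp: D_invariant_subspace_def)
  have fS: "f \<in> S" using f invariant_subset[OF L(1)] by blast
  obtain u0 l0 where u0: "u0 \<in> ann L" "h u0 l0 \<noteq> 0" using annihilator_nontrivial[OF ab L] by blast
  obtain c u where u: "u \<in> ann L" and ew: "exp_bounded s w c" and eu: "exp_bounded s u c"
    and neu: "\<not> exp_bounded s u (c + s * \<epsilon>)"
    using annihilator_exponent[OF ab L' I u0(1) smooth_exp u0(2)[unfolded hat_def] w van s \<epsilon>] by blast
  obtain \<alpha>' \<beta>' n' C' where uf: "functional \<alpha>' \<beta>' n' C' u" using annihilator_functional[OF u] by blast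
  obtain K1 m1 where K1: "\<And>l. s * Re l \<le> 0 \<Longrightarrow> norm (h w l) \<le> K1 * (1 + norm l) ^ m1 * exp (c * Re l)"
    using ew unfolding exp_bounded_def by blast
  obtain K2 m2 where K2: "\<And>l. s * Re l \<le> 0 \<Longrightarrow> norm (h u l) \<le> K2 * (1 + norm l) ^ m2 * exp (c * Re l)"
    using eu unfolding exp_bounded_def by blast
  obtain K3 where K3: "\<And>l. norm (M l) * norm (h u l) \<le> K3 * (1 + norm l) ^ max n n' * (norm (h u l) + norm (h w l))"
    using resolvent_transform_bound[OF w uf u fS M] by blast
  define m where "m = m1 + m2 + max n n'"
  define K where "K = \<bar>K2\<bar> + \<bar>K3\<bar> * (\<bar>K1\<bar> + \<bar>K2\<bar>)"
  define B where "B = (\<lambda>z. h u (of_real s * z) * exp (- of_real (c * s) * z))"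
  have norm_s: "norm (complex_of_real s * z) = norm z" for z using s by (auto simp: norm_mult)
  have Re_s: "s * Re (of_real s * z) = Re z" for z using s by auto
  have "norm (B z) \<le> K * (1 + norm z) ^ m \<and> norm (M (of_real s * z) * B z) \<le> K * (1 + norm z) ^ m" if z: "Re z \<le> 0" for z
  proof -
    define l where "l = of_real s * z"
    define P e where "P = 1 + norm z" and "e = exp (c * Re l)"
    have l: "s * Re l \<le> 0" using z by (simp only: l_def Re_s)
    have nl: "1 + norm l = P" by (simp add: l_def P_def norm_s)
    have P: "P \<ge> 1" by (simp add: P_def)
    have e: "e > 0" by (simp add: e_def)
    have nB: "norm (B z) = norm (h u l) / e"
      by (simp add: B_def l_def e_def norm_mult exp_minus divide_inverse norm_inverse mult.assoc)
    have hw: "norm (h w l) \<le> \<bar>K1\<bar> * P ^ (m1 + m2) * e"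
    proof -
      have "norm (h w l) \<le> K1 * P ^ m1 * e" using K1[OF l] by (simp only: nl e_def)
      also have "\<dots> \<le> \<bar>K1\<bar> * P ^ (m1 + m2) * e"
        using P e by (intro mult_right_mono mult_mono power_increasing) auto
      finally show ?thesis .
    qed
    have hu: "norm (h u l) \<le> \<bar>K2\<bar> * P ^ (m1 + m2) * e"
    proof -
      have "norm (h u l) \<le> K2 * P ^ m2 * e" using K2[OF l] by (simp only: nl e_def)
      also have "\<dots> \<le> \<bar>K2\<bar> * P ^ (m1 + m2) * e"
        using P e by (intro mult_right_mono mult_mono power_increasing) auto
      finally show ?thesis .
    qed
    have "norm (B z) \<le> \<bar>K2\<bar> * P ^ (m1 + m2)" unfolding nB using hu e by (simp add: pos_divide_le_eq)
    also have "\<dots> \<le> K * P ^ m"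
      using P by (intro mult_mono power_increasing) (auto simp: K_def m_def)
    finally have 1: "norm (B z) \<le> K * P ^ m" .
    have "norm (M l) * norm (h u l) \<le> K3 * P ^ max n n' * (norm (h u l) + norm (h w l))" using K3[of l] by (simp only: nl)
    also have "\<dots> \<le> \<bar>K3\<bar> * P ^ max n n' * (\<bar>K2\<bar> * P ^ (m1 + m2) * e + \<bar>K1\<bar> * P ^ (m1 + m2) * e)"
      using P hw hu by (intro mult_mono add_mono) auto
    also have "\<dots> = (\<bar>K3\<bar> * (\<bar>K1\<bar> + \<bar>K2\<bar>) * P ^ m) * e" by (simp add: m_def power_add algebra_simps)
    also have "\<dots> \<le> (K * P ^ m) * e" using P e by (intro mult_right_mono) (auto simp: K_def)
    finally have "norm (M l) * norm (B z) \<le> K * P ^ m" unfolding nB using e by (simp add: pos_divide_le_eq)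
    with 1 show ?thesis by (simp add: norm_mult l_def P_def)
  qed
  moreover have "B holomorphic_on UNIV"
  proof -
    have "(\<lambda>z. h u (of_real s * z)) holomorphic_on UNIV"
      by (rule holomorphic_on_compose_gen[OF _ hat_holomorphic[OF uf], unfolded o_def]) (auto intro!: holomorphic_intros)
    then show ?thesis unfolding B_def by (intro holomorphic_intros)
  qed
  moreover have "\<exists>\<rho>\<ge>r. norm (B (- of_real \<rho>)) \<ge> exp (- \<epsilon> * \<rho>)" for r
  proof (rule ccontr)
    assume "\<not> ?thesis"
    then have "norm (B (- of_real \<rho>)) \<le> exp (- \<epsilon> * \<rho>)" if "\<rho> \<ge> r" for \<rho> using that by force
    then have "norm (h u (of_real (- s * \<rho>)) * exp (of_real (c * s * \<rho>))) \<le> exp (- \<epsilon> * \<rho>)" if "\<rho> \<ge> r" for \<rho>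
      using that by (simp add: B_def)
    from exp_bounded_improve[OF uf s eu \<epsilon> this] neu show False by blast
  qed
  ultimately show ?thesis unfolding dominated_left_def by blast
qed

lemma resolvent_transform_zero_type:
  assumes "a < b" and L: "D_invariant_subspace a b L" "discrete (D_spectrum a b L)"
    and I: "is_residual_interval a b L I" and f: "f \<in> L"
    and w: "functional \<alpha> \<beta> n C w" and van: "\<And>g. g \<in> vanishing_subspace a b I \<Longrightarrow> w g = 0"
    and M: "resolvent_transform L w f M" and "\<epsilon> > 0"
  shows "\<exists>C. \<forall>z. norm (M z) \<le> C * exp (\<epsilon> * norm z)"
proof (rule zero_exponential_type[OF _ _ _ \<open>\<epsilon> > 0\<close>])
  show "M holomorphic_on UNIV" using M by (simp add: resolvent_transform_def)
  show "dominated_left M \<delta>" if "\<delta> > 0" for \<delta>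
    using resolvent_transform_dominated[OF assms(1) L I f w van M _ that, of 1] by simp
  show "dominated_left (\<lambda>z. M (- z)) \<delta>" if "\<delta> > 0" for \<delta>
    using resolvent_transform_dominated[OF assms(1) L I f w van M _ that, of "- 1"] by simp
qed

section \<open>The dichotomy between the two resolvent transforms\<close>

text \<open>The bound for \<open>M\<close> has |h \<psi>| as factor on the left and the one for
  \<open>N\<close> has |h \<phi>|, while both have the sum of the two on the right. The larger one
  absorbs the sum at the cost of a factor 2.\<close>

lemma resolvent_transform_min_bound:
  assumes \<phi>: "functional \<alpha> \<beta> p C \<phi>" "\<phi> \<in> ann L\<^sub>2" and \<psi>: "functional \<alpha>' \<beta>' p' C' \<psi>" "\<psi> \<in> ann L\<^sub>1"
    and f: "f\<^sub>1 \<in> S" "f\<^sub>2 \<in> S" and nz: "h \<phi> l0 \<noteq> 0"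
    and M: "resolvent_transform L\<^sub>1 \<phi> f\<^sub>1 M" and N: "resolvent_transform L\<^sub>2 \<psi> f\<^sub>2 N"
  shows "\<exists>C. \<forall>l. norm (M l) \<le> C * (1 + norm l) ^ max p p' \<or> norm (N l) \<le> C * (1 + norm l) ^ max p p'"
proof -
  obtain K1 where K1: "\<And>l. norm (M l) * norm (h \<psi> l) \<le> K1 * (1 + norm l) ^ max p p' * (norm (h \<psi> l) + norm (h \<phi> l))"
    using resolvent_transform_bound[OF \<phi>(1) \<psi> f(1) M] by blast
  obtain K2 where K2: "\<And>l. norm (N l) * norm (h \<phi> l) \<le> K2 * (1 + norm l) ^ max p p' * (norm (h \<phi> l) + norm (h \<psi> l))"
    using resolvent_transform_bound[OF \<psi>(1) \<phi> f(2) N] by (auto simp: max.commute)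
  define K where "K = 2 * (\<bar>K1\<bar> + \<bar>K2\<bar>)"
  define Z where "Z = {l. norm (M l) \<le> K * (1 + norm l) ^ max p p'} \<union> {l. norm (N l) \<le> K * (1 + norm l) ^ max p p'}"
  have quot: "X \<le> K * P" if "X * x \<le> k * P * (x + y)" "0 \<le> y" "y \<le> x" "x > 0" "P \<ge> 1" "\<bar>k\<bar> \<le> \<bar>K1\<bar> + \<bar>K2\<bar>" for X x y k P :: real
  proof -
    have "k * P * (x + y) \<le> (\<bar>K1\<bar> + \<bar>K2\<bar>) * P * (2 * x)"
      using that by (intro mult_mono) auto
    then have "X * x \<le> (K * P) * x" using that(1) by (simp add: K_def mult_ac)
    then show ?thesis using that(4) by simp
  qed
  have Z: "l \<in> Z" if l: "h \<phi> l \<noteq> 0" for l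
  proof (cases "norm (h \<phi> l) \<le> norm (h \<psi> l)")
    case True
    moreover from this have "norm (h \<psi> l) > 0" using l by (meson less_le_trans zero_less_norm_iff)
    ultimately have "norm (M l) \<le> K * (1 + norm l) ^ max p p'" by (intro quot[OF K1]) auto
    then show ?thesis by (simp add: Z_def)
  next
    case False
    then have "norm (N l) \<le> K * (1 + norm l) ^ max p p'" using l by (intro quot[OF K2]) auto
    then show ?thesis by (simp add: Z_def)
  qed
  \<comment> \<open>Where h \<phi> vanishes, h \<psi> may vanish too, and neither bound can be
    divided. Such points are limits of points of \<open>Z\<close>, because the zeros of h \<phi> are
    isolated.\<close>
  have "closed Z"
  proof -
    have "continuous_on UNIV M" "continuous_on UNIV N"
      using M N holomorphic_on_imp_continuous_on by (auto simp: resolvent_transform_def)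
    then show ?thesis unfolding Z_def by (intro closed_Un closed_Collect_le continuous_intros)
  qed
  have "l \<in> Z" for l
  proof -
    have "\<forall>\<^sub>F z in at l. z \<in> Z"
      using entire_zero_isolated[OF hat_holomorphic[OF \<phi>(1)] nz, of l] by (rule eventually_mono) (rule Z)
    then have "\<not> (\<forall>\<^sub>F z in at l. z \<notin> Z)"
      using eventually_conj[of "\<lambda>z. z \<in> Z" "at l" "\<lambda>z. z \<notin> Z"] by auto
    then show ?thesis using \<open>closed Z\<close> by (simp add: closed_limpt islimpt_iff_eventually)
  qed
  then show ?thesis unfolding Z_def by blast
qed

end

theorem theorem1p4:
  fixes a b :: ereal and L\<^sub>1 L\<^sub>2 :: "(real \<Rightarrow> complex) set" and I :: "real set"
  assumes "a < b"
    and "D_invariant_subspace a b L\<^sub>1" and "D_invariant_subspace a b L\<^sub>2"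
    and "discrete_simple_spectrum a b L\<^sub>1" and "discrete_simple_spectrum a b L\<^sub>2"
    and "is_residual_interval a b L\<^sub>1 I" and "is_residual_interval a b L\<^sub>2 I"
    and "D_spectrum a b L\<^sub>1 = D_spectrum a b L\<^sub>2"
  shows "L\<^sub>1 \<subseteq> L\<^sub>2 \<or> L\<^sub>2 \<subseteq> L\<^sub>1"
proof (rule ccontr)
  note ab = assms(1) and L = assms(2,3) and simple = assms(4,5) and I = assms(6,7) and spec = assms(8)
  assume "\<not> ?thesis"
  then obtain f g where f: "f \<in> L\<^sub>1" "f \<notin> L\<^sub>2" and g: "g \<in> L\<^sub>2" "g \<notin> L\<^sub>1" by blast
  have disc: "discrete (D_spectrum a b L\<^sub>1)" "discrete (D_spectrum a b L\<^sub>2)"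
    using simple by (auto simp: discrete_simple_spectrum_def)
  have sub: "L\<^sub>1 \<subseteq> smooth_functions a b" "L\<^sub>2 \<subseteq> smooth_functions a b" using L invariant_subset by blast+
  have fS: "f \<in> smooth_functions a b" and gS: "g \<in> smooth_functions a b" using f g sub by auto
  have iter: "(deriv_op a b ^^ k) f \<in> L\<^sub>1" "(deriv_op a b ^^ k) g \<in> L\<^sub>2" for k
    using f g L by (induction k) (auto simp: D_invariant_subspace_def)
  obtain \<phi> where \<phi>: "\<phi> \<in> annihilator a b L\<^sub>2" "\<phi> f \<noteq> 0"
    using annihilator_separates[OF ab _ _ fS f(2)] L(2) by (auto simp: D_invariant_subspace_def)
  obtain \<psi> where \<psi>: "\<psi> \<in> annihilator a b L\<^sub>1" "\<psi> g \<noteq> 0"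
    using annihilator_separates[OF ab _ _ gS g(2)] L(1) by (auto simp: D_invariant_subspace_def)
  obtain \<alpha> \<beta> n C where \<phi>': "functional a b \<alpha> \<beta> n C \<phi>" using annihilator_functional[OF \<phi>(1)] by blast
  obtain \<alpha>' \<beta>' n' C' where \<psi>': "functional a b \<alpha>' \<beta>' n' C' \<psi>" using annihilator_functional[OF \<psi>(1)] by blast
  \<comment> \<open>The exponentials at the points of the common spectrum lie in both subspaces, so
    each functional kills them although it annihilates only one of the two.\<close>
  have hat_spec: "hat a b \<phi> m = 0" "hat a b \<psi> m = 0" if "m \<in> D_spectrum a b L\<^sub>1" for m
    using that simple spec annihilator_vanishes[OF \<phi>(1)] annihilator_vanishes[OF \<psi>(1)]
    by (auto simp: hat_def discrete_simple_spectrum_def)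
  have van: "\<phi> k = 0" "\<psi> k = 0" if "k \<in> vanishing_subspace a b I" for k
    using that I annihilator_vanishes[OF \<phi>(1)] annihilator_vanishes[OF \<psi>(1)]
    by (auto simp: is_residual_interval_def)
  obtain l0 where l0: "hat a b \<phi> l0 \<noteq> 0" using hat_zero_imp[OF \<phi>' _ fS] \<phi>(2) by blast
  have "\<exists>M. resolvent_transform a b L\<^sub>1 \<phi> ((deriv_op a b ^^ k) f) M" for k
    by (rule resolvent_transform_exists[OF ab L(1) simple(1) \<phi>' _ iter(1)]) (rule hat_spec)
  then obtain M where M: "\<And>k. resolvent_transform a b L\<^sub>1 \<phi> ((deriv_op a b ^^ k) f) (M k)" by metis
  have "\<exists>N. resolvent_transform a b L\<^sub>2 \<psi> ((deriv_op a b ^^ k) g) N" for k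
    by (rule resolvent_transform_exists[OF ab L(2) simple(2) \<psi>' _ iter(2)]) (use hat_spec spec in auto)
  then obtain N where N: "\<And>k. resolvent_transform a b L\<^sub>2 \<psi> ((deriv_op a b ^^ k) g) (N k)" by metis
  have holo: "M k holomorphic_on UNIV" "N k holomorphic_on UNIV" for k
    using M N by (auto simp: resolvent_transform_def)
  have rec: "M (Suc k) l = l * M k l + \<phi> ((deriv_op a b ^^ k) f)" "N (Suc k) l = l * N k l + \<psi> ((deriv_op a b ^^ k) g)" for k l
    using resolvent_transform_deriv[OF ab L(1) disc(1) \<phi>' iter(1) M M[of "Suc k", unfolded funpow.simps o_apply]]
      resolvent_transform_deriv[OF ab L(2) disc(2) \<psi>' iter(2) N N[of "Suc k", unfolded funpow.simps o_apply]] by auto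
  \<comment> \<open>The orders of \<phi> and \<psi>: passing to derivatives of f and g changes the
    constants in the bounds but not this degree.\<close>
  define p where "p = max n n'"
  obtain K where K: "\<And>l. norm (M (p + 2) l) \<le> K * (1 + norm l) ^ p \<or> norm (N (p + 2) l) \<le> K * (1 + norm l) ^ p"
    using resolvent_transform_min_bound[OF \<phi>' \<phi>(1) \<psi>' \<psi>(1) _ _ l0 M N] iter sub unfolding p_def by blast
  have "(\<exists>C. \<forall>l. norm (M (p + 2) l) \<le> C * (1 + norm l) ^ p) \<or> (\<exists>C. \<forall>l. norm (N (p + 2) l) \<le> C * (1 + norm l) ^ p)"
    by (rule entire_min_polynomial[OF holo resolvent_transform_zero_type[OF ab L(1) disc(1) I(1) iter(1) \<phi>' van(1) M]
          resolvent_transform_zero_type[OF ab L(2) disc(2) I(2) iter(2) \<psi>' van(2) N] K])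
  then show False
  proof (elim disjE exE)
    fix C assume "\<forall>l. norm (M (p + 2) l) \<le> C * (1 + norm l) ^ p"
    then have "\<phi> ((deriv_op a b ^^ 0) f) = 0" using shifted_sequence_trivial[of M "\<lambda>k. \<phi> ((deriv_op a b ^^ k) f)", OF holo(1) rec(1)] by blast
    then show False using \<phi>(2) by simp
  next
    fix C assume "\<forall>l. norm (N (p + 2) l) \<le> C * (1 + norm l) ^ p"
    then have "\<psi> ((deriv_op a b ^^ 0) g) = 0" using shifted_sequence_trivial[of N "\<lambda>k. \<psi> ((deriv_op a b ^^ k) g)", OF holo(2) rec(2)] by blast
    then show False using \<psi>(2) by simp
  qed
qed

end
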